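(* Let $\eta\in L_2(\mathbb S^2)$ satisfy (A1) $\int_{\mathbb S^2}\frac{|\eta(\theta,\varphi)|}{1+\cos\theta}\,d\Sigma<\infty$, (A2) $\int_{\mathbb S^2}|\eta(\theta,\varphi)|\frac{\tan^2(\theta/2)}{1+\cos\theta}\,d\Sigma<\infty$, (A3) $\operatorname*{ess\,sup}_{(\theta,\varphi)\in\mathbb S^2}|\eta(\theta,\varphi)|\frac{1+\tan^2(\theta/2)}{1-\cos\theta}<\infty$, (C) $\int_{\mathbb S^2}\frac{\eta(\theta,\varphi)}{1+\cos\theta}\,d\Sigma=0$. Then the sequence $(G_\ell)_{\ell\in\mathbb N_0}$ is bounded.
   Context: $\mathbb S^2\subset\mathbb R^3$ is the unit sphere; points are written $\omega=(\theta,\varphi)=(\sin\theta\cos\varphi,\sin\theta\sin\varphi,\cos\theta)$ with $\theta\in[0,\pi]$, $\varphi\in[0,2\pi)$; $d\Sigma(\omega)=\sin\theta\,d\theta\,d\varphi$, $L_2(\mathbb S^2)=L_2(\mathbb S^2,\Sigma)$. For $a>0$ let $\omega_a=(\theta_a,\varphi)$ with $\theta_a\in[0,\pi]$, $\tan(\theta_a/2)=a\tan(\theta/2)$; $\kappa(a,\theta)=\frac{4a^2}{[(a^2-1)\cos\theta+(a^2+1)]^2}$; $(D_af)(\omega)=\kappa(a,\theta)^{1/2}f(\omega_{1/a})$; $\eta_a:=D_a\eta$. Spherical harmonics $Y_\ell^m(\theta,\varphi)=\sqrt{\frac{2\ell+1}{4\pi}\frac{(\ell-m)!}{(\ell+m)!}}P_\ell^m(\cos\theta)e^{im\varphi}$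 form an orthonormal basis; $\Pi_\ell$ is the orthogonal projection onto $\mathrm{span}\{Y_\ell^m:|m|\le\ell\}$. $G_\ell=\frac1{2\ell+1}\int_0^\infty\|\Pi_\ell\eta_a\|^2\frac{da}{a^3}\in[0,\infty]$. *)

theory Defs
  imports "HOL-Probability.Probability" "HOL-Computational_Algebra.Polynomial"
begin

text \<open>Points of the sphere are represented by spherical coordinates
  (theta, phi) in [0,pi] x [0,2pi); the surface measure is sin theta dtheta dphi.\<close>

definition sphere_measure :: "(real \<times> real) measure" where
  "sphere_measure = density (restrict_space lborel ({0..pi} \<times> {0..<2*pi}))
      (\<lambda>\<omega>. ennreal (sin (fst \<omega>)))"

definition L2_sphere :: "(real \<times> real \<Rightarrow> complex) set" where
  "L2_sphere = {f. f \<in> borel_measurable sphere_measure \<and>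
      integrable sphere_measure (\<lambda>\<omega>. (cmod (f \<omega>))\<^sup>2)}"

definition inner_S2 :: "(real \<times> real \<Rightarrow> complex) \<Rightarrow> (real \<times> real \<Rightarrow> complex) \<Rightarrow> complex" where
  "inner_S2 f g = integral\<^sup>L sphere_measure (\<lambda>\<omega>. f \<omega> * cnj (g \<omega>))"

definition normsq_S2 :: "(real \<times> real \<Rightarrow> complex) \<Rightarrow> ennreal" where
  "normsq_S2 f = (\<integral>\<^sup>+\<omega>. ennreal ((cmod (f \<omega>))\<^sup>2) \<partial>sphere_measure)"

text \<open>Associated Legendre functions via the Rodrigues formula, valid for |m| \<le> l:
  P_l^m(x) = (-1)^m / (2^l l!) (1-x^2)^(m/2) d^(l+m)/dx^(l+m) (x^2-1)^l.\<close>

definition assoc_legendre :: "nat \<Rightarrow> int \<Rightarrow> real \<Rightarrow> real" where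
  "assoc_legendre l m x =
     (-1) ^ nat \<bar>m\<bar> / (2 ^ l * fact l) * (1 - x\<^sup>2) powr (real_of_int m / 2) *
     poly ((pderiv ^^ nat (int l + m)) ([:-1, 0, 1:] ^ l)) x"

definition sph_harm :: "nat \<Rightarrow> int \<Rightarrow> real \<times> real \<Rightarrow> complex" where
  "sph_harm l m \<omega> =
     complex_of_real (sqrt ((2 * real l + 1) / (4 * pi) *
        (fact (nat (int l - m)) / fact (nat (int l + m)))) *
        assoc_legendre l m (cos (fst \<omega>)))
     * exp (\<i> * of_int m * of_real (snd \<omega>))"

definition proj_l :: "nat \<Rightarrow> (real \<times> real \<Rightarrow> complex) \<Rightarrow> real \<times> real \<Rightarrow> complex" where
  "proj_l l f \<omega> = (\<Sum>m\<in>{-int l..int l}. inner_S2 f (sph_harm l m) * sph_harm l m \<omega>)"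

definition theta_dil :: "real \<Rightarrow> real \<Rightarrow> real" where
  "theta_dil a \<theta> = (if \<theta> = pi then pi else 2 * arctan (a * tan (\<theta> / 2)))"

definition kappa :: "real \<Rightarrow> real \<Rightarrow> real" where
  "kappa a \<theta> = 4 * a\<^sup>2 / ((a\<^sup>2 - 1) * cos \<theta> + (a\<^sup>2 + 1))\<^sup>2"

definition dilation :: "real \<Rightarrow> (real \<times> real \<Rightarrow> complex) \<Rightarrow> real \<times> real \<Rightarrow> complex" where
  "dilation a f \<omega> = complex_of_real (sqrt (kappa a (fst \<omega>))) *
      f (theta_dil (1 / a) (fst \<omega>), snd \<omega>)"

definition G_coeff :: "(real \<times> real \<Rightarrow> complex) \<Rightarrow> nat \<Rightarrow> ennreal" where
  "G_coeff \<eta> l = ennreal (1 / (2 * real l + 1)) *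
     (\<integral>\<^sup>+a\<in>{0<..}. normsq_S2 (proj_l l (dilation a \<eta>)) * ennreal (1 / a ^ 3) \<partial>lborel)"

end

theory Submission
  imports Defs
begin

text \<open>
  Write \<open>c_m(a)\<close> for the coefficient of \<open>D_a \<eta>\<close> at \<open>Y_l^m\<close>, so that \<open>\<parallel>\<Pi>_l D_a \<eta>\<parallel>\<^sup>2 = \<Sum>_m |c_m(a)|\<^sup>2\<close>.
  For a positive weight \<open>W(\<theta>)\<close> the functions \<open>Y_l^m / \<surd>W\<close> are still orthogonal because of their dependence
  on \<open>\<phi>\<close>, and Bessel's inequality bounds \<open>\<Sum>_m |c_m(a)|\<^sup>2\<close> by
  \<open>max_m \<integral>|Y_l^m|\<^sup>2/W \<cdot> \<integral>|D_a \<eta>|\<^sup>2 W\<close>. With \<open>W = (a\<^sup>2 + sin\<^sup>2 \<theta>)^{3/2}\<close> the second factor is \<open>O(a\<^sup>3)\<close> by (A3).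

  A multiplier identity for the associated Legendre equation shows \<open>\<integral>|Y_l^m|\<^sup>2/W \<le> 2/a\<^sup>2\<close> once
  \<open>l(l+1) a\<^sup>2 \<ge> 2\<close>, and, with \<open>W = sin\<^sup>3 \<theta>\<close> and \<open>m \<noteq> 0\<close>, \<open>\<integral>|Y_l^m|\<^sup>2/W \<le> (4/3) l(l+1)\<close>. Hence
  \<open>\<parallel>\<Pi>_l D_a \<eta>\<parallel>\<^sup>2 = O(a)\<close> for \<open>a \<ge> 2/(l+1)\<close>, while for smaller \<open>a\<close> the part with \<open>m \<noteq> 0\<close> is \<open>O(l\<^sup>2 a\<^sup>3)\<close>.
  For \<open>m = 0\<close> the cancellation (C) together with \<open>|P_l(cos \<theta>) - 1| \<le> (l+1) \<theta>\<close> gives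
  \<open>|c_0(a)|\<^sup>2 = O(l\<^sup>3 a\<^sup>4)\<close>. Dividing by \<open>(2l+1) a\<^sup>3\<close> and integrating over both ranges of \<open>a\<close> gives a bound
  that does not depend on \<open>l\<close>.
\<close>

section \<open>Derivatives of the Rodrigues polynomials\<close>

text \<open>D_a is an isometry, but \<parallel>\<Pi>_l D_a \<eta>\<parallel> \<le>
  \<parallel>\<eta>\<parallel> alone allows order l^2 for the integral over a \<ge> 1/l, hence order
  l for G_l: a further factor a is needed, uniformly in l. As a tends to 0, D_a \<eta> concentrates
  at the north pole on the scale a, and a ~ 1/l is where this scale meets the wavelength of Y_l^m.
  The weight W is of size a^3 on that scale and costs the harmonics only a^(-2), so a factor a
  remains. Its exponent comes from the multiplier: cos / sqrt (a^2 + sin^2) has derivative -(1 +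
  a^2) sin / W. Condition (A3) bounds |\<eta>| by a constant times sin^2 \<theta>; the decay at the
  south pole pays for the growth of the dilated weight, relative to a^3, there. Order m = 0 resists
  the weight sin^3 because Y_l^0 does not tend to 0 at the poles, so that |Y_l^0|^2 / sin^3 is not
  integrable; (C) removes the leading term, as a tends to 0, of exactly this coefficient.\<close>

definition rodrigues :: "nat \<Rightarrow> nat \<Rightarrow> real poly" where
  "rodrigues l n = (pderiv ^^ n) ([:-1, 0, 1:] ^ l)"

lemma pderiv_rodrigues [simp]: "pderiv (rodrigues l n) = rodrigues l (Suc n)"
  by (simp add: rodrigues_def)

lemma rodrigues_0: "rodrigues l 0 = [:-1, 0, 1:] ^ l"
  by (simp add: rodrigues_def)

lemma rodrigues_1: "[:-1, 0, 1:] * rodrigues l 1 = smult (2 * real l) ([:0, 1:] * rodrigues l 0)"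
proof (cases l)
  case 0
  then show ?thesis by (simp add: rodrigues_def)
next
  case (Suc k)
  have "rodrigues l 1 = smult (real l) ([:-1, 0, 1:] ^ k * [:0, 2:])"
    by (simp add: rodrigues_def Suc pderiv_power_Suc pderiv_pCons algebra_simps del: power_Suc)
  then have "poly ([:-1, 0, 1:] * rodrigues l 1) x = poly (smult (2 * real l) ([:0, 1:] * rodrigues l 0)) x" for x
    by (simp add: rodrigues_0 Suc algebra_simps)
  then show ?thesis using poly_eq_poly_eq_iff by blast
qed

text \<open>With f = (x^2-1)^l, this is (x^2-1) f' = 2 l x f differentiated n+1 times; the induction
  step is one more derivative. At n = l + m it is the equation of the m-th derivative of
  P_l.\<close>

lemma rodrigues_ode_poly:
  "[:-1, 0, 1:] * rodrigues l (Suc (Suc n)) + smult (2 * (real n + 1 - real l)) ([:0, 1:] * rodrigues l (Suc n))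
     + smult ((real n + 1) * (real n - 2 * real l)) (rodrigues l n) = 0"
proof (induction n)
  case 0
  have "poly (pderiv ([:-1, 0, 1:] * rodrigues l (Suc 0))) x = poly (pderiv (smult (2 * real l) ([:0, 1:] * rodrigues l 0))) x" for x
    using rodrigues_1[of l] by simp
  then have "poly ([:-1, 0, 1:] * rodrigues l (Suc (Suc 0)) + smult (2 * (real 0 + 1 - real l)) ([:0, 1:] * rodrigues l (Suc 0))
     + smult ((real 0 + 1) * (real 0 - 2 * real l)) (rodrigues l 0)) x = 0" for x
    unfolding pderiv_mult pderiv_smult pderiv_rodrigues by (simp add: pderiv_pCons algebra_simps)
  then show ?case using poly_all_0_iff_0 by blast
next
  case (Suc n)
  have "poly (pderiv ([:-1, 0, 1:] * rodrigues l (Suc (Suc n)) + smult (2 * (real n + 1 - real l)) ([:0, 1:] * rodrigues l (Suc n))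
     + smult ((real n + 1) * (real n - 2 * real l)) (rodrigues l n))) x = 0" for x
    by (simp only: Suc pderiv_0 poly_0)
  then have "poly ([:-1, 0, 1:] * rodrigues l (Suc (Suc (Suc n))) + smult (2 * (real (Suc n) + 1 - real l)) ([:0, 1:] * rodrigues l (Suc (Suc n)))
     + smult ((real (Suc n) + 1) * (real (Suc n) - 2 * real l)) (rodrigues l (Suc n))) x = 0" for x
    unfolding pderiv_mult pderiv_smult pderiv_add pderiv_rodrigues by (simp add: pderiv_pCons algebra_simps)
  then show ?case using poly_all_0_iff_0 by blast
qed

lemma rodrigues_ode:
  "(x\<^sup>2 - 1) * poly (rodrigues l (Suc (Suc n))) x + 2 * (real n + 1 - real l) * x * poly (rodrigues l (Suc n)) x
     + (real n + 1) * (real n - 2 * real l) * poly (rodrigues l n) x = 0"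
proof -
  have "poly ([:-1, 0, 1:] * rodrigues l (Suc (Suc n)) + smult (2 * (real n + 1 - real l)) ([:0, 1:] * rodrigues l (Suc n))
     + smult ((real n + 1) * (real n - 2 * real l)) (rodrigues l n)) x = 0"
    by (simp only: rodrigues_ode_poly poly_0)
  then show ?thesis by (simp add: power2_eq_square algebra_simps)
qed

text \<open>Divergence form of the equation at n = l + m, with integrating factor (x^2-1)^m. It
  makes the reflection formula below a matter of integration.\<close>

lemma rodrigues_sturm_liouville:
  assumes "m < l"
  shows "pderiv ([:-1, 0, 1:] ^ Suc m * rodrigues l (Suc (l + m))) =
    smult (real (l - m) * real (l + m + 1)) ([:-1, 0, 1:] ^ m * rodrigues l (l + m))"
proof (rule poly_eq_poly_eq_iff[THEN iffD1], rule ext)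
  fix x :: real
  have ode: "(x\<^sup>2 - 1) * poly (rodrigues l (Suc (Suc (l+m)))) x + 2 * (real m + 1) * x * poly (rodrigues l (Suc (l+m))) x
    = real (l - m) * real (l + m + 1) * poly (rodrigues l (l+m)) x"
    using rodrigues_ode[of x l "l+m"] assms by (simp add: algebra_simps of_nat_diff)
  have "poly (pderiv ([:-1, 0, 1:] ^ Suc m * rodrigues l (Suc (l + m)))) x
    = (x\<^sup>2-1)^m * ((x\<^sup>2 - 1) * poly (rodrigues l (Suc (Suc (l+m)))) x + 2 * (real m + 1) * x * poly (rodrigues l (Suc (l+m))) x)"
    unfolding pderiv_mult pderiv_power_Suc pderiv_rodrigues
    by (simp add: pderiv_pCons poly_power power2_eq_square algebra_simps)
  then show "poly (pderiv ([:-1, 0, 1:] ^ Suc m * rodrigues l (Suc (l + m)))) x =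
    poly (smult (real (l - m) * real (l + m + 1)) ([:-1, 0, 1:] ^ m * rodrigues l (l + m))) x"
    unfolding ode by (simp add: poly_power power2_eq_square algebra_simps)
qed

text \<open>Each derivative lowers the multiplicity of the root c by one and multiplies the value of
  the cofactor at c by the old multiplicity. For j < n this gives vanishing, for j = n the value, of
  the Rodrigues derivatives at 1 and -1.\<close>

lemma higher_pderiv_power_linear_mult:
  fixes g :: "real poly"
  assumes "j \<le> n"
  shows "\<exists>h. (pderiv ^^ j) ([:-c, 1:] ^ n * g) = [:-c, 1:] ^ (n - j) * h \<and>
     poly h c = fact n / fact (n - j) * poly g c"
  using assms
proof (induction j)
  case 0
  then show ?case by auto
next
  case (Suc j)
  then obtain h where h: "(pderiv ^^ j) ([:-c, 1:] ^ n * g) = [:-c, 1:] ^ (n - j) * h"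
    "poly h c = fact n / fact (n - j) * poly g c" by auto
  define k where "k = n - Suc j"
  have k: "n - j = Suc k" using Suc.prems by (simp add: k_def)
  have e: "pderiv ([:-c, 1:] ^ Suc k * h) = [:-c, 1:] ^ k * (smult (real (Suc k)) h + [:-c, 1:] * pderiv h)"
    unfolding pderiv_mult pderiv_power_Suc by (simp add: pderiv_pCons algebra_simps)
  have "poly (smult (real (Suc k)) h + [:-c, 1:] * pderiv h) c = fact n / fact k * poly g c"
    using h(2) by (simp add: k fact_Suc field_simps del: of_nat_Suc)
  with e h(1) show ?case unfolding k_def[symmetric] by (auto simp: k intro!: exI)
qed

lemma rodrigues_factor: "rodrigues l j = (pderiv ^^ j) ([:-1, 1:] ^ l * [:1, 1:] ^ l)"
  "rodrigues l j = (pderiv ^^ j) ([:-(-1), 1:] ^ l * [:-1, 1:] ^ l)"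
  by (simp_all add: rodrigues_def flip: power_mult_distrib)

lemma rodrigues_at_1: "j < l \<Longrightarrow> poly (rodrigues l j) 1 = 0" 
  using higher_pderiv_power_linear_mult[of j l 1 "[:1,1:]^l"] unfolding rodrigues_factor(1)
  by (auto simp: poly_power zero_power)

lemma rodrigues_l_at_1: "poly (rodrigues l l) 1 = 2 ^ l * fact l"
  using higher_pderiv_power_linear_mult[of l l 1 "[:1,1:]^l"] unfolding rodrigues_factor(1)
  by (auto simp: poly_power)

lemma rodrigues_l_at_minus_1: "poly (rodrigues l l) (-1) = (-2) ^ l * fact l"
  using higher_pderiv_power_linear_mult[of l l "-1" "[:-1,1:]^l"] unfolding rodrigues_factor(2)
  by (auto simp: poly_power)

text \<open>The classical relation between P_l^(-m) and P_l^m, needed because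
  \<open>assoc_legendre\<close> uses one Rodrigues formula for both signs. In the induction step
  both sides have the same derivative by the Sturm-Liouville form, and both vanish at 1, which fixes
  the constant.\<close>

lemma rodrigues_reflect:
  assumes "m \<le> l"
  shows "rodrigues l (l - m) = smult (fact (l - m) / fact (l + m)) ([:-1, 0, 1:] ^ m * rodrigues l (l + m))"
  using assms
proof (induction m)
  case 0
  then show ?case by simp
next
  case (Suc m)
  then have m: "m < l" by simp
  let ?g = "smult (fact (l - Suc m) / fact (l + Suc m)) ([:-1, 0, 1:] ^ Suc m * rodrigues l (Suc (l + m)))"
  have f1: "fact (l - m) = real (l - m) * fact (l - Suc m)"
    using m by (metis Suc_diff_Suc fact_Suc of_nat_fact of_nat_mult)
  have f2: "fact (l + Suc m) = real (l + m + 1) * fact (l + m)"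
    by simp
  have "pderiv (rodrigues l (l - Suc m)) = rodrigues l (l - m)" using m by (simp add: Suc_diff_Suc)
  also have "\<dots> = smult (fact (l - m) / fact (l + m)) ([:-1, 0, 1:] ^ m * rodrigues l (l + m))"
    using Suc by simp
  also have "\<dots> = pderiv ?g"
    unfolding pderiv_smult rodrigues_sturm_liouville[OF m] smult_smult f1 f2 by (simp add: mult.commute)
  finally have "pderiv (rodrigues l (l - Suc m) - ?g) = 0" by (simp add: pderiv_diff)
  then obtain c where c: "rodrigues l (l - Suc m) - ?g = [:c:]" using pderiv_iszero by blast
  have "poly (rodrigues l (l - Suc m) - ?g) 1 = 0" using rodrigues_at_1[of "l - Suc m" l] m
    by simp
  then have "c = 0" unfolding c by simp
  with c show ?case by simp
qed

section \<open>Associated Legendre functions in the polar angle\<close>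

lemma has_integral_FTC:
  fixes f :: "real \<Rightarrow> real"
  assumes "a \<le> b" "continuous_on {a..b} f"
    "\<And>x. a < x \<Longrightarrow> x < b \<Longrightarrow> (f has_real_derivative f' x) (at x)"
  shows "(f' has_integral (f b - f a)) {a..b}"
  by (rule fundamental_theorem_of_calculus_interior)
     (use assms in \<open>auto simp: has_real_derivative_iff_has_vector_derivative\<close>)

text \<open>The derivative of sin^(2l+2) cos integrates to 0 over [0, pi], which is the recursion
  (2l+3) S_(l+1) = (2l+2) S_l.\<close>

lemma has_integral_odd_sin_power:
  "((\<lambda>\<theta>. sin \<theta> ^ (2 * l + 1)) has_integral (2 ^ (2 * l + 1) * (fact l)\<^sup>2 / fact (2 * l + 1))) {0..pi}"
proof (induction l)
  case 0
  have "((\<lambda>\<theta>. sin \<theta>) has_integral (- cos pi - - cos 0)) {0..pi}"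
    by (rule has_integral_FTC) (auto intro!: continuous_intros derivative_eq_intros)
  then show ?case by simp
next
  case (Suc l)
  have "((\<lambda>\<theta>. (2 * real l + 2) * sin \<theta> ^ (2 * l + 1) - (2 * real l + 3) * sin \<theta> ^ (2 * Suc l + 1))
     has_integral (sin pi ^ (2 * l + 2) * cos pi - sin 0 ^ (2 * l + 2) * cos 0)) {0..pi}"
  proof (rule has_integral_FTC)
    fix x :: real
    have "((\<lambda>\<theta>. sin \<theta> ^ (2 * l + 2) * cos \<theta>) has_real_derivative
      ((2 * real l + 2) * sin x ^ (2 * l + 1) * (cos x)\<^sup>2 - sin x ^ (2 * l + 3))) (at x)"
      using DERIV_mult[OF DERIV_power[OF DERIV_sin, of "2 * l + 2" x] DERIV_cos[of x]]
      by (simp add: power2_eq_square power3_eq_cube power_add algebra_simps)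
    moreover have "(2 * real l + 2) * sin x ^ (2 * l + 1) * (cos x)\<^sup>2 - sin x ^ (2 * l + 3)
       = (2 * real l + 2) * sin x ^ (2 * l + 1) - (2 * real l + 3) * sin x ^ (2 * Suc l + 1)"
      unfolding cos_squared_eq by (simp add: algebra_simps power2_eq_square power3_eq_cube power_add)
    ultimately show "((\<lambda>\<theta>. sin \<theta> ^ (2 * l + 2) * cos \<theta>) has_real_derivative
      ((2 * real l + 2) * sin x ^ (2 * l + 1) - (2 * real l + 3) * sin x ^ (2 * Suc l + 1))) (at x)"
      by simp
  qed (auto intro!: continuous_intros)
  then have "((\<lambda>\<theta>. (2 * real l + 2) * sin \<theta> ^ (2 * l + 1) - (2 * real l + 3) * sin \<theta> ^ (2 * Suc l + 1))
     has_integral 0) {0..pi}" by simp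
  from has_integral_diff[OF has_integral_mult_right[OF Suc, of "2 * real l + 2"] this]
  have "((\<lambda>\<theta>. (2 * real l + 3) * sin \<theta> ^ (2 * Suc l + 1)) has_integral
     ((2 * real l + 2) * (2 ^ (2 * l + 1) * (fact l)\<^sup>2 / fact (2 * l + 1)))) {0..pi}"
    by simp
  from has_integral_divide[OF this, of "2 * real l + 3"]
  have *: "((\<lambda>\<theta>. sin \<theta> ^ (2 * Suc l + 1)) has_integral
     ((2 * real l + 2) * (2 ^ (2 * l + 1) * (fact l)\<^sup>2 / fact (2 * l + 1)) / (2 * real l + 3))) {0..pi}"
    by (simp add: add_nonneg_eq_0_iff del: power_Suc)
  have f: "fact (2 * Suc l + 1) = (2 * real l + 3) * (2 * real l + 2) * fact (2 * l + 1)"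
    by (simp add: algebra_simps)
  have n0: "2 * real l + 3 \<noteq> 0" "2 * real l + 2 \<noteq> 0" "1 + real l \<noteq> 0" by linarith+
  have "(2 * real l + 2) * (2 ^ (2 * l + 1) * (fact l)\<^sup>2 / fact (2 * l + 1)) / (2 * real l + 3)
    = 2 ^ (2 * Suc l + 1) * (fact (Suc l))\<^sup>2 / fact (2 * Suc l + 1)"
    unfolding f using n0 by (simp add: divide_simps) (simp add: power2_eq_square algebra_simps)
  with * show ?case by simp
qed

text \<open>P_l^n(cos \<theta>) without the factor (-1)^n / (2^l l!). Only orders n \<ge> 0 occur;
  negative ones are reduced to them by \<open>rodrigues_reflect\<close>.\<close>

definition polar_legendre :: "nat \<Rightarrow> nat \<Rightarrow> real \<Rightarrow> real" where
  "polar_legendre l n \<theta> = sin \<theta> ^ n * poly (rodrigues l (l + n)) (cos \<theta>)"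

text \<open>This is sin \<theta> times the derivative of \<open>polar_legendre\<close>, multiplied
  out so that it is continuous at the poles. The pair turns the Legendre equation into a first-order
  system.\<close>

definition sin_deriv_legendre :: "nat \<Rightarrow> nat \<Rightarrow> real \<Rightarrow> real" where
  "sin_deriv_legendre l n \<theta> = sin \<theta> ^ n * (real n * cos \<theta> * poly (rodrigues l (l + n)) (cos \<theta>)
      - (sin \<theta>)\<^sup>2 * poly (rodrigues l (Suc (l + n))) (cos \<theta>))"

lemma DERIV_rodrigues_cos [derivative_intros]:
  "((\<lambda>\<theta>. poly (rodrigues l n) (cos \<theta>)) has_real_derivative (- sin \<theta> * poly (rodrigues l (Suc n)) (cos \<theta>))) (at \<theta>)"
  using DERIV_chain2[OF poly_DERIV[of "rodrigues l n"] DERIV_cos[of \<theta>]] by (simp add: mult.commute)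

lemma continuous_on_polar_legendre [continuous_intros]:
  "continuous_on A (polar_legendre l n)" "continuous_on A (sin_deriv_legendre l n)"
  unfolding polar_legendre_def sin_deriv_legendre_def by (intro continuous_intros)+

lemma rodrigues_ode_sin:
  "- (sin \<theta>)\<^sup>2 * poly (rodrigues l (Suc (Suc (l + n)))) (cos \<theta>)
     + 2 * (real n + 1) * cos \<theta> * poly (rodrigues l (Suc (l + n))) (cos \<theta>)
   = (real l * (real l + 1) - real n * (real n + 1)) * poly (rodrigues l (l + n)) (cos \<theta>)"
  using rodrigues_ode[of "cos \<theta>" l "l + n"] unfolding cos_squared_eq by (simp add: algebra_simps)

lemma DERIV_polar_legendre:
  assumes "0 < \<theta>" "\<theta> < pi"
  shows "(polar_legendre l n has_real_derivative sin_deriv_legendre l n \<theta> / sin \<theta>) (at \<theta>)"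
proof -
  have s: "sin \<theta> \<noteq> 0" using sin_gt_zero[OF assms] by simp
  show ?thesis unfolding polar_legendre_def sin_deriv_legendre_def
    by (rule derivative_eq_intros refl | simp)+
       (use s in \<open>cases n; simp add: field_simps power2_eq_square\<close>)
qed

text \<open>The associated Legendre equation in the polar angle, sin (sin y')' = -(l(l+1) sin^2 -
  n^2) y, with z = sin y'.\<close>

lemma DERIV_sin_deriv_legendre:
  assumes "0 < \<theta>" "\<theta> < pi"
  shows "(sin_deriv_legendre l n has_real_derivative
    - (real l * (real l + 1) * (sin \<theta>)\<^sup>2 - (real n)\<^sup>2) * polar_legendre l n \<theta> / sin \<theta>) (at \<theta>)"
proof -
  have s: "sin \<theta> \<noteq> 0" using sin_gt_zero[OF assms] by simp
  define S C Q Q1 Q2 where "S = sin \<theta>" "C = cos \<theta>" "Q = poly (rodrigues l (l + n)) (cos \<theta>)"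
    "Q1 = poly (rodrigues l (Suc (l + n))) (cos \<theta>)" "Q2 = poly (rodrigues l (Suc (Suc (l + n)))) (cos \<theta>)"
  note d = this
  \<comment> \<open>The factor n makes the truncated exponent n - 1 harmless at n = 0.\<close>
  have p: "real n * S ^ (n - Suc 0) = real n * S ^ n / S"
    using s unfolding d by (cases n) auto
  have "(sin_deriv_legendre l n has_real_derivative (real n * S ^ (n - Suc 0) * C * (real n * C * Q - S\<^sup>2 * Q1)
      + S ^ n * (- real n * S * Q - real n * C * S * Q1 - 2 * S * C * Q1 + S * S\<^sup>2 * Q2))) (at \<theta>)"
    unfolding sin_deriv_legendre_def d
    by (rule derivative_eq_intros refl)+ (simp add: algebra_simps)
  moreover have "real n * S ^ (n - Suc 0) * C * (real n * C * Q - S\<^sup>2 * Q1)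
      + S ^ n * (- real n * S * Q - real n * C * S * Q1 - 2 * S * C * Q1 + S * S\<^sup>2 * Q2)
     = - (real l * (real l + 1) * S\<^sup>2 - (real n)\<^sup>2) * (S ^ n * Q) / S"
  proof -
    have ode: "S\<^sup>2 * Q2 = 2 * (real n + 1) * C * Q1 - (real l * (real l + 1) - real n * (real n + 1)) * Q"
      using rodrigues_ode_sin[of \<theta> l n] unfolding d by simp
    have c: "C * C = 1 - S * S" using cos_squared_eq[of \<theta>] unfolding d power2_eq_square .
    have "S * (real n * S ^ n / S * C * (real n * C * Q - S\<^sup>2 * Q1)
      + S ^ n * (- real n * S * Q - real n * C * S * Q1 - 2 * S * C * Q1 + S * (S\<^sup>2 * Q2)))
      = S ^ n * (real n * C * (real n * C * Q - S\<^sup>2 * Q1)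
      + S * S * (- real n * Q - real n * C * Q1 - 2 * C * Q1 + S\<^sup>2 * Q2))"
      using s unfolding d(1)[symmetric] by (simp add: algebra_simps power2_eq_square)
    also have "\<dots> = S ^ n * ((real n)\<^sup>2 * (C * C) * Q + S * S * (- real n * Q - (real l * (real l + 1) - real n * (real n + 1)) * Q))"
      unfolding ode by (simp add: algebra_simps power2_eq_square)
    also have "\<dots> = - (real l * (real l + 1) * S\<^sup>2 - (real n)\<^sup>2) * (S ^ n * Q)"
      unfolding c by (simp add: algebra_simps power2_eq_square)
    finally show ?thesis unfolding p using s unfolding d(1)[symmetric]
      by (simp add: eq_divide_eq mult.commute mult.left_commute)
  qed
  ultimately show ?thesis unfolding polar_legendre_def d by simp
qed

lemma rodrigues_top: "rodrigues l (l + l) = [:fact (2 * l):]"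
proof (rule poly_eqI)
  fix k
  have deg: "degree ([:-1, 0, 1:] ^ l :: real poly) = 2 * l"
    by (simp add: degree_power_eq)
  have lc: "coeff ([:-1, 0, 1:] ^ l :: real poly) (2 * l) = 1"
    using lead_coeff_power[of "[:-1, 0, 1:] :: real poly" l] unfolding deg by simp
  show "coeff (rodrigues l (l + l)) k = coeff [:fact (2 * l):] k"
  proof (cases k)
    case 0
    then show ?thesis using lc
      by (simp add: rodrigues_def coeff_higher_pderiv pochhammer_fact mult_2)
  next
    case (Suc j)
    have "coeff ([:-1, 0, 1:] ^ l :: real poly) (l + l + k) = 0"
      by (rule coeff_eq_0) (use deg Suc in simp)
    then show ?thesis by (simp add: rodrigues_def coeff_higher_pderiv Suc add_ac)
  qed
qed

text \<open>Descending induction from n = l, where the polynomial factor is constant. The derivative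
  of sin^(2n+2) q_n q_(n+1) integrates to 0, so the squared norms satisfy N_(n+1) = (l-n)(l+n+1)
  N_n.\<close>

lemma has_integral_polar_legendre_square:
  assumes "n \<le> l"
  shows "((\<lambda>\<theta>. sin \<theta> * (polar_legendre l n \<theta>)\<^sup>2) has_integral
    (fact (l + n) / fact (l - n) * (2 ^ (2 * l + 1) * (fact l)\<^sup>2 / (2 * real l + 1)))) {0..pi}"
  using assms
proof (induction n rule: inc_induct)
  case base
  have "((\<lambda>\<theta>. (fact (2 * l))\<^sup>2 * sin \<theta> ^ (2 * l + 1)) has_integral
     ((fact (2 * l))\<^sup>2 * (2 ^ (2 * l + 1) * (fact l)\<^sup>2 / fact (2 * l + 1)))) {0..pi}"
    by (rule has_integral_mult_right[OF has_integral_odd_sin_power])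
  moreover have "(\<lambda>\<theta>. (fact (2 * l))\<^sup>2 * sin \<theta> ^ (2 * l + 1)) = (\<lambda>\<theta>. sin \<theta> * (polar_legendre l l \<theta>)\<^sup>2)"
    by (auto simp: polar_legendre_def rodrigues_top power_mult_distrib power_mult[symmetric] mult.commute)
  moreover have "(fact (2 * l))\<^sup>2 * (2 ^ (2 * l + 1) * (fact l)\<^sup>2 / fact (2 * l + 1))
    = fact (l + l) / fact (l - l) * (2 ^ (2 * l + 1) * (fact l)\<^sup>2 / (2 * real l + 1))"
    by (simp add: power2_eq_square mult_2[symmetric] add.commute)
  ultimately show ?case by metis
next
  case (step n)
  define L where "L = real l * (real l + 1) - real n * (real n + 1)"
  have Leq: "L = real (l - n) * real (l + n + 1)"
    using step by (simp add: L_def of_nat_diff algebra_simps)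
  then have L0: "L > 0" using step by simp
  let ?q = "\<lambda>k \<theta>. poly (rodrigues l (l + k)) (cos \<theta>)"
  let ?G = "\<lambda>\<theta>. sin \<theta> ^ (2 * n + 2) * (?q n \<theta> * ?q (Suc n) \<theta>)"
  have "((\<lambda>\<theta>. L * (sin \<theta> * (polar_legendre l n \<theta>)\<^sup>2) - sin \<theta> * (polar_legendre l (Suc n) \<theta>)\<^sup>2) has_integral (?G pi - ?G 0)) {0..pi}"
  proof (rule has_integral_FTC)
    fix x :: real
    have "(?G has_real_derivative (sin x ^ (2 * n + 1) * ?q n x *
      (2 * (real n + 1) * cos x * ?q (Suc n) x - (sin x)\<^sup>2 * ?q (Suc (Suc n)) x)
       - sin x ^ (2 * n + 1) * (sin x)\<^sup>2 * (?q (Suc n) x)\<^sup>2)) (at x)"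
      by (rule derivative_eq_intros refl | simp)+ (simp add: algebra_simps power2_eq_square)
    moreover have "2 * (real n + 1) * cos x * ?q (Suc n) x - (sin x)\<^sup>2 * ?q (Suc (Suc n)) x = L * ?q n x"
      using rodrigues_ode_sin[of x l n] by (simp add: L_def)
    moreover have "sin x ^ (2 * n + 1) * ?q n x * (L * ?q n x) - sin x ^ (2 * n + 1) * (sin x)\<^sup>2 * (?q (Suc n) x)\<^sup>2
      = L * (sin x * (polar_legendre l n x)\<^sup>2) - sin x * (polar_legendre l (Suc n) x)\<^sup>2"
      by (simp add: polar_legendre_def power_mult_distrib power2_eq_square power_add power_mult algebra_simps)
    ultimately show "(?G has_real_derivative (L * (sin x * (polar_legendre l n x)\<^sup>2) - sin x * (polar_legendre l (Suc n) x)\<^sup>2)) (at x)"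
      by simp
  qed (auto intro!: continuous_intros)
  then have "((\<lambda>\<theta>. L * (sin \<theta> * (polar_legendre l n \<theta>)\<^sup>2) - sin \<theta> * (polar_legendre l (Suc n) \<theta>)\<^sup>2) has_integral 0) {0..pi}"
    by simp
  from has_integral_divide[OF has_integral_add[OF this step.IH], of L]
  have *: "((\<lambda>\<theta>. sin \<theta> * (polar_legendre l n \<theta>)\<^sup>2) has_integral
    (fact (l + Suc n) / fact (l - Suc n) * (2 ^ (2 * l + 1) * (fact l)\<^sup>2 / (2 * real l + 1))) / L) {0..pi}"
    using L0 by simp
  have f1: "fact (l - n) = real (l - n) * fact (l - Suc n)"
    using step by (metis Suc_diff_Suc fact_Suc)
  have f2: "fact (l + Suc n) = real (l + n + 1) * fact (l + n)"
    by simp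
  have "fact (l + Suc n) / fact (l - Suc n) * B / L = fact (l + n) / fact (l - n) * B" for B :: real
    unfolding f1 f2 Leq using step by simp
  from *[unfolded this] show ?case .
qed

section \<open>Weighted estimates by a multiplier identity\<close>

lemma DERIV_inverse_rho:
  assumes "0 < \<theta>" "\<theta> < pi"
  shows "((\<lambda>\<theta>. inverse (sqrt (a\<^sup>2 + (sin \<theta>)\<^sup>2))) has_real_derivative
    (- sin \<theta> * cos \<theta> * inverse (sqrt (a\<^sup>2 + (sin \<theta>)\<^sup>2)) ^ 3)) (at \<theta>)"
proof -
  have p: "0 < a\<^sup>2 + (sin \<theta>)\<^sup>2" using sin_gt_zero[OF assms] by (simp add: add_nonneg_pos)
  have "((\<lambda>\<theta>. sqrt (a\<^sup>2 + (sin \<theta>)\<^sup>2)) has_real_derivative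
      inverse (sqrt (a\<^sup>2 + (sin \<theta>)\<^sup>2)) / 2 * (2 * sin \<theta> * cos \<theta>)) (at \<theta>)"
    by (rule DERIV_chain2[where f = sqrt and x = \<theta> and g = "\<lambda>\<theta>. a\<^sup>2 + (sin \<theta>)\<^sup>2", OF DERIV_real_sqrt[OF p]])
       (auto intro!: derivative_eq_intros)
  then have "((\<lambda>\<theta>. inverse (sqrt (a\<^sup>2 + (sin \<theta>)\<^sup>2))) has_real_derivative
      - (inverse (sqrt (a\<^sup>2 + (sin \<theta>)\<^sup>2)) / 2 * (2 * sin \<theta> * cos \<theta>) *
         inverse (sqrt (a\<^sup>2 + (sin \<theta>)\<^sup>2) ^ Suc (Suc 0)))) (at \<theta>)"
    by (rule DERIV_inverse_fun) (metis p less_irrefl real_sqrt_eq_0_iff)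
  moreover have "- (inverse r / 2 * (2 * s * c) * inverse (r ^ Suc (Suc 0))) = - s * c * inverse r ^ 3" for r s c :: real
    by (simp add: power3_eq_cube)
  ultimately show ?thesis by (simp only:)
qed

text \<open>For \<open>z = sin \<theta> \<cdot> y'\<close> and a solution \<open>y\<close> of the associated Legendre equation, the energy
  \<open>z\<^sup>2 + (\<Lambda> sin\<^sup>2 \<theta> - \<mu>) y\<^sup>2\<close> has derivative \<open>2 \<Lambda> sin \<theta> cos \<theta> y\<^sup>2\<close>. It is multiplied by
  \<open>cos \<theta> / sqrt (a\<^sup>2 + sin\<^sup>2 \<theta>)\<close>; the other two terms remove \<open>z\<^sup>2\<close> and \<open>y z\<close> from the derivative,
  leaving a multiple of \<open>y\<^sup>2\<close>.\<close>

definition morawetz :: "real \<Rightarrow> real \<Rightarrow> real \<Rightarrow> (real \<Rightarrow> real) \<Rightarrow> (real \<Rightarrow> real) \<Rightarrow> real \<Rightarrow> real" where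
  "morawetz a \<Lambda> \<mu> y z \<theta> = (let s = sin \<theta>; c = cos \<theta>; r = inverse (sqrt (a\<^sup>2 + s\<^sup>2)) in
     c * r * ((z \<theta>)\<^sup>2 + (\<Lambda> * s\<^sup>2 - \<mu>) * (y \<theta>)\<^sup>2) + (1 + a\<^sup>2) * (s\<^sup>2 * r ^ 3) * (y \<theta> * z \<theta>)
     - (1 + a\<^sup>2) / 2 * (s\<^sup>2 * c * (3 * a\<^sup>2 * r ^ 5 - r ^ 3)) * (y \<theta>)\<^sup>2)"

text \<open>The derivative of sin^2 cos (3 a^2 r^5 - r^3) divided by sin: the coefficient of y^2
  that the last term of \<open>morawetz\<close> creates.\<close>

definition morawetz_err :: "real \<Rightarrow> real \<Rightarrow> real" where
  "morawetz_err a \<theta> = (let s = sin \<theta>; c = cos \<theta>; r = inverse (sqrt (a\<^sup>2 + s\<^sup>2)) in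
     (2 * c\<^sup>2 - s\<^sup>2) * (3 * a\<^sup>2 * r ^ 5 - r ^ 3) + 3 * s\<^sup>2 * c\<^sup>2 * (r ^ 5 - 5 * a\<^sup>2 * r ^ 7))"

text \<open>Differentiating the multiplier cos r gives -(1 + a^2) sin r^3 z^2, which the derivative
  of the y z term cancels; the y z that this leaves is cancelled by the last term. Since 1/W = r^3,
  the surviving multiple of y^2 compares the weighted norm, with coefficient \<Lambda> a^2 + \<mu>,
  to an unweighted one.\<close>

lemma DERIV_morawetz:
  assumes \<theta>: "0 < \<theta>" "\<theta> < pi"
    and y: "(y has_real_derivative z \<theta> / sin \<theta>) (at \<theta>)"
    and z: "(z has_real_derivative - (\<Lambda> * (sin \<theta>)\<^sup>2 - \<mu>) * y \<theta> / sin \<theta>) (at \<theta>)"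
  shows "(morawetz a \<Lambda> \<mu> y z has_real_derivative
     sin \<theta> * (y \<theta>)\<^sup>2 *
      (2 * (1 + a\<^sup>2) * (\<Lambda> * a\<^sup>2 + \<mu>) * inverse (sqrt (a\<^sup>2 + (sin \<theta>)\<^sup>2)) ^ 3
       - (1 + a\<^sup>2) / 2 * morawetz_err a \<theta> - 2 * \<Lambda> * sqrt (a\<^sup>2 + (sin \<theta>)\<^sup>2))) (at \<theta>)"
proof -
  define R where "R = (\<lambda>\<theta>. inverse (sqrt (a\<^sup>2 + (sin \<theta>)\<^sup>2)))"
  have Rx: "inverse (sqrt (a\<^sup>2 + (sin \<theta>)\<^sup>2)) = R \<theta>" for \<theta> by (simp add: R_def)
  define s c r where "s = sin \<theta>" "c = cos \<theta>" "r = R \<theta>"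
  note d = this
  have s0: "s > 0" using sin_gt_zero[OF \<theta>] by (simp add: d)
  have p: "0 < a\<^sup>2 + s\<^sup>2" using s0 by (simp add: add_nonneg_pos)
  have r1: "r * r * (a\<^sup>2 + s\<^sup>2) = 1"
  proof -
    have "r * r = inverse (a\<^sup>2 + s\<^sup>2)"
      using p by (simp add: d(3) R_def d(1)[symmetric] flip: inverse_mult_distrib)
    then show ?thesis using p by (metis left_inverse less_irrefl)
  qed
  have rs: "sqrt (a\<^sup>2 + s\<^sup>2) = (a\<^sup>2 + s\<^sup>2) * r"
    using p by (simp add: d(3) R_def d(1)[symmetric] real_div_sqrt flip: divide_inverse)
  have c2: "c * c = 1 - s * s" using cos_squared_eq[of \<theta>] unfolding d power2_eq_square .
  have s2r: "s * s * r ^ (k+2) = r ^ k - a\<^sup>2 * r ^ (k+2)" for k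
  proof -
    have "r ^ k = r ^ k * (r * r * (a\<^sup>2 + s\<^sup>2))" by (simp only: r1 mult_1_right)
    then show ?thesis by (simp add: algebra_simps power2_eq_square)
  qed
  have dR: "(R has_real_derivative (- s * c * r ^ 3)) (at \<theta>)"
    unfolding d R_def by (rule DERIV_inverse_rho[OF \<theta>])
  note [derivative_intros] = dR y z
  have d1: "((\<lambda>\<theta>. cos \<theta> * R \<theta>) has_real_derivative (- (1 + a\<^sup>2) * s * r ^ 3)) (at \<theta>)"
  proof -
    have "((\<lambda>\<theta>. cos \<theta> * R \<theta>) has_real_derivative (- s * r - s * (c * c) * r ^ 3)) (at \<theta>)"
      by (rule derivative_eq_intros refl)+ (simp add: d algebra_simps)
    moreover have "- s * r - s * (c * c) * r ^ 3 = - (1 + a\<^sup>2) * s * r ^ 3"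
    proof -
      have "s * r = s * (s * s * r ^ 3 + a\<^sup>2 * r ^ 3)" using s2r[of 1] by (simp add: numeral_3_eq_3)
      then show ?thesis unfolding c2 by (simp add: algebra_simps)
    qed
    ultimately show ?thesis by simp
  qed
  have d2: "((\<lambda>\<theta>. (z \<theta>)\<^sup>2 + (\<Lambda> * (sin \<theta>)\<^sup>2 - \<mu>) * (y \<theta>)\<^sup>2) has_real_derivative (2 * \<Lambda> * s * c * (y \<theta>)\<^sup>2)) (at \<theta>)"
    by (rule derivative_eq_intros refl)+ (use s0 in \<open>simp add: d field_simps power2_eq_square\<close>)
  define h where "h = s\<^sup>2 * c * (3 * a\<^sup>2 * r ^ 5 - r ^ 3)"
  have d3: "((\<lambda>\<theta>. (sin \<theta>)\<^sup>2 * R \<theta> ^ 3) has_real_derivative (h / s)) (at \<theta>)"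
  proof -
    have "((\<lambda>\<theta>. (sin \<theta>)\<^sup>2 * R \<theta> ^ 3) has_real_derivative (2 * s * c * r ^ 3 - 3 * s * c * (s * s * r ^ 5))) (at \<theta>)"
      by (rule derivative_eq_intros refl)+ (simp add: d algebra_simps eval_nat_numeral)
    moreover have "2 * s * c * r ^ 3 - 3 * s * c * (s * s * r ^ 5) = h / s"
    proof -
      have "s * s * r ^ 5 = r ^ 3 - a\<^sup>2 * r ^ 5" using s2r[of 3] by simp
      moreover have "h / s = s * c * (3 * a\<^sup>2 * r ^ 5 - r ^ 3)"
        using s0 unfolding h_def by (simp add: power2_eq_square)
      ultimately show ?thesis by (simp only:) (simp add: algebra_simps)
    qed
    ultimately show ?thesis by simp
  qed
  have d4: "((\<lambda>\<theta>. (sin \<theta>)\<^sup>2 * cos \<theta> * (3 * a\<^sup>2 * R \<theta> ^ 5 - R \<theta> ^ 3)) has_real_derivative (s * morawetz_err a \<theta>)) (at \<theta>)"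
    by (rule derivative_eq_intros refl)+ 
       (unfold d morawetz_err_def Let_def Rx, simp add: algebra_simps eval_nat_numeral)
  have d5: "((\<lambda>\<theta>. y \<theta> * z \<theta>) has_real_derivative ((z \<theta>)\<^sup>2 - (\<Lambda> * s\<^sup>2 - \<mu>) * (y \<theta>)\<^sup>2) / s) (at \<theta>)"
    by (rule derivative_eq_intros refl)+ (use s0 in \<open>simp add: d field_simps power2_eq_square\<close>)
  have d6: "((\<lambda>\<theta>. (y \<theta>)\<^sup>2) has_real_derivative 2 * y \<theta> * z \<theta> / s) (at \<theta>)"
    by (rule derivative_eq_intros refl)+ (use s0 in \<open>simp add: d field_simps power2_eq_square\<close>)
  have D: "(morawetz a \<Lambda> \<mu> y z has_real_derivative
    ((- (1 + a\<^sup>2) * s * r ^ 3) * ((z \<theta>)\<^sup>2 + (\<Lambda> * s\<^sup>2 - \<mu>) * (y \<theta>)\<^sup>2) + (2 * \<Lambda> * s * c * (y \<theta>)\<^sup>2) * (c * r)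
     + (1 + a\<^sup>2) * ((h / s) * (y \<theta> * z \<theta>) + ((z \<theta>)\<^sup>2 - (\<Lambda> * s\<^sup>2 - \<mu>) * (y \<theta>)\<^sup>2) / s * (s\<^sup>2 * r ^ 3))
     - (1 + a\<^sup>2) / 2 * ((s * morawetz_err a \<theta>) * (y \<theta>)\<^sup>2 + (2 * y \<theta> * z \<theta> / s) * h))) (at \<theta>)"
    using DERIV_diff[OF DERIV_add[OF DERIV_mult[OF d1 d2]
        DERIV_cmult[OF DERIV_mult[OF d3 d5], of "1 + a\<^sup>2"]]
        DERIV_cmult[OF DERIV_mult[OF d4 d6], of "(1 + a\<^sup>2) / 2"]]
    unfolding morawetz_def Let_def Rx d(1,2,3)[symmetric] h_def[symmetric]
    by (simp add: mult.assoc d h_def)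
  have s2r3: "s * s * r ^ 3 = r - a\<^sup>2 * r ^ 3" using s2r[of 1] by (simp add: numeral_3_eq_3)
  have "((- (1 + a\<^sup>2) * s * r ^ 3) * ((z \<theta>)\<^sup>2 + (\<Lambda> * s\<^sup>2 - \<mu>) * (y \<theta>)\<^sup>2) + (2 * \<Lambda> * s * c * (y \<theta>)\<^sup>2) * (c * r)
     + (1 + a\<^sup>2) * ((h / s) * (y \<theta> * z \<theta>) + ((z \<theta>)\<^sup>2 - (\<Lambda> * s\<^sup>2 - \<mu>) * (y \<theta>)\<^sup>2) / s * (s\<^sup>2 * r ^ 3))
     - (1 + a\<^sup>2) / 2 * ((s * morawetz_err a \<theta>) * (y \<theta>)\<^sup>2 + (2 * y \<theta> * z \<theta> / s) * h))
    = s * (y \<theta>)\<^sup>2 * (2 * (1 + a\<^sup>2) * \<mu> * r ^ 3 - 2 * (1 + a\<^sup>2) * \<Lambda> * (s * s * r ^ 3)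
        + 2 * \<Lambda> * (c * c) * r - (1 + a\<^sup>2) / 2 * morawetz_err a \<theta>)"
  proof -
    define H where "H = h / s * (y \<theta> * z \<theta>)"
    have e1: "(2 * y \<theta> * z \<theta> / s) * h = 2 * H" by (simp add: H_def)
    have e2: "X / s * (s\<^sup>2 * r ^ 3) = s * r ^ 3 * X" for X using s0 by (simp add: power2_eq_square)
    show ?thesis unfolding e1 e2 H_def[symmetric] by (simp add: algebra_simps power2_eq_square)
  qed
  also have "\<dots> = s * (y \<theta>)\<^sup>2 * (2 * (1 + a\<^sup>2) * (\<Lambda> * a\<^sup>2 + \<mu>) * r ^ 3
       - (1 + a\<^sup>2) / 2 * morawetz_err a \<theta> - 2 * \<Lambda> * sqrt (a\<^sup>2 + s\<^sup>2))"
    unfolding c2 rs s2r3 by (simp add: algebra_simps power2_eq_square)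
  finally show ?thesis using D by (simp only: d R_def)
qed

text \<open>With v = a^2 r^2 in [0, 1] and sin^2 r^2 = 1 - v, the error is r^3 times the convex
  combination, with weights sin^2 and cos^2, of 1 - 3 v and 1 + 3 v - 15 v (1 - v); both are at most
  4.\<close>

lemma morawetz_err_le:
  assumes "0 < \<theta>" "\<theta> < pi"
  shows "morawetz_err a \<theta> \<le> 4 * inverse (sqrt (a\<^sup>2 + (sin \<theta>)\<^sup>2)) ^ 3"
proof -
  define s c where "s = sin \<theta>" "c = cos \<theta>"
  define r where "r = inverse (sqrt (a\<^sup>2 + s\<^sup>2))"
  note d = \<open>s = sin \<theta>\<close> \<open>c = cos \<theta>\<close> r_def
  have s0: "s > 0" using sin_gt_zero[OF assms] by (simp add: d)
  have p: "0 < a\<^sup>2 + s\<^sup>2" using s0 by (simp add: add_nonneg_pos)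
  have r0: "r > 0" using p by (simp add: d)
  define u v where "u = s\<^sup>2 * r\<^sup>2" "v = a\<^sup>2 * r\<^sup>2"
  note e = this
  have uv: "u = 1 - v" 
  proof -
    have "r\<^sup>2 = inverse (a\<^sup>2 + s\<^sup>2)" using p by (simp add: d power_inverse)
    then have "u + v = (s\<^sup>2 + a\<^sup>2) * inverse (a\<^sup>2 + s\<^sup>2)" by (simp add: e algebra_simps)
    moreover have "(s\<^sup>2 + a\<^sup>2) * inverse (a\<^sup>2 + s\<^sup>2) = 1" using p by (metis add.commute right_inverse less_irrefl)
    ultimately show ?thesis by simp
  qed
  have v: "0 \<le> v" "v \<le> 1" using uv by (auto simp: e)
      (metis diff_ge_0_iff_ge mult_nonneg_nonneg zero_le_power2)
  have sc: "s\<^sup>2 + c\<^sup>2 = 1" by (simp add: d)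
  have "morawetz_err a \<theta> = r ^ 3 * ((2 * c\<^sup>2 - s\<^sup>2) * (3 * v - 1) + 3 * c\<^sup>2 * u * (1 - 5 * v))"
    unfolding morawetz_err_def Let_def d(1,2)[symmetric] d(3)[symmetric] e
    by (simp add: algebra_simps eval_nat_numeral)
  also have "(2 * c\<^sup>2 - s\<^sup>2) * (3 * v - 1) + 3 * c\<^sup>2 * u * (1 - 5 * v)
     = s\<^sup>2 * (1 - 3 * v) + c\<^sup>2 * (1 + 3 * v - 15 * (v * (1 - v)))"
    unfolding uv by (simp add: algebra_simps)
  also have "\<dots> \<le> s\<^sup>2 * 4 + c\<^sup>2 * 4"
  proof (intro add_mono mult_left_mono)
    have "0 \<le> v * (1 - v)" using v by simp
    then show "1 + 3 * v - 15 * (v * (1 - v)) \<le> 4" using v by linarith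
  qed (use v in auto)
  also have "\<dots> = 4" using sc by simp
  finally show ?thesis using r0 unfolding d(1)[symmetric] d(3)[symmetric] by (simp add: mult.commute)
qed

text \<open>Integrate \<open>DERIV_morawetz\<close> over [0, pi]. At the poles the terms with a
  factor sin vanish and a multiple of z^2 - \<mu> y^2 is left; the boundary hypotheses remove it.
  For Legendre functions they hold since \<mu> = 0 for order 0 and y = 0 at the poles for every
  other order.\<close>

lemma weighted_integral_scale:
  fixes y z :: "real \<Rightarrow> real"
  assumes cont [continuous_intros]: "continuous_on {0..pi} y" "continuous_on {0..pi} z"
    and y: "\<And>\<theta>. 0 < \<theta> \<Longrightarrow> \<theta> < pi \<Longrightarrow> (y has_real_derivative z \<theta> / sin \<theta>) (at \<theta>)"
    and z: "\<And>\<theta>. 0 < \<theta> \<Longrightarrow> \<theta> < pi \<Longrightarrow>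
       (z has_real_derivative - (\<Lambda> * (sin \<theta>)\<^sup>2 - \<mu>) * y \<theta> / sin \<theta>) (at \<theta>)"
    and bd: "z 0 = 0" "z pi = 0" "\<mu> * (y 0)\<^sup>2 = 0" "\<mu> * (y pi)\<^sup>2 = 0"
    and a: "a > 0" and \<Lambda>: "\<Lambda> * a\<^sup>2 \<ge> 2" and \<mu>: "\<mu> \<ge> 0"
  shows "integral {0..pi} (\<lambda>\<theta>. sin \<theta> * (y \<theta>)\<^sup>2 / sqrt (a\<^sup>2 + (sin \<theta>)\<^sup>2) ^ 3)
    \<le> 2 / a\<^sup>2 * integral {0..pi} (\<lambda>\<theta>. sin \<theta> * (y \<theta>)\<^sup>2)"
proof -
  define R where "R = (\<lambda>\<theta>. inverse (sqrt (a\<^sup>2 + (sin \<theta>)\<^sup>2)))"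
  have Rx: "inverse (sqrt (a\<^sup>2 + (sin \<theta>)\<^sup>2)) = R \<theta>" for \<theta> by (simp add: R_def)
  have p: "0 < a\<^sup>2 + (sin \<theta>)\<^sup>2" for \<theta> using a by (simp add: add_pos_nonneg)
  then have p': "a\<^sup>2 + (sin \<theta>)\<^sup>2 \<noteq> 0" for \<theta> by (metis less_irrefl)
  have contR [continuous_intros]: "continuous_on {0..pi} R"
    unfolding R_def
  proof (rule continuous_on_inverse)
    show "continuous_on {0..pi} (\<lambda>\<theta>. sqrt (a\<^sup>2 + (sin \<theta>)\<^sup>2))"
      by (intro continuous_on_real_sqrt continuous_on_add continuous_on_const continuous_on_power continuous_on_sin continuous_on_id)
    show "\<forall>\<theta>\<in>{0..pi}. sqrt (a\<^sup>2 + (sin \<theta>)\<^sup>2) \<noteq> 0"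
      using p' by simp
  qed
  have contM: "continuous_on {0..pi} (morawetz a \<Lambda> \<mu> y z)"
    unfolding morawetz_def Let_def Rx by (intro continuous_intros)
  have contE [continuous_intros]: "continuous_on {0..pi} (morawetz_err a)"
    unfolding morawetz_err_def Let_def Rx by (intro continuous_intros)
  have \<Lambda>0: "\<Lambda> > 0" using \<Lambda> a zero_less_mult_pos2[of \<Lambda> "a\<^sup>2"] by simp
  let ?b = "sqrt (1 + a\<^sup>2)"
  define g where "g = (\<lambda>\<theta>. sin \<theta> * (y \<theta>)\<^sup>2 *
      (2 * (1 + a\<^sup>2) * (\<Lambda> * a\<^sup>2 + \<mu>) * R \<theta> ^ 3
       - (1 + a\<^sup>2) / 2 * morawetz_err a \<theta> - 2 * \<Lambda> * sqrt (a\<^sup>2 + (sin \<theta>)\<^sup>2)))"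
  have "(g has_integral (morawetz a \<Lambda> \<mu> y z pi - morawetz a \<Lambda> \<mu> y z 0)) {0..pi}"
    unfolding g_def R_def
    by (rule has_integral_FTC[OF _ contM]) (simp, rule DERIV_morawetz, (assumption | rule y z)+)
  moreover have "morawetz a \<Lambda> \<mu> y z pi = 0" "morawetz a \<Lambda> \<mu> y z 0 = 0"
    using bd by (auto simp: morawetz_def)
  ultimately have g0: "(g has_integral 0) {0..pi}" by simp
  define I where "I = integral {0..pi} (\<lambda>\<theta>. sin \<theta> * (y \<theta>)\<^sup>2 * R \<theta> ^ 3)"
  define N where "N = integral {0..pi} (\<lambda>\<theta>. sin \<theta> * (y \<theta>)\<^sup>2)"
  have I: "((\<lambda>\<theta>. sin \<theta> * (y \<theta>)\<^sup>2 * R \<theta> ^ 3) has_integral I) {0..pi}"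
    unfolding I_def by (intro integrable_integral integrable_continuous_interval continuous_intros)
  have N: "((\<lambda>\<theta>. sin \<theta> * (y \<theta>)\<^sup>2) has_integral N) {0..pi}"
    unfolding N_def by (intro integrable_integral integrable_continuous_interval continuous_intros)
  have le: "(1 + a\<^sup>2) * (\<Lambda> * a\<^sup>2) * (sin \<theta> * (y \<theta>)\<^sup>2 * R \<theta> ^ 3) - 2 * \<Lambda> * ?b * (sin \<theta> * (y \<theta>)\<^sup>2) \<le> g \<theta>"
    if "\<theta> \<in> {0..pi}" for \<theta>
  proof (cases "\<theta> = 0 \<or> \<theta> = pi")
    case True
    then show ?thesis by (auto simp: g_def)
  next
    case False
    then have \<theta>: "0 < \<theta>" "\<theta> < pi" using that by auto
    have R0: "R \<theta> > 0" using p by (simp add: R_def)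
    have s1: "sqrt (a\<^sup>2 + (sin \<theta>)\<^sup>2) \<le> ?b" using sin_cos_squared_add[of \<theta>]
      by (intro real_sqrt_le_mono) (smt (verit) zero_le_power2)
    have "(1 + a\<^sup>2) / 2 * morawetz_err a \<theta> \<le> (1 + a\<^sup>2) / 2 * (4 * R \<theta> ^ 3)"
      using morawetz_err_le[OF \<theta>, of a] by (intro mult_left_mono) (auto simp: R_def add_nonneg_nonneg)
    \<comment> \<open>The threshold enters here: \<Lambda> a^2 \<ge> 2 gives 2 (\<Lambda> a^2 +
      \<mu>) - 2 \<ge> \<Lambda> a^2, so half of the main term absorbs the error, which is at most 2
      (1 + a^2) r^3.\<close>
    moreover have "(1 + a\<^sup>2) * (\<Lambda> * a\<^sup>2) * R \<theta> ^ 3 \<le> 2 * (1 + a\<^sup>2) * (\<Lambda> * a\<^sup>2 + \<mu>) * R \<theta> ^ 3 - (1 + a\<^sup>2) / 2 * (4 * R \<theta> ^ 3)"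
    proof -
      have "(1 + a\<^sup>2) * R \<theta> ^ 3 * (\<Lambda> * a\<^sup>2) \<le> (1 + a\<^sup>2) * R \<theta> ^ 3 * (2 * (\<Lambda> * a\<^sup>2 + \<mu>) - 2)"
        using \<Lambda> \<mu> R0 by (intro mult_left_mono) (auto simp: add_nonneg_nonneg)
      then show ?thesis by (simp add: algebra_simps)
    qed
    moreover have "2 * \<Lambda> * sqrt (a\<^sup>2 + (sin \<theta>)\<^sup>2) \<le> 2 * \<Lambda> * ?b"
      using s1 \<Lambda>0 by simp
    ultimately have "(1 + a\<^sup>2) * (\<Lambda> * a\<^sup>2) * R \<theta> ^ 3 - 2 * \<Lambda> * ?b \<le> 2 * (1 + a\<^sup>2) * (\<Lambda> * a\<^sup>2 + \<mu>) * R \<theta> ^ 3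
       - (1 + a\<^sup>2) / 2 * morawetz_err a \<theta> - 2 * \<Lambda> * sqrt (a\<^sup>2 + (sin \<theta>)\<^sup>2)" by linarith
    then have "sin \<theta> * (y \<theta>)\<^sup>2 * ((1 + a\<^sup>2) * (\<Lambda> * a\<^sup>2) * R \<theta> ^ 3 - 2 * \<Lambda> * ?b) \<le> g \<theta>"
      unfolding g_def using sin_gt_zero[OF \<theta>] by (intro mult_left_mono) auto
    then show ?thesis by (simp add: algebra_simps)
  qed
  have "(1 + a\<^sup>2) * (\<Lambda> * a\<^sup>2) * I - 2 * \<Lambda> * ?b * N \<le> 0"
    by (rule has_integral_le[OF has_integral_diff[OF has_integral_mult_right[OF I] has_integral_mult_right[OF N]] g0 le])
  then have *: "\<Lambda> * ((1 + a\<^sup>2) * a\<^sup>2 * I) \<le> \<Lambda> * (2 * ?b * N)" by (simp add: algebra_simps)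
  have N0: "N \<ge> 0" by (rule has_integral_nonneg[OF N]) (auto intro!: mult_nonneg_nonneg sin_ge_zero)
  have b: "?b \<le> 1 + a\<^sup>2"
    by (rule real_le_lsqrt) (auto simp: power2_sum add_nonneg_nonneg)
  have "(1 + a\<^sup>2) * a\<^sup>2 * I \<le> 2 * ?b * N" using * \<Lambda>0 by simp
  also have "\<dots> \<le> 2 * (1 + a\<^sup>2) * N" using N0 b by (intro mult_right_mono) auto
  finally have "(1 + a\<^sup>2) * (a\<^sup>2 * I) \<le> (1 + a\<^sup>2) * (2 * N)" by (simp add: algebra_simps)
  moreover have "1 + a\<^sup>2 > 0" by (simp add: add_pos_nonneg)
  ultimately have "a\<^sup>2 * I \<le> 2 * N" by simp
  then have "I \<le> 2 / a\<^sup>2 * N" using a by (simp add: field_simps)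
  then show ?thesis unfolding I_def N_def R_def by (simp add: divide_inverse power_inverse)
qed

text \<open>The limiting case \<open>a = 0\<close>: here the boundary terms vanish because \<open>y\<close> and \<open>z\<close> are divisible by \<open>sin\<close>.\<close>

lemma weighted_integral_singular:
  fixes y z g h :: "real \<Rightarrow> real"
  assumes cont [continuous_intros]: "continuous_on {0..pi} g" "continuous_on {0..pi} h"
    and yg: "\<And>\<theta>. y \<theta> = sin \<theta> * g \<theta>" and zh: "\<And>\<theta>. z \<theta> = sin \<theta> * h \<theta>"
    and y: "\<And>\<theta>. 0 < \<theta> \<Longrightarrow> \<theta> < pi \<Longrightarrow> (y has_real_derivative z \<theta> / sin \<theta>) (at \<theta>)"
    and z: "\<And>\<theta>. 0 < \<theta> \<Longrightarrow> \<theta> < pi \<Longrightarrow>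
       (z has_real_derivative - (\<Lambda> * (sin \<theta>)\<^sup>2 - \<mu>) * y \<theta> / sin \<theta>) (at \<theta>)"
    and \<Lambda>: "\<Lambda> \<ge> 0" and \<mu>: "\<mu> \<ge> 1"
  shows "integral {0..pi} (\<lambda>\<theta>. (g \<theta>)\<^sup>2) \<le> 4 / 3 * \<Lambda> * integral {0..pi} (\<lambda>\<theta>. sin \<theta> * (y \<theta>)\<^sup>2)"
proof -
  \<comment> \<open>\<open>morawetz 0\<close> contains 1/sin, which is 0 by convention at the poles.
    Cancelling the factors sin of y and z gives \<Psi>, which is continuous on the closed interval
    and zero at both ends.\<close>
  define \<Psi> where "\<Psi> = (\<lambda>\<theta>. sin \<theta> * (cos \<theta> * ((h \<theta>)\<^sup>2 + (\<Lambda> * (sin \<theta>)\<^sup>2 - \<mu>) * (g \<theta>)\<^sup>2) + g \<theta> * h \<theta> + cos \<theta> * (g \<theta>)\<^sup>2 / 2))"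
  have eq: "morawetz 0 \<Lambda> \<mu> y z \<theta> = \<Psi> \<theta>" if "0 < \<theta>" "\<theta> < pi" for \<theta>
    unfolding morawetz_def Let_def \<Psi>_def yg zh using sin_gt_zero[OF that]
    by (simp add: field_simps eval_nat_numeral)
  have err: "morawetz_err 0 \<theta> = inverse (sin \<theta>) ^ 3" if "0 < \<theta>" "\<theta> < pi" for \<theta>
    unfolding morawetz_err_def Let_def using sin_gt_zero[OF that] cos_squared_eq[of \<theta>]
    by (simp add: field_simps eval_nat_numeral)
  have "((\<lambda>\<theta>. (2 * \<mu> - 1 / 2) * (g \<theta>)\<^sup>2 - 2 * \<Lambda> * ((sin \<theta>)\<^sup>2 * (y \<theta>)\<^sup>2)) has_integral (\<Psi> pi - \<Psi> 0)) {0..pi}"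
  proof (rule has_integral_FTC)
    show "continuous_on {0..pi} \<Psi>" unfolding \<Psi>_def by (intro continuous_intros) auto
  next
    fix \<theta> :: real assume \<theta>: "0 < \<theta>" "\<theta> < pi"
    have "(\<Psi> has_real_derivative sin \<theta> * (y \<theta>)\<^sup>2 *
      (2 * (1 + 0\<^sup>2) * (\<Lambda> * 0\<^sup>2 + \<mu>) * inverse (sqrt (0\<^sup>2 + (sin \<theta>)\<^sup>2)) ^ 3
       - (1 + 0\<^sup>2) / 2 * morawetz_err 0 \<theta> - 2 * \<Lambda> * sqrt (0\<^sup>2 + (sin \<theta>)\<^sup>2))) (at \<theta>)"
      by (rule has_field_derivative_transform_within_open[OF DERIV_morawetz[OF \<theta> y[OF \<theta>] z[OF \<theta>]], where S = "{0<..<pi}"])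
         (use \<theta> eq in auto)
    then show "(\<Psi> has_real_derivative ((2 * \<mu> - 1 / 2) * (g \<theta>)\<^sup>2 - 2 * \<Lambda> * ((sin \<theta>)\<^sup>2 * (y \<theta>)\<^sup>2))) (at \<theta>)"
      unfolding err[OF \<theta>] yg using sin_gt_zero[OF \<theta>]
      by (elim DERIV_cong) (simp add: field_simps eval_nat_numeral)
  qed simp
  then have g0: "((\<lambda>\<theta>. (2 * \<mu> - 1 / 2) * (g \<theta>)\<^sup>2 - 2 * \<Lambda> * ((sin \<theta>)\<^sup>2 * (y \<theta>)\<^sup>2)) has_integral 0) {0..pi}"
    by (simp add: \<Psi>_def)
  define I where "I = integral {0..pi} (\<lambda>\<theta>. (g \<theta>)\<^sup>2)"
  define N where "N = integral {0..pi} (\<lambda>\<theta>. sin \<theta> * (y \<theta>)\<^sup>2)"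
  have I: "((\<lambda>\<theta>. (g \<theta>)\<^sup>2) has_integral I) {0..pi}"
    unfolding I_def by (intro integrable_integral integrable_continuous_interval continuous_intros)
  have N: "((\<lambda>\<theta>. sin \<theta> * (y \<theta>)\<^sup>2) has_integral N) {0..pi}"
    unfolding N_def yg by (intro integrable_integral integrable_continuous_interval continuous_intros)
  \<comment> \<open>From \<mu> \<ge> 1 the coefficient 2 \<mu> - 1/2 is at least 3/2; the 1/2 comes
    from \<open>morawetz_err\<close>, which is 1/sin^3 at a = 0. Hence the constant 4/3.\<close>
  have "3 / 2 * I - 2 * \<Lambda> * N \<le> 0"
  proof (rule has_integral_le[OF has_integral_diff[OF has_integral_mult_right[OF I] has_integral_mult_right[OF N]] g0])
    fix \<theta> :: real assume "\<theta> \<in> {0..pi}"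
    then have s: "sin \<theta> \<ge> 0" "sin \<theta> \<le> 1" by (auto intro: sin_ge_zero)
    have "3 / 2 * (g \<theta>)\<^sup>2 \<le> (2 * \<mu> - 1 / 2) * (g \<theta>)\<^sup>2" using \<mu> by (intro mult_right_mono) auto
    moreover have "2 * \<Lambda> * ((sin \<theta>)\<^sup>2 * (y \<theta>)\<^sup>2) \<le> 2 * \<Lambda> * (sin \<theta> * (y \<theta>)\<^sup>2)"
      using \<Lambda> s by (intro mult_left_mono mult_right_mono) (auto simp: power2_eq_square mult_left_le)
    ultimately show "3 / 2 * (g \<theta>)\<^sup>2 - 2 * \<Lambda> * (sin \<theta> * (y \<theta>)\<^sup>2) \<le> (2 * \<mu> - 1 / 2) * (g \<theta>)\<^sup>2 - 2 * \<Lambda> * ((sin \<theta>)\<^sup>2 * (y \<theta>)\<^sup>2)"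
      by linarith
  qed
  then show ?thesis unfolding I_def N_def by simp
qed

lemma polar_legendre_weighted_scale:
  assumes "a > 0" "real l * (real l + 1) * a\<^sup>2 \<ge> 2"
  shows "integral {0..pi} (\<lambda>\<theta>. sin \<theta> * (polar_legendre l n \<theta>)\<^sup>2 / sqrt (a\<^sup>2 + (sin \<theta>)\<^sup>2) ^ 3)
    \<le> 2 / a\<^sup>2 * integral {0..pi} (\<lambda>\<theta>. sin \<theta> * (polar_legendre l n \<theta>)\<^sup>2)"
proof (rule weighted_integral_scale[where \<mu> = "(real n)\<^sup>2" and z = "sin_deriv_legendre l n"])
  show "sin_deriv_legendre l n 0 = 0" "sin_deriv_legendre l n pi = 0" by (cases n; simp add: sin_deriv_legendre_def)+
  show "(real n)\<^sup>2 * (polar_legendre l n 0)\<^sup>2 = 0" "(real n)\<^sup>2 * (polar_legendre l n pi)\<^sup>2 = 0" by (cases n; simp add: polar_legendre_def)+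
qed (fact assms continuous_on_polar_legendre DERIV_polar_legendre DERIV_sin_deriv_legendre zero_le_power2)+

text \<open>The left integrand is sin y^2 / sin^3, with the factor sin of y already cancelled
  against the weight so that it is continuous at the poles.\<close>

lemma polar_legendre_weighted_singular:
  assumes "n > 0"
  shows "integral {0..pi} (\<lambda>\<theta>. (sin \<theta> ^ (n - 1) * poly (rodrigues l (l + n)) (cos \<theta>))\<^sup>2)
    \<le> 4 / 3 * (real l * (real l + 1)) * integral {0..pi} (\<lambda>\<theta>. sin \<theta> * (polar_legendre l n \<theta>)\<^sup>2)"
proof (rule weighted_integral_singular[where \<mu> = "(real n)\<^sup>2" and z = "sin_deriv_legendre l n" and
    h = "\<lambda>\<theta>. sin \<theta> ^ (n - 1) * (real n * cos \<theta> * poly (rodrigues l (l + n)) (cos \<theta>)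
      - (sin \<theta>)\<^sup>2 * poly (rodrigues l (Suc (l + n))) (cos \<theta>))"])
  show "polar_legendre l n \<theta> = sin \<theta> * (sin \<theta> ^ (n - 1) * poly (rodrigues l (l + n)) (cos \<theta>))" for \<theta>
    using assms by (cases n) (auto simp: polar_legendre_def)
  show "sin_deriv_legendre l n \<theta> = sin \<theta> * (sin \<theta> ^ (n - 1) * (real n * cos \<theta> * poly (rodrigues l (l + n)) (cos \<theta>)
      - (sin \<theta>)\<^sup>2 * poly (rodrigues l (Suc (l + n))) (cos \<theta>)))" for \<theta>
    using assms by (cases n) (auto simp: sin_deriv_legendre_def)
  show "continuous_on {0..pi} (\<lambda>\<theta>. sin \<theta> ^ (n - 1) * poly (rodrigues l (l + n)) (cos \<theta>))"
    by (intro continuous_intros)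
  show "continuous_on {0..pi} (\<lambda>\<theta>. sin \<theta> ^ (n - 1) * (real n * cos \<theta> * poly (rodrigues l (l + n)) (cos \<theta>)
      - (sin \<theta>)\<^sup>2 * poly (rodrigues l (Suc (l + n))) (cos \<theta>)))"
    by (intro continuous_intros)
  show "1 \<le> (real n)\<^sup>2" using assms by simp
  show "0 \<le> real l * (real l + 1)" by simp
qed (fact DERIV_polar_legendre DERIV_sin_deriv_legendre)+

section \<open>Dilations of the sphere\<close>

lemma sets_sphere_measure [measurable_cong]:
  "sets sphere_measure = sets (restrict_space borel ({0..pi} \<times> {0..<2*pi}))"
  by (simp add: sphere_measure_def sets_restrict_space)

lemma borel_measurable_sphereI: "f \<in> borel_measurable borel \<Longrightarrow> f \<in> borel_measurable sphere_measure"
  using measurable_restrict_space1[of f borel borel] measurable_cong_sets[OF sets_sphere_measure refl] by blast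

lemma measurable_fst_sphere [measurable]: "fst \<in> borel_measurable sphere_measure"
  and measurable_snd_sphere [measurable]: "snd \<in> borel_measurable sphere_measure"
  by (auto intro!: borel_measurable_sphereI borel_measurable_continuous_onI continuous_intros)

lemma sphere_rect_measurable: "{0..pi} \<times> {0..<2*pi} \<in> sets (borel :: (real \<times> real) measure)"
  by (simp add: borel_prod[symmetric])

lemma measurable_sphere_ext:
  fixes F :: "real \<times> real \<Rightarrow> ennreal"
  assumes "F \<in> borel_measurable sphere_measure"
  shows "(\<lambda>\<omega>. F \<omega> * ennreal (sin (fst \<omega>)) * indicator ({0..pi} \<times> {0..<2*pi}) \<omega>) \<in> borel_measurable borel"
proof -
  have "(\<lambda>\<omega>. F \<omega> * ennreal (sin (fst \<omega>))) \<in> borel_measurable sphere_measure"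
    using assms by measurable
  then have "(\<lambda>\<omega>. F \<omega> * ennreal (sin (fst \<omega>))) \<in> borel_measurable (restrict_space borel ({0..pi} \<times> {0..<2*pi}))"
    using measurable_cong_sets[OF sets_sphere_measure refl] by blast
  then show ?thesis
    by (subst (asm) borel_measurable_restrict_space_iff_ennreal) (use sphere_rect_measurable in auto)
qed

text \<open>Tonelli with \<theta> innermost, so that the polar angle can be substituted at fixed
  \<phi>.\<close>

lemma nn_integral_sphere:
  fixes F :: "real \<times> real \<Rightarrow> ennreal"
  assumes [measurable]: "F \<in> borel_measurable sphere_measure"
  shows "(\<integral>\<^sup>+\<omega>. F \<omega> \<partial>sphere_measure) =
    (\<integral>\<^sup>+\<phi>. \<integral>\<^sup>+\<theta>. F (\<theta>, \<phi>) * ennreal (sin \<theta>) * indicator ({0..pi} \<times> {0..<2*pi}) (\<theta>, \<phi>) \<partial>lborel \<partial>lborel)"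
proof -
  have F: "F \<in> borel_measurable (restrict_space lborel ({0..pi} \<times> {0..<2*pi}))"
    using assms by (simp add: sphere_measure_def)
  have "(\<integral>\<^sup>+\<omega>. F \<omega> \<partial>sphere_measure) =
     (\<integral>\<^sup>+\<omega>. ennreal (sin (fst \<omega>)) * F \<omega> \<partial>restrict_space lborel ({0..pi} \<times> {0..<2*pi}))"
    unfolding sphere_measure_def
    by (rule nn_integral_density) (use F in \<open>auto intro!: measurable_restrict_space1\<close>)
  also have "\<dots> = (\<integral>\<^sup>+\<omega>. F \<omega> * ennreal (sin (fst \<omega>)) * indicator ({0..pi} \<times> {0..<2*pi}) \<omega> \<partial>lborel)"
    by (subst nn_integral_restrict_space) (use sphere_rect_measurable in \<open>auto simp: mult_ac\<close>)
  also have "\<dots> = (\<integral>\<^sup>+\<omega>. F \<omega> * ennreal (sin (fst \<omega>)) * indicator ({0..pi} \<times> {0..<2*pi}) \<omega> \<partial>(lborel \<Otimes>\<^sub>M lborel))"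
    by (simp only: lborel_prod)
  also have "\<dots> = (\<integral>\<^sup>+\<phi>. \<integral>\<^sup>+\<theta>. F (\<theta>, \<phi>) * ennreal (sin \<theta>) * indicator ({0..pi} \<times> {0..<2*pi}) (\<theta>, \<phi>) \<partial>lborel \<partial>lborel)"
    by (subst lborel_pair.nn_integral_snd[symmetric])
       (use measurable_sphere_ext[OF assms] in \<open>simp_all add: lborel_prod\<close>)
  finally show ?thesis .
qed

text \<open>Equals cos^2(\<theta>/2) (1 + b tan^2(\<theta>/2)), in a form that is meaningful at
  \<theta> = pi. With b^2 in place of b it is the denominator in the sine and in the derivative of
  the dilated angle.\<close>

definition half_den :: "real \<Rightarrow> real \<Rightarrow> real" where
  "half_den b \<theta> = (cos (\<theta> / 2))\<^sup>2 + b * (sin (\<theta> / 2))\<^sup>2"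

lemma half_den_pos:
  assumes "b > 0"
  shows "half_den b \<theta> > 0"
proof (cases "cos (\<theta> / 2) = 0")
  case True
  then have "(sin (\<theta> / 2))\<^sup>2 = 1" using sin_cos_squared_add[of "\<theta> / 2"] by simp
  with True assms show ?thesis by (simp add: half_den_def)
next
  case False
  then show ?thesis using assms by (simp add: half_den_def add_pos_nonneg)
qed

lemma half_angle:
  fixes \<theta> :: real
  shows "cos \<theta> = (cos (\<theta> / 2))\<^sup>2 - (sin (\<theta> / 2))\<^sup>2" "sin \<theta> = 2 * sin (\<theta> / 2) * cos (\<theta> / 2)"
    "1 + cos \<theta> = 2 * (cos (\<theta> / 2))\<^sup>2" "1 - cos \<theta> = 2 * (sin (\<theta> / 2))\<^sup>2"
  using cos_double[of "\<theta> / 2"] sin_double[of "\<theta> / 2"] sin_cos_squared_add[of "\<theta> / 2"]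
  by (simp_all del: sin_cos_squared_add)

lemma theta_dil_range:
  assumes "b > 0" "0 \<le> \<theta>" "\<theta> \<le> pi"
  shows "0 \<le> theta_dil b \<theta>" "theta_dil b \<theta> \<le> pi"
proof -
  have "tan (\<theta> / 2) \<ge> 0" if "\<theta> < pi"
    using that assms by (cases "\<theta> = 0") (auto intro!: less_imp_le tan_gt_zero)
  then show "0 \<le> theta_dil b \<theta>" "theta_dil b \<theta> \<le> pi"
    using assms arctan_ubound[of "b * tan (\<theta> / 2)"] by (auto simp: theta_dil_def)
qed

lemma half_cos_pos: "0 \<le> \<theta> \<Longrightarrow> \<theta> < pi \<Longrightarrow> cos (\<theta> / 2) > 0"
  by (intro cos_gt_zero_pi) auto

lemma tan_half_theta_dil:
  assumes "b > 0" "0 \<le> \<theta>" "\<theta> < pi"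
  shows "tan (theta_dil b \<theta> / 2) = b * tan (\<theta> / 2)"
  using assms by (simp add: theta_dil_def tan_arctan)

lemma theta_dil_lt_pi: "\<theta> \<noteq> pi \<Longrightarrow> theta_dil b \<theta> < pi"
  using arctan_ubound[of "b * tan (\<theta> / 2)"] by (simp add: theta_dil_def)

lemma trig_of_tan_half:
  assumes "0 \<le> \<theta>" "\<theta> < pi"
  shows "cos \<theta> = (1 - (tan (\<theta> / 2))\<^sup>2) / (1 + (tan (\<theta> / 2))\<^sup>2)"
    "sin \<theta> = 2 * tan (\<theta> / 2) / (1 + (tan (\<theta> / 2))\<^sup>2)"
proof -
  have C: "cos (\<theta> / 2) > 0" using half_cos_pos[OF assms] .
  have "1 + (tan (\<theta> / 2))\<^sup>2 = inverse ((cos (\<theta> / 2))\<^sup>2)"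
    using C tan_sec[of "\<theta> / 2"] by (simp add: power_inverse)
  then show "cos \<theta> = (1 - (tan (\<theta> / 2))\<^sup>2) / (1 + (tan (\<theta> / 2))\<^sup>2)"
    "sin \<theta> = 2 * tan (\<theta> / 2) / (1 + (tan (\<theta> / 2))\<^sup>2)"
    using C unfolding half_angle(1,2)[of \<theta>] by (simp_all add: tan_def field_simps power2_eq_square)
qed

lemma sin_theta_dil:
  assumes "b > 0" "0 \<le> \<theta>" "\<theta> \<le> pi"
  shows "sin (theta_dil b \<theta>) = b * sin \<theta> / half_den (b\<^sup>2) \<theta>"
proof (cases "\<theta> = pi")
  case True
  then show ?thesis by (simp add: theta_dil_def)
next
  case False
  then have \<theta>: "0 \<le> \<theta>" "\<theta> < pi" using assms by auto
  have C: "cos (\<theta> / 2) > 0" using half_cos_pos[OF \<theta>] .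
  have "sin (theta_dil b \<theta>) = 2 * (b * tan (\<theta> / 2)) / (1 + (b * tan (\<theta> / 2))\<^sup>2)"
    using trig_of_tan_half(2)[of "theta_dil b \<theta>"] theta_dil_range[OF assms] theta_dil_lt_pi[OF False]
      tan_half_theta_dil[OF assms(1) \<theta>] by simp
  also have "1 + (b * tan (\<theta> / 2))\<^sup>2 = half_den (b\<^sup>2) \<theta> / (cos (\<theta> / 2))\<^sup>2"
    using C by (simp add: half_den_def tan_def field_simps)
  also have "2 * (b * tan (\<theta> / 2)) / (half_den (b\<^sup>2) \<theta> / (cos (\<theta> / 2))\<^sup>2) = b * sin \<theta> / half_den (b\<^sup>2) \<theta>"
    unfolding half_angle(2)[of \<theta>] using C by (simp add: tan_def power2_eq_square)
  finally show ?thesis .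
qed

lemma theta_dil_inverse:
  assumes "a > 0" "0 \<le> \<theta>" "\<theta> \<le> pi"
  shows "theta_dil a (theta_dil (1 / a) \<theta>) = \<theta>"
proof (cases "\<theta> = pi")
  case False
  have "arctan (tan (\<theta> / 2)) = \<theta> / 2"
    by (rule arctan_tan) (use assms False in auto)
  then show ?thesis
    using False theta_dil_lt_pi[OF False, of "1 / a"] tan_half_theta_dil[of "1 / a" \<theta>] assms
    by (simp add: theta_dil_def[of a])
qed (simp add: theta_dil_def)

text \<open>A formula for \<open>theta_dil b\<close> on \<open>[0, \<pi>]\<close> that is smooth on the whole line, also across \<open>\<pi>\<close>; it comes
  from the addition theorem for \<open>arctan (b tan (\<theta>/2)) - \<theta>/2\<close>.\<close>

definition dil_smooth :: "real \<Rightarrow> real \<Rightarrow> real" where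
  "dil_smooth b \<theta> = \<theta> + 2 * arctan ((b - 1) * sin (\<theta> / 2) * cos (\<theta> / 2) / half_den b \<theta>)"

text \<open>The substitution rule used below needs a derivative at every point of [0, pi], whereas
  \<open>theta_dil\<close> is defined by cases at pi. Off pi, both arctangent arguments agree by the
  tangent subtraction formula, and the difference of angles stays within (-pi/2, pi/2).\<close>

lemma theta_dil_eq_smooth:
  assumes "b > 0" "0 \<le> \<theta>" "\<theta> \<le> pi"
  shows "theta_dil b \<theta> = dil_smooth b \<theta>"
proof (cases "\<theta> = pi")
  case True
  then show ?thesis by (simp add: theta_dil_def dil_smooth_def)
next
  case False
  then have \<theta>: "0 \<le> \<theta>" "\<theta> < pi" using assms by auto
  have C: "cos (\<theta> / 2) > 0" using half_cos_pos[OF \<theta>] .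
  define t where "t = tan (\<theta> / 2)"
  have t0: "t \<ge> 0"
    unfolding t_def using \<theta> by (cases "\<theta> = 0") (auto intro!: less_imp_le tan_gt_zero)
  have a0: "0 \<le> arctan (b * t)" "arctan (b * t) < pi / 2" using t0 assms arctan_ubound by auto
  have "arctan ((b * t - t) / (1 + b * t * t)) = arctan (b * t) - \<theta> / 2"
  proof (rule arctan_unique)
    show "- (pi / 2) < arctan (b * t) - \<theta> / 2" "arctan (b * t) - \<theta> / 2 < pi / 2"
      using a0 \<theta> by linarith+
    have "tan (arctan (b * t) - \<theta> / 2) = (b * t - t) / (1 + b * t * t)"
    proof (subst tan_diff)
      show "cos (arctan (b * t) - \<theta> / 2) \<noteq> 0"
        using cos_gt_zero_pi[of "arctan (b * t) - \<theta> / 2"] a0 \<theta> by auto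
    qed (use C in \<open>auto simp: tan_arctan t_def\<close>)
    then show "tan (arctan (b * t) - \<theta> / 2) = (b * t - t) / (1 + b * t * t)" .
  qed
  moreover have "(b * t - t) / (1 + b * t * t) = (b - 1) * sin (\<theta> / 2) * cos (\<theta> / 2) / half_den b \<theta>"
  proof -
    have "1 + b * t * t = half_den b \<theta> / (cos (\<theta> / 2))\<^sup>2"
      using C by (simp add: half_den_def t_def tan_def field_simps power2_eq_square)
    moreover have "b * t - t = (b - 1) * sin (\<theta> / 2) * cos (\<theta> / 2) / (cos (\<theta> / 2))\<^sup>2"
      using C by (simp add: t_def tan_def power2_eq_square algebra_simps diff_divide_distrib)
    ultimately show ?thesis using C by simp
  qed
  ultimately show ?thesis using False by (simp add: theta_dil_def dil_smooth_def t_def)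
qed

lemma DERIV_dil_smooth:
  assumes "b > 0"
  shows "(dil_smooth b has_real_derivative b / half_den (b\<^sup>2) \<theta>) (at \<theta>)"
proof -
  define S C D V where "S = sin (\<theta> / 2)" "C = cos (\<theta> / 2)" "D = half_den b \<theta>" "V = half_den (b\<^sup>2) \<theta>"
  note d = this
  have D0: "D > 0" and V0: "V > 0" unfolding d using half_den_pos assms by auto
  have sc: "S * S = 1 - C * C" using sin_cos_squared_add[of "\<theta> / 2"] unfolding d power2_eq_square by linarith
  have DD: "D = C\<^sup>2 + b * S\<^sup>2" and VV: "V = C\<^sup>2 + b\<^sup>2 * S\<^sup>2" by (simp_all add: d half_den_def)
  have dD: "(half_den b has_real_derivative (b - 1) * S * C) (at \<theta>)"
    unfolding half_den_def[abs_def] by (auto intro!: derivative_eq_intros simp: d algebra_simps)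
  have dN: "((\<lambda>\<theta>. (b - 1) * sin (\<theta> / 2) * cos (\<theta> / 2)) has_real_derivative (b - 1) * (C\<^sup>2 - S\<^sup>2) / 2) (at \<theta>)"
    by (auto intro!: derivative_eq_intros simp: d algebra_simps power2_eq_square)
  define w w' where "w = (b - 1) * S * C / D" "w' = ((b - 1) * (C\<^sup>2 - S\<^sup>2) / 2 * D - (b - 1) * S * C * ((b - 1) * S * C)) / (D * D)"
  note wd = this
  have dw: "((\<lambda>\<theta>. (b - 1) * sin (\<theta> / 2) * cos (\<theta> / 2) / half_den b \<theta>) has_real_derivative w') (at \<theta>)"
    using DERIV_divide[OF dN dD] D0 unfolding wd d by simp
  have "(dil_smooth b has_real_derivative 1 + 2 * (inverse (1 + w\<^sup>2) * w')) (at \<theta>)"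
    unfolding dil_smooth_def[abs_def] wd(1) d
    by (rule DERIV_add[OF DERIV_ident DERIV_cmult[OF DERIV_chain2[OF DERIV_arctan dw]]])
  moreover have "1 + 2 * (inverse (1 + w\<^sup>2) * w') = b / V"
  proof -
    \<comment> \<open>Lagrange's identity (C^2 + b S^2)^2 + (b S C - S C)^2 = (C^2 + S^2)(C^2 + b^2
      S^2): it turns the denominator of the arctangent derivative into \<open>V\<close>.\<close>
    have V': "D * D + ((b - 1) * S * C) * ((b - 1) * S * C) = V"
    proof -
      have "D * D + ((b - 1) * S * C) * ((b - 1) * S * C) = (C * C + S * S) * V"
        unfolding DD VV by (simp add: algebra_simps power2_eq_square)
      then show ?thesis unfolding sc by simp
    qed
    have "1 + w\<^sup>2 = (D * D + ((b - 1) * S * C) * ((b - 1) * S * C)) / (D * D)"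
      using D0 by (simp add: wd(1) power2_eq_square add_divide_distrib)
    then have 1: "1 + w\<^sup>2 = V / (D * D)" unfolding V' .
    have 2: "w' = (b - 1) * (C\<^sup>2 - b * S\<^sup>2) / 2 / (D * D)"
    proof -
      have "(b - 1) * (C\<^sup>2 - S\<^sup>2) / 2 * D - (b - 1) * S * C * ((b - 1) * S * C)
        = (b - 1) * ((C * C + S * S) * (C\<^sup>2 - b * S\<^sup>2)) / 2"
        unfolding DD by (simp add: field_simps power2_eq_square)
      also have "\<dots> = (b - 1) * (C\<^sup>2 - b * S\<^sup>2) / 2" by (simp add: sc)
      finally show ?thesis unfolding wd(2) by (simp only:)
    qed
    have "1 + 2 * (inverse (1 + w\<^sup>2) * w') = (V + (b - 1) * (C\<^sup>2 - b * S\<^sup>2)) / V"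
      unfolding 1 2 using D0 V0 by (simp add: field_simps)
    also have "V + (b - 1) * (C\<^sup>2 - b * S\<^sup>2) = b * (C * C + S * S)"
      unfolding VV by (simp add: algebra_simps power2_eq_square)
    finally show ?thesis unfolding sc by simp
  qed
  ultimately show ?thesis unfolding d by simp
qed

text \<open>By \<open>DERIV_dil_smooth\<close> the squared quantity is the derivative of the polar
  angle under dilation by 1/a.\<close>

lemma kappa_half_den:
  assumes "a > 0"
  shows "kappa a \<theta> = ((1 / a) / half_den ((1 / a)\<^sup>2) \<theta>)\<^sup>2"
proof -
  have "(a\<^sup>2 - 1) * cos \<theta> + (a\<^sup>2 + 1) = a\<^sup>2 * (1 + cos \<theta>) + (1 - cos \<theta>)" by (simp add: algebra_simps)
  also have "\<dots> = 2 * a\<^sup>2 * half_den ((1 / a)\<^sup>2) \<theta>"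
    unfolding half_angle(3,4)[of \<theta>] half_den_def using assms by (simp add: field_simps)
  finally have e: "(a\<^sup>2 - 1) * cos \<theta> + (a\<^sup>2 + 1) = 2 * a\<^sup>2 * half_den ((1 / a)\<^sup>2) \<theta>" .
  show ?thesis unfolding kappa_def e using assms half_den_pos[of "(1/a)\<^sup>2" \<theta>]
    by (simp add: power_mult_distrib power_divide) (simp add: power2_eq_square power4_eq_xxxx)
qed

section \<open>Dilations as changes of variables on the sphere\<close>

definition dil_map :: "real \<Rightarrow> real \<times> real \<Rightarrow> real \<times> real" where
  "dil_map b \<omega> = (theta_dil b (fst \<omega>), snd \<omega>)"

lemma theta_dil_borel [measurable]: "theta_dil b \<in> borel_measurable borel"
  unfolding theta_dil_def[abs_def] tan_def by measurable

lemma dil_map_measurable [measurable]: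
  assumes "b > 0"
  shows "dil_map b \<in> measurable sphere_measure sphere_measure"
proof -
  have "dil_map b \<in> measurable (restrict_space borel ({0..pi} \<times> {0..<2*pi})) (restrict_space borel ({0..pi} \<times> {0..<2*pi}))"
  proof (rule measurable_restrict_space3)
    show "dil_map b \<in> borel_measurable borel"
      unfolding dil_map_def[abs_def] borel_prod[symmetric] by measurable
    show "dil_map b \<in> {0..pi} \<times> {0..<2*pi} \<rightarrow> {0..pi} \<times> {0..<2*pi}"
      using theta_dil_range[OF assms] by (auto simp: dil_map_def)
  qed
  then show ?thesis using measurable_cong_sets[OF sets_sphere_measure sets_sphere_measure] by blast
qed

lemma kappa_nonneg: "0 \<le> kappa a \<theta>"
  by (simp add: kappa_def)

lemma kappa_borel [measurable]: "kappa a \<in> borel_measurable borel"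
  unfolding kappa_def[abs_def] by measurable

text \<open>\<open>kappa a\<close> is the Jacobian of the dilation by 1/a for sin \<theta>
  d\<theta>: of its two equal factors, one comes from the sine of the dilated angle and one from the
  derivative of that angle.\<close>

lemma nn_integral_dilation:
  fixes F :: "real \<times> real \<Rightarrow> ennreal"
  assumes a: "a > 0" and F [measurable]: "F \<in> borel_measurable sphere_measure"
  shows "(\<integral>\<^sup>+\<omega>. ennreal (kappa a (fst \<omega>)) * F (dil_map (1 / a) \<omega>) \<partial>sphere_measure) = (\<integral>\<^sup>+\<omega>. F \<omega> \<partial>sphere_measure)"
proof -
  define b where "b = 1 / a"
  have b: "b > 0" using a by (simp add: b_def)
  note [measurable] = dil_map_measurable[OF b]
  let ?I = "indicator ({0..pi} \<times> {0..<2*pi}) :: real \<times> real \<Rightarrow> ennreal"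
  have m: "(\<lambda>\<omega>. ennreal (kappa a (fst \<omega>)) * F (dil_map b \<omega>)) \<in> borel_measurable sphere_measure"
    by measurable
  have "(\<integral>\<^sup>+\<theta>. ennreal (kappa a \<theta>) * F (theta_dil b \<theta>, \<phi>) * ennreal (sin \<theta>) * ?I (\<theta>, \<phi>) \<partial>lborel)
     = (\<integral>\<^sup>+\<theta>. F (\<theta>, \<phi>) * ennreal (sin \<theta>) * ?I (\<theta>, \<phi>) \<partial>lborel)" for \<phi>
  proof -
    define f where "f = (\<lambda>\<theta>. F (\<theta>, \<phi>) * ennreal (sin \<theta>) * ?I (\<theta>, \<phi>))"
    have fm: "f \<in> borel_measurable borel"
      unfolding f_def
      using measurable_compose[OF _ measurable_sphere_ext[OF F], of "\<lambda>\<theta>. (\<theta>, \<phi>)" borel] 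
      by (simp add: borel_prod[symmetric])
    have g0: "dil_smooth b 0 = 0" "dil_smooth b pi = pi" by (simp_all add: dil_smooth_def)
    have "(\<integral>\<^sup>+\<theta>. f \<theta> \<partial>lborel) = (\<integral>\<^sup>+\<theta>. f \<theta> * indicator {dil_smooth b 0..dil_smooth b pi} \<theta> \<partial>lborel)"
      unfolding g0 by (rule nn_integral_cong) (auto simp: f_def indicator_def)
    also have "\<dots> = (\<integral>\<^sup>+\<theta>. f (dil_smooth b \<theta>) * ennreal (b / half_den (b\<^sup>2) \<theta>) * indicator {0..pi} \<theta> \<partial>lborel)"
    proof (rule nn_integral_substitution_aux[OF fm])
      show "continuous_on {0..pi} (\<lambda>\<theta>. b / half_den (b\<^sup>2) \<theta>)"
        unfolding half_den_def
        by (intro continuous_intros) (use half_den_pos[of "b\<^sup>2"] b in \<open>auto simp: half_den_def less_le\<close>)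
      show "b / half_den (b\<^sup>2) \<theta> \<ge> 0" for \<theta> using b half_den_pos[of "b\<^sup>2" \<theta>] by simp
    qed (use DERIV_dil_smooth[OF b] in auto)
    also have "\<dots> = (\<integral>\<^sup>+\<theta>. ennreal (kappa a \<theta>) * F (theta_dil b \<theta>, \<phi>) * ennreal (sin \<theta>) * ?I (\<theta>, \<phi>) \<partial>lborel)"
    proof (rule nn_integral_cong)
      fix \<theta> :: real
      show "f (dil_smooth b \<theta>) * ennreal (b / half_den (b\<^sup>2) \<theta>) * indicator {0..pi} \<theta> =
         ennreal (kappa a \<theta>) * F (theta_dil b \<theta>, \<phi>) * ennreal (sin \<theta>) * ?I (\<theta>, \<phi>)"
      proof (cases "\<theta> \<in> {0..pi}")
        case True
        then have \<theta>: "0 \<le> \<theta>" "\<theta> \<le> pi" by auto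
        have V: "half_den (b\<^sup>2) \<theta> > 0" using half_den_pos[of "b\<^sup>2" \<theta>] b by simp
        have "ennreal (sin (theta_dil b \<theta>)) * ennreal (b / half_den (b\<^sup>2) \<theta>)
           = ennreal (sin (theta_dil b \<theta>) * (b / half_den (b\<^sup>2) \<theta>))"
          using theta_dil_range[OF b \<theta>] b V by (intro ennreal_mult[symmetric]) (auto intro!: sin_ge_zero)
        also have "sin (theta_dil b \<theta>) * (b / half_den (b\<^sup>2) \<theta>) = kappa a \<theta> * sin \<theta>"
          unfolding sin_theta_dil[OF b \<theta>] kappa_half_den[OF a] b_def[symmetric]
          by (simp add: power2_eq_square)
        also have "ennreal (kappa a \<theta> * sin \<theta>) = ennreal (kappa a \<theta>) * ennreal (sin \<theta>)"
          using \<theta> by (intro ennreal_mult) (auto intro!: sin_ge_zero simp: kappa_half_den[OF a])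
        finally have e: "ennreal (sin (theta_dil b \<theta>)) * ennreal (b / half_den (b\<^sup>2) \<theta>) = ennreal (kappa a \<theta>) * ennreal (sin \<theta>)" .
        have i: "?I (theta_dil b \<theta>, \<phi>) = ?I (\<theta>, \<phi>)"
          using theta_dil_range[OF b \<theta>] \<theta> by (auto simp: indicator_def)
        have "f (dil_smooth b \<theta>) * ennreal (b / half_den (b\<^sup>2) \<theta>) * indicator {0..pi} \<theta> =
          F (theta_dil b \<theta>, \<phi>) * ?I (\<theta>, \<phi>) * (ennreal (sin (theta_dil b \<theta>)) * ennreal (b / half_den (b\<^sup>2) \<theta>))"
          unfolding theta_dil_eq_smooth[OF b \<theta>, symmetric] f_def i using True by (simp add: mult_ac)
        also have "\<dots> = ennreal (kappa a \<theta>) * F (theta_dil b \<theta>, \<phi>) * ennreal (sin \<theta>) * ?I (\<theta>, \<phi>)"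
          unfolding e by (simp add: mult_ac)
        finally show ?thesis .
      qed auto
    qed
    finally show ?thesis unfolding f_def by simp
  qed
  then show ?thesis
    unfolding nn_integral_sphere[OF F] b_def[symmetric] nn_integral_sphere[OF m]
    by (simp add: dil_map_def)
qed

text \<open>The substitution rule for indicators, read as an equality of measures; complex integrals
  then transform without a separate integrability argument.\<close>

lemma distr_dilation:
  assumes a: "a > 0"
  shows "distr (density sphere_measure (\<lambda>\<omega>. ennreal (kappa a (fst \<omega>)))) sphere_measure (dil_map (1 / a)) = sphere_measure"
proof (rule measure_eqI)
  have [measurable]: "dil_map (1 / a) \<in> measurable sphere_measure sphere_measure"
    using a by (intro dil_map_measurable) simp
  fix A assume "A \<in> sets (distr (density sphere_measure (\<lambda>\<omega>. ennreal (kappa a (fst \<omega>)))) sphere_measure (dil_map (1 / a)))"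
  then have [measurable]: "A \<in> sets sphere_measure" by simp
  have "emeasure (distr (density sphere_measure (\<lambda>\<omega>. ennreal (kappa a (fst \<omega>)))) sphere_measure (dil_map (1 / a))) A
    = (\<integral>\<^sup>+\<omega>. ennreal (kappa a (fst \<omega>)) * indicator (dil_map (1 / a) -` A \<inter> space sphere_measure) \<omega> \<partial>sphere_measure)"
    by (subst emeasure_distr) (auto simp: emeasure_density)
  also have "\<dots> = (\<integral>\<^sup>+\<omega>. ennreal (kappa a (fst \<omega>)) * indicator A (dil_map (1 / a) \<omega>) \<partial>sphere_measure)"
    by (intro nn_integral_cong) (auto simp: indicator_def)
  also have "\<dots> = emeasure sphere_measure A"
    by (subst nn_integral_dilation[OF a]) auto
  finally show "emeasure (distr (density sphere_measure (\<lambda>\<omega>. ennreal (kappa a (fst \<omega>)))) sphere_measure (dil_map (1 / a))) A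
    = emeasure sphere_measure A" .
qed simp

lemma integral_dilation:
  fixes F :: "real \<times> real \<Rightarrow> complex"
  assumes a: "a > 0" and F [measurable]: "F \<in> borel_measurable sphere_measure"
  shows "(\<integral>\<omega>. complex_of_real (kappa a (fst \<omega>)) * F (dil_map (1 / a) \<omega>) \<partial>sphere_measure) = (\<integral>\<omega>. F \<omega> \<partial>sphere_measure)"
proof -
  have [measurable]: "dil_map (1 / a) \<in> measurable sphere_measure sphere_measure"
    using a by (intro dil_map_measurable) simp
  have "(\<integral>\<omega>. F \<omega> \<partial>sphere_measure) = (\<integral>\<omega>. F \<omega> \<partial>(distr (density sphere_measure (\<lambda>\<omega>. ennreal (kappa a (fst \<omega>)))) sphere_measure (dil_map (1 / a))))"
    by (simp only: distr_dilation[OF a])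
  also have "\<dots> = (\<integral>\<omega>. F (dil_map (1 / a) \<omega>) \<partial>(density sphere_measure (\<lambda>\<omega>. ennreal (kappa a (fst \<omega>)))))"
    by (subst integral_distr) auto
  also have "\<dots> = (\<integral>\<omega>. kappa a (fst \<omega>) *\<^sub>R F (dil_map (1 / a) \<omega>) \<partial>sphere_measure)"
    by (subst integral_density) (auto simp: kappa_nonneg)
  finally show ?thesis by (simp add: scaleR_conv_of_real)
qed

section \<open>Orthogonality of the spherical harmonics\<close>

lemma measurable_cnj [measurable]: "cnj \<in> borel_measurable borel"
  by (intro borel_measurable_continuous_onI continuous_intros)

lemma integrable_mult_cnj:
  fixes f g :: "'a \<Rightarrow> complex"
  assumes [measurable]: "f \<in> borel_measurable M" "g \<in> borel_measurable M"
    and f: "integrable M (\<lambda>x. (cmod (f x))\<^sup>2)" and g: "integrable M (\<lambda>x. (cmod (g x))\<^sup>2)"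
  shows "integrable M (\<lambda>x. f x * cnj (g x))"
proof (rule Bochner_Integration.integrable_bound[OF Bochner_Integration.integrable_add[OF f g]])
  show "AE x in M. cmod (f x * cnj (g x)) \<le> norm ((cmod (f x))\<^sup>2 + (cmod (g x))\<^sup>2)"
  proof (rule AE_I2)
    fix x
    have "2 * cmod (f x) * cmod (g x) \<le> (cmod (f x))\<^sup>2 + (cmod (g x))\<^sup>2" by (rule sum_squares_bound)
    moreover have "0 \<le> cmod (f x) * cmod (g x)" by simp
    ultimately have "cmod (f x) * cmod (g x) \<le> (cmod (f x))\<^sup>2 + (cmod (g x))\<^sup>2" by linarith
    then show "cmod (f x * cnj (g x)) \<le> norm ((cmod (f x))\<^sup>2 + (cmod (g x))\<^sup>2)"
      by (simp add: norm_mult)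
  qed
qed measurable

lemma cmod_square_complex: "complex_of_real ((cmod z)\<^sup>2) = z * cnj z"
  by (metis complex_norm_square)

lemma integral_orthogonal_sum:
  fixes h :: "'i \<Rightarrow> 'a \<Rightarrow> complex"
  assumes "finite I" and [measurable]: "\<And>i. i \<in> I \<Longrightarrow> h i \<in> borel_measurable M"
    and h: "\<And>i. i \<in> I \<Longrightarrow> integrable M (\<lambda>x. (cmod (h i x))\<^sup>2)"
    and orth: "\<And>i j. i \<in> I \<Longrightarrow> j \<in> I \<Longrightarrow> i \<noteq> j \<Longrightarrow> (\<integral>x. h i x * cnj (h j x) \<partial>M) = 0"
  shows "integrable M (\<lambda>x. (cmod (\<Sum>i\<in>I. c i * h i x))\<^sup>2)"
    "(\<integral>x. (cmod (\<Sum>i\<in>I. c i * h i x))\<^sup>2 \<partial>M) = (\<Sum>i\<in>I. (cmod (c i))\<^sup>2 * (\<integral>x. (cmod (h i x))\<^sup>2 \<partial>M))"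
proof -
  have int: "integrable M (\<lambda>x. h i x * cnj (h j x))" if "i \<in> I" "j \<in> I" for i j
    using that by (intro integrable_mult_cnj assms)
  have e: "complex_of_real ((cmod (\<Sum>i\<in>I. c i * h i x))\<^sup>2) = (\<Sum>i\<in>I. \<Sum>j\<in>I. c i * cnj (c j) * (h i x * cnj (h j x)))" for x
    unfolding cmod_square_complex cnj_sum sum_product by (simp add: mult_ac)
  have i: "integrable M (\<lambda>x. \<Sum>i\<in>I. \<Sum>j\<in>I. c i * cnj (c j) * (h i x * cnj (h j x)))"
    by (intro Bochner_Integration.integrable_sum integrable_mult_right int)
  then have "integrable M (\<lambda>x. complex_of_real ((cmod (\<Sum>i\<in>I. c i * h i x))\<^sup>2))" by (simp only: e)
  then show "integrable M (\<lambda>x. (cmod (\<Sum>i\<in>I. c i * h i x))\<^sup>2)"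
    by (simp only: complex_of_real_integrable_eq)
  have "complex_of_real (\<integral>x. (cmod (\<Sum>i\<in>I. c i * h i x))\<^sup>2 \<partial>M) = (\<integral>x. complex_of_real ((cmod (\<Sum>i\<in>I. c i * h i x))\<^sup>2) \<partial>M)"
    by (simp only: integral_complex_of_real)
  also have "\<dots> = (\<Sum>i\<in>I. \<Sum>j\<in>I. c i * cnj (c j) * (\<integral>x. h i x * cnj (h j x) \<partial>M))"
    unfolding e using int by (simp add: Bochner_Integration.integral_sum Bochner_Integration.integrable_sum)
  also have "\<dots> = (\<Sum>i\<in>I. c i * cnj (c i) * (\<integral>x. h i x * cnj (h i x) \<partial>M))"
  proof (rule sum.cong[OF refl])
    fix i assume i: "i \<in> I"
    have "(\<Sum>j\<in>I. c i * cnj (c j) * (\<integral>x. h i x * cnj (h j x) \<partial>M)) =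
      (\<Sum>j\<in>I. if j = i then c i * cnj (c i) * (\<integral>x. h i x * cnj (h i x) \<partial>M) else 0)"
      using orth i by (intro sum.cong) auto
    then show "(\<Sum>j\<in>I. c i * cnj (c j) * (\<integral>x. h i x * cnj (h j x) \<partial>M)) = c i * cnj (c i) * (\<integral>x. h i x * cnj (h i x) \<partial>M)"
      using i assms(1) by simp
  qed
  also have "\<dots> = complex_of_real (\<Sum>i\<in>I. (cmod (c i))\<^sup>2 * (\<integral>x. (cmod (h i x))\<^sup>2 \<partial>M))"
    unfolding of_real_sum of_real_mult cmod_square_complex[symmetric] by (simp only: integral_complex_of_real)
  finally show "(\<integral>x. (cmod (\<Sum>i\<in>I. c i * h i x))\<^sup>2 \<partial>M) = (\<Sum>i\<in>I. (cmod (c i))\<^sup>2 * (\<integral>x. (cmod (h i x))\<^sup>2 \<partial>M))"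
    by (simp only: of_real_eq_iff)
qed

text \<open>Bessel for orthogonal h_i whose squared norms are merely at most K, as happens after
  weighting. For v = \<Sum> c_i h_i the product of g with v is S = \<Sum> |c_i|^2 and
  \<parallel>v\<parallel>^2 \<le> K S, so Young's inequality yields 2 S \<le> K
  \<parallel>g\<parallel>^2 + S.\<close>

lemma bessel_inequality:
  fixes g :: "'a \<Rightarrow> complex" and h :: "'i \<Rightarrow> 'a \<Rightarrow> complex"
  assumes fin: "finite I" and hm [measurable]: "\<And>i. i \<in> I \<Longrightarrow> h i \<in> borel_measurable M"
    and h: "\<And>i. i \<in> I \<Longrightarrow> integrable M (\<lambda>x. (cmod (h i x))\<^sup>2)"
    and orth: "\<And>i j. i \<in> I \<Longrightarrow> j \<in> I \<Longrightarrow> i \<noteq> j \<Longrightarrow> (\<integral>x. h i x * cnj (h j x) \<partial>M) = 0"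
    and g [measurable]: "g \<in> borel_measurable M" "integrable M (\<lambda>x. (cmod (g x))\<^sup>2)"
    and K: "K > 0" "\<And>i. i \<in> I \<Longrightarrow> (\<integral>x. (cmod (h i x))\<^sup>2 \<partial>M) \<le> K"
  shows "(\<Sum>i\<in>I. (cmod (\<integral>x. g x * cnj (h i x) \<partial>M))\<^sup>2) \<le> K * (\<integral>x. (cmod (g x))\<^sup>2 \<partial>M)"
proof -
  define c where "c = (\<lambda>i. \<integral>x. g x * cnj (h i x) \<partial>M)"
  define S where "S = (\<Sum>i\<in>I. (cmod (c i))\<^sup>2)"
  define v where "v = (\<lambda>x. \<Sum>i\<in>I. c i * h i x)"
  have vm [measurable]: "v \<in> borel_measurable M" unfolding v_def by measurable
  have vi: "integrable M (\<lambda>x. (cmod (v x))\<^sup>2)"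
    "(\<integral>x. (cmod (v x))\<^sup>2 \<partial>M) = (\<Sum>i\<in>I. (cmod (c i))\<^sup>2 * (\<integral>x. (cmod (h i x))\<^sup>2 \<partial>M))"
    unfolding v_def by (rule integral_orthogonal_sum[OF fin hm h orth]; assumption)+
  have gv: "integrable M (\<lambda>x. g x * cnj (v x))" by (intro integrable_mult_cnj g vi vm)
  have "(\<integral>x. g x * cnj (v x) \<partial>M) = (\<Sum>i\<in>I. cnj (c i) * c i)"
  proof -
    have "(\<integral>x. g x * cnj (v x) \<partial>M) = (\<integral>x. (\<Sum>i\<in>I. cnj (c i) * (g x * cnj (h i x))) \<partial>M)"
      unfolding v_def cnj_sum sum_distrib_left by (simp add: mult_ac)
    also have "\<dots> = (\<Sum>i\<in>I. cnj (c i) * c i)"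
      unfolding c_def
      by (subst Bochner_Integration.integral_sum) (auto intro!: integrable_mult_cnj g h hm integrable_mult_right)
    finally show ?thesis .
  qed
  also have "\<dots> = complex_of_real S"
    unfolding S_def of_real_sum cmod_square_complex by (simp add: mult.commute)
  finally have gvS: "(\<integral>x. g x * cnj (v x) \<partial>M) = complex_of_real S" .
  have vS: "(\<integral>x. (cmod (v x))\<^sup>2 \<partial>M) \<le> K * S"
    unfolding vi S_def sum_distrib_left by (intro sum_mono) (metis K(2) mult.commute mult_left_mono zero_le_power2)
  have pt: "2 * Re (g x * cnj (v x)) \<le> K * (cmod (g x))\<^sup>2 + (cmod (v x))\<^sup>2 / K" for x
  proof -
    have "2 * Re (g x * cnj (v x)) \<le> 2 * (cmod (g x) * cmod (v x))"
      using complex_Re_le_cmod[of "g x * cnj (v x)"] by (simp add: norm_mult)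
    also have "\<dots> = 2 * (sqrt K * cmod (g x)) * (cmod (v x) / sqrt K)" using K by simp
    also have "\<dots> \<le> (sqrt K * cmod (g x))\<^sup>2 + (cmod (v x) / sqrt K)\<^sup>2" by (rule sum_squares_bound)
    also have "\<dots> = K * (cmod (g x))\<^sup>2 + (cmod (v x))\<^sup>2 / K" using K by (simp add: power_mult_distrib power_divide)
    finally show ?thesis .
  qed
  have "2 * S = (\<integral>x. 2 * Re (g x * cnj (v x)) \<partial>M)"
    using gvS gv by (simp add: integral_Re del: times_complex.sel)
  also have "\<dots> \<le> (\<integral>x. K * (cmod (g x))\<^sup>2 + (cmod (v x))\<^sup>2 / K \<partial>M)"
    by (intro integral_mono pt Bochner_Integration.integrable_add integrable_mult_right g vi(1) integrable_Re gv integrable_divide)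
  also have "\<dots> = K * (\<integral>x. (cmod (g x))\<^sup>2 \<partial>M) + (\<integral>x. (cmod (v x))\<^sup>2 \<partial>M) / K"
    using g vi(1) by simp
  also have "\<dots> \<le> K * (\<integral>x. (cmod (g x))\<^sup>2 \<partial>M) + S"
    using vS K by (simp add: field_simps)
  finally show ?thesis unfolding S_def c_def by simp
qed

section \<open>Orthogonality in the azimuth\<close>

lemma integral_sphere:
  fixes F :: "real \<times> real \<Rightarrow> complex"
  assumes [measurable]: "F \<in> borel_measurable sphere_measure"
  shows "(\<integral>\<omega>. F \<omega> \<partial>sphere_measure) =
    (\<integral>\<omega>. indicator ({0..pi} \<times> {0..<2*pi}) \<omega> *\<^sub>R (sin (fst \<omega>) *\<^sub>R F \<omega>) \<partial>lborel)"
    "integrable sphere_measure F \<longleftrightarrow>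
     integrable lborel (\<lambda>\<omega>. indicator ({0..pi} \<times> {0..<2*pi}) \<omega> *\<^sub>R (sin (fst \<omega>) *\<^sub>R F \<omega>))"
proof -
  let ?R = "restrict_space lborel ({0..pi} \<times> {0..<2*pi}) :: (real \<times> real) measure"
  have F: "F \<in> borel_measurable ?R"
    using assms by (simp add: sphere_measure_def)
  have s: "(\<lambda>\<omega>. sin (fst \<omega>)) \<in> borel_measurable ?R" by (auto intro!: measurable_restrict_space1)
  have s0: "AE \<omega> in ?R. 0 \<le> sin (fst \<omega>)"
    by (rule AE_I2) (auto simp: space_restrict_space intro!: sin_ge_zero)
  have S: "({0..pi} \<times> {0..<2*pi}) \<inter> space lborel \<in> sets (lborel :: (real \<times> real) measure)"
    using sphere_rect_measurable by simp
  show "(\<integral>\<omega>. F \<omega> \<partial>sphere_measure) =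
    (\<integral>\<omega>. indicator ({0..pi} \<times> {0..<2*pi}) \<omega> *\<^sub>R (sin (fst \<omega>) *\<^sub>R F \<omega>) \<partial>lborel)"
    unfolding sphere_measure_def integral_density[OF F s s0] integral_restrict_space[OF S] ..
  show "integrable sphere_measure F \<longleftrightarrow>
     integrable lborel (\<lambda>\<omega>. indicator ({0..pi} \<times> {0..<2*pi}) \<omega> *\<^sub>R (sin (fst \<omega>) *\<^sub>R F \<omega>))"
    unfolding sphere_measure_def integrable_density[OF F s s0] integrable_restrict_space[OF S] ..
qed

lemma integral_exp_period:
  assumes "k \<noteq> (0::int)"
  shows "(\<integral>\<phi>. indicator {0..<2*pi} \<phi> *\<^sub>R exp (\<i> * of_int k * of_real \<phi>) \<partial>lborel) = (0::complex)"
proof -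
  have "has_bochner_integral lborel (\<lambda>\<phi>. indicator {0..2*pi} \<phi> *\<^sub>R exp (\<i> * of_int k * of_real \<phi>))
     (exp (\<i> * of_int k * of_real (2*pi)) / (\<i> * of_int k) - exp (\<i> * of_int k * of_real 0) / (\<i> * of_int k))"
  proof (rule has_bochner_integral_FTC_Icc)
    fix x :: real
    have "((\<lambda>z. exp (\<i> * of_int k * z) / (\<i> * of_int k)) has_field_derivative exp (\<i> * of_int k * of_real x)) (at (of_real x))"
      using assms by (auto intro!: derivative_eq_intros)
    from has_vector_derivative_real_field[OF this]
    show "((\<lambda>\<phi>. exp (\<i> * of_int k * of_real \<phi>) / (\<i> * of_int k)) has_vector_derivative exp (\<i> * of_int k * of_real x)) (at x within {0..2*pi})" .
  qed (auto intro!: continuous_intros)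
  moreover have "exp (\<i> * of_int k * of_real (2*pi)) = (1::complex)"
    using exp_integer_2pi[of "of_int k"] by (simp add: mult_ac)
  ultimately have "(\<integral>\<phi>. indicator {0..2*pi} \<phi> *\<^sub>R exp (\<i> * of_int k * of_real \<phi>) \<partial>lborel) = (0::complex)"
    by (simp add: has_bochner_integral_integral_eq)
  moreover have "(\<integral>\<phi>. indicator {0..<2*pi} \<phi> *\<^sub>R exp (\<i> * of_int k * of_real \<phi>) \<partial>lborel)
    = (\<integral>\<phi>. indicator {0..2*pi} \<phi> *\<^sub>R exp (\<i> * of_int k * of_real \<phi>) \<partial>lborel)"
  proof (rule integral_cong_AE)
    show "AE \<phi> in lborel. indicator {0..<2*pi} \<phi> *\<^sub>R exp (\<i> * of_int k * of_real \<phi>) = (indicator {0..2*pi} \<phi> *\<^sub>R exp (\<i> * of_int k * of_real \<phi>) :: complex)"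
      using AE_lborel_singleton[of "2*pi"] by eventually_elim (auto simp: indicator_def)
  qed measurable
  ultimately show ?thesis by simp
qed

lemma integral_sphere_exp:
  fixes f :: "real \<Rightarrow> complex"
  assumes [measurable]: "f \<in> borel_measurable borel" and k: "k \<noteq> (0::int)"
  shows "(\<integral>\<omega>. f (fst \<omega>) * exp (\<i> * of_int k * of_real (snd \<omega>)) \<partial>sphere_measure) = 0"
proof (cases "integrable sphere_measure (\<lambda>\<omega>. f (fst \<omega>) * exp (\<i> * of_int k * of_real (snd \<omega>)))")
  case True
  let ?F = "\<lambda>\<omega>. f (fst \<omega>) * exp (\<i> * of_int k * of_real (snd \<omega>))"
  let ?G = "\<lambda>\<omega>. indicator ({0..pi} \<times> {0..<2*pi}) \<omega> *\<^sub>R (sin (fst \<omega>) *\<^sub>R ?F \<omega>)"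
  have m: "?F \<in> borel_measurable sphere_measure" by measurable
  have i: "integrable (lborel \<Otimes>\<^sub>M lborel) ?G"
    using True unfolding integral_sphere(2)[OF m] lborel_prod .
  have "(\<integral>\<omega>. ?F \<omega> \<partial>sphere_measure) = (\<integral>\<omega>. ?G \<omega> \<partial>(lborel \<Otimes>\<^sub>M lborel))"
    unfolding integral_sphere(1)[OF m] lborel_prod ..
  also have "\<dots> = (\<integral>\<phi>. (\<integral>\<theta>. ?G (\<theta>, \<phi>) \<partial>lborel) \<partial>lborel)"
    using lborel_pair.integral_snd[where f = "\<lambda>\<theta> \<phi>. ?G (\<theta>, \<phi>)"] i
    by (simp add: case_prod_unfold)
  also have "\<dots> = (\<integral>\<phi>. (indicator {0..<2*pi} \<phi> *\<^sub>R exp (\<i> * of_int k * of_real \<phi>))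
       * (\<integral>\<theta>. indicator {0..pi} \<theta> *\<^sub>R (sin \<theta> *\<^sub>R f \<theta>) \<partial>lborel) \<partial>lborel)"
  proof (rule Bochner_Integration.integral_cong[OF refl])
    fix \<phi> :: real
    have "(\<integral>\<theta>. ?G (\<theta>, \<phi>) \<partial>lborel) = (\<integral>\<theta>. (indicator {0..<2*pi} \<phi> *\<^sub>R exp (\<i> * of_int k * of_real \<phi>)) * (indicator {0..pi} \<theta> *\<^sub>R (sin \<theta> *\<^sub>R f \<theta>)) \<partial>lborel)"
      by (intro Bochner_Integration.integral_cong refl) (auto simp: indicator_def)
    then show "(\<integral>\<theta>. ?G (\<theta>, \<phi>) \<partial>lborel) = (indicator {0..<2*pi} \<phi> *\<^sub>R exp (\<i> * of_int k * of_real \<phi>))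
       * (\<integral>\<theta>. indicator {0..pi} \<theta> *\<^sub>R (sin \<theta> *\<^sub>R f \<theta>) \<partial>lborel)"
      by (simp only: integral_mult_right_zero)
  qed
  also have "\<dots> = 0"
    by (simp only: integral_mult_left_zero integral_exp_period[OF k] mult_zero_left)
  finally show ?thesis .
\<comment> \<open>A function that is not integrable has Bochner integral 0, so the claim holds in
  this case as well.\<close>
qed (rule not_integrable_integral_eq)

lemma nn_integral_sphere_radial:
  assumes [measurable]: "f \<in> borel_measurable borel"
  shows "(\<integral>\<^sup>+\<omega>. f (fst \<omega>) \<partial>sphere_measure) = ennreal (2 * pi) * (\<integral>\<^sup>+\<theta>. f \<theta> * ennreal (sin \<theta>) * indicator {0..pi} \<theta> \<partial>lborel)"
proof -
  have m: "(\<lambda>\<omega>. f (fst \<omega>)) \<in> borel_measurable sphere_measure" by measurable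
  have "(\<integral>\<^sup>+\<omega>. f (fst \<omega>) \<partial>sphere_measure) =
    (\<integral>\<^sup>+\<phi>. \<integral>\<^sup>+\<theta>. indicator {0..<2*pi} \<phi> * (f \<theta> * ennreal (sin \<theta>) * indicator {0..pi} \<theta>) \<partial>lborel \<partial>lborel)"
    unfolding nn_integral_sphere[OF m] by (intro nn_integral_cong) (auto simp: indicator_def)
  also have "\<dots> = (\<integral>\<^sup>+\<phi>. indicator {0..<2*pi} \<phi> * (\<integral>\<^sup>+\<theta>. f \<theta> * ennreal (sin \<theta>) * indicator {0..pi} \<theta> \<partial>lborel) \<partial>lborel)"
    by (subst nn_integral_cmult) auto
  also have "\<dots> = ennreal (2 * pi) * (\<integral>\<^sup>+\<theta>. f \<theta> * ennreal (sin \<theta>) * indicator {0..pi} \<theta> \<partial>lborel)"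
    by (subst nn_integral_multc) auto
  finally show ?thesis .
qed

text \<open>The density sin \<theta> is zero at both poles. Later identities can thus ignore them,
  where \<open>tan\<close>, \<open>powr\<close> and division take default values.\<close>

lemma AE_sphere_interior: "AE \<omega> in sphere_measure. 0 < fst \<omega> \<and> fst \<omega> < pi"
  unfolding sphere_measure_def
proof (subst AE_density)
  show "(\<lambda>\<omega>. ennreal (sin (fst \<omega>))) \<in> borel_measurable (restrict_space lborel ({0..pi} \<times> {0..<2*pi}))"
    by (auto intro!: measurable_restrict_space1)
  show "AE \<omega> in restrict_space lborel ({0..pi} \<times> {0..<2*pi}). 0 < ennreal (sin (fst \<omega>)) \<longrightarrow> 0 < fst \<omega> \<and> fst \<omega> < pi"
    by (rule AE_I2) (auto simp: space_restrict_space less_le)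
qed

definition sph_amp :: "nat \<Rightarrow> int \<Rightarrow> real \<Rightarrow> real" where
  "sph_amp l m \<theta> = sqrt ((2 * real l + 1) / (4 * pi) * (fact (nat (int l - m)) / fact (nat (int l + m)))) *
     assoc_legendre l m (cos \<theta>)"

lemma sph_harm_amp: "sph_harm l m \<omega> = complex_of_real (sph_amp l m (fst \<omega>)) * exp (\<i> * of_int m * of_real (snd \<omega>))"
  by (simp add: sph_harm_def sph_amp_def)

lemma cmod_sph_harm: "cmod (sph_harm l m \<omega>) = \<bar>sph_amp l m (fst \<omega>)\<bar>"
  by (simp add: sph_harm_amp norm_mult)

lemma sph_amp_borel [measurable]: "sph_amp l m \<in> borel_measurable borel"
proof -
  have [measurable]: "(\<lambda>x. poly p (cos x)) \<in> borel_measurable borel" for p :: "real poly"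
    by (intro borel_measurable_continuous_onI continuous_intros)
  show ?thesis unfolding sph_amp_def[abs_def] assoc_legendre_def by measurable
qed

lemma sph_harm_measurable [measurable]: "sph_harm l m \<in> borel_measurable sphere_measure"
  unfolding sph_harm_amp[abs_def] by measurable

text \<open>The squared normalisation of Y_l^n, including the 1/(2^l l!)^2 that
  \<open>polar_legendre\<close> omits.\<close>

definition amp_const :: "nat \<Rightarrow> nat \<Rightarrow> real" where
  "amp_const l n = (2 * real l + 1) / (4 * pi) * (fact (l - n) / fact (l + n)) / (2 ^ l * fact l)\<^sup>2"

lemma sin_square_powr:
  assumes "0 < \<theta>" "\<theta> < pi"
  shows "(1 - (cos \<theta>)\<^sup>2) powr (r / 2) = sin \<theta> powr r"
proof -
  have s: "sin \<theta> > 0" using sin_gt_zero[OF assms] .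
  have "1 - (cos \<theta>)\<^sup>2 = sin \<theta> powr 2" using s by (simp add: sin_squared_eq)
  then show ?thesis by (simp add: powr_powr)
qed

text \<open>Orders m and -m have the same modulus: for m < 0, \<open>rodrigues_reflect\<close> turns
  sin^(-n) into sin^n and inverts the quotient of factorials. The poles are excluded since 0 powr 0
  = 0 makes \<open>sph_amp\<close> vanish there for m = 0.\<close>

lemma sph_amp_square:
  assumes \<theta>: "0 < \<theta>" "\<theta> < pi" and m: "\<bar>m\<bar> \<le> int l"
  shows "(sph_amp l m \<theta>)\<^sup>2 = amp_const l (nat \<bar>m\<bar>) * (polar_legendre l (nat \<bar>m\<bar>) \<theta>)\<^sup>2"
proof -
  define n where "n = nat \<bar>m\<bar>"
  have nl: "n \<le> l" using m by (simp add: n_def)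
  have s: "sin \<theta> > 0" using sin_gt_zero[OF \<theta>] .
  let ?Q = "poly (rodrigues l (l + n)) (cos \<theta>)"
  show ?thesis
  proof (cases "m \<ge> 0")
    case True
    then have mn: "m = int n" by (simp add: n_def)
    have pw: "(1 - (cos \<theta>)\<^sup>2) powr (real_of_int m / 2) = sin \<theta> ^ n"
      unfolding sin_square_powr[OF \<theta>] mn using s by (simp add: powr_realpow)
    have n1: "nat (int l - m) = l - n" "nat (int l + m) = l + n" using nl by (auto simp: mn nat_diff_distrib)
    have "(sph_amp l m \<theta>)\<^sup>2 = (2 * real l + 1) / (4 * pi) * (fact (l - n) / fact (l + n)) *
       ((-1) ^ nat \<bar>m\<bar> / (2 ^ l * fact l) * sin \<theta> ^ n * ?Q)\<^sup>2"
      unfolding sph_amp_def assoc_legendre_def pw n1 rodrigues_def[symmetric] power_mult_distrib by simp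
    also have "\<dots> = amp_const l n * (polar_legendre l n \<theta>)\<^sup>2"
      by (simp add: amp_const_def polar_legendre_def power_mult_distrib power_divide flip: power_mult)
    finally show ?thesis unfolding n_def .
  next
    case False
    then have mn: "m = - int n" by (simp add: n_def)
    have pw: "(1 - (cos \<theta>)\<^sup>2) powr (real_of_int m / 2) = inverse (sin \<theta> ^ n)"
      unfolding sin_square_powr[OF \<theta>] mn using s by (simp add: powr_minus powr_realpow)
    have n1: "nat (int l - m) = l + n" "nat (int l + m) = l - n" using nl by (auto simp: mn nat_diff_distrib)
    have q: "poly (rodrigues l (l - n)) (cos \<theta>) = fact (l - n) / fact (l + n) * ((-1) ^ n * (sin \<theta> ^ n)\<^sup>2) * ?Q"
    proof -
      have "(cos \<theta>)\<^sup>2 - 1 = - (sin \<theta>)\<^sup>2" by (simp add: sin_squared_eq)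
      then have "((cos \<theta>)\<^sup>2 - 1) ^ n = (-1) ^ n * (sin \<theta> ^ n)\<^sup>2"
        by (simp add: power_minus[of "(sin \<theta>)\<^sup>2"] power_commutes flip: power_mult) (simp add: mult.commute)
      then show ?thesis unfolding rodrigues_reflect[OF nl] by (simp add: poly_power power2_eq_square algebra_simps)
    qed
    have "(sph_amp l m \<theta>)\<^sup>2 = (2 * real l + 1) / (4 * pi) * (fact (l + n) / fact (l - n)) *
       ((-1) ^ nat \<bar>m\<bar> / (2 ^ l * fact l) * inverse (sin \<theta> ^ n) * (fact (l - n) / fact (l + n) * ((-1) ^ n * (sin \<theta> ^ n)\<^sup>2) * ?Q))\<^sup>2"
      unfolding sph_amp_def assoc_legendre_def pw n1 rodrigues_def[symmetric] q power_mult_distrib by simp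
    also have "\<dots> = (2 * real l + 1) / (4 * pi) * (fact (l + n) / fact (l - n)) * (fact (l - n) / fact (l + n))\<^sup>2
        / (2 ^ l * fact l)\<^sup>2 * (sin \<theta> ^ n * ?Q)\<^sup>2"
    proof -
      have sq: "((-1) ^ k / D * inverse X * (r * ((-1) ^ n * X\<^sup>2) * Q))\<^sup>2 = r\<^sup>2 / D\<^sup>2 * (X * Q)\<^sup>2"
        if "X \<noteq> 0" for X r Q D :: real and k
      proof -
        have "(-1) ^ k / D * inverse X * (r * ((-1) ^ n * X\<^sup>2) * Q) = (-1) ^ k * (-1) ^ n * (r / D * (X * Q))"
          using that by (simp add: power2_eq_square)
        then show ?thesis by (simp only: power_mult_distrib power_divide) (simp flip: power_mult)
      qed
      have "sin \<theta> ^ n \<noteq> 0" using s by simp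
      then show ?thesis by (subst sq) simp_all
    qed
    also have "(2 * real l + 1) / (4 * pi) * (fact (l + n) / fact (l - n)) * (fact (l - n) / fact (l + n))\<^sup>2
        / (2 ^ l * fact l)\<^sup>2 = amp_const l n"
      by (simp add: amp_const_def power2_eq_square)
    finally show ?thesis unfolding n_def polar_legendre_def by simp
  qed
qed

section \<open>Weighted norms and coefficients\<close>

lemma amp_const_pos: "amp_const l n > 0"
  by (simp add: amp_const_def)

text \<open>The function v is a separate parameter so that g may blow up at the poles while the
  product sin y^2 g still extends continuously.\<close>

lemma nn_integral_sph_harm_weight:
  assumes m: "\<bar>m\<bar> \<le> int l" and g [measurable]: "g \<in> borel_measurable borel"
    and v: "continuous_on {0..pi} v" "\<And>\<theta>. 0 < \<theta> \<Longrightarrow> \<theta> < pi \<Longrightarrow> v \<theta> = sin \<theta> * (polar_legendre l (nat \<bar>m\<bar>) \<theta>)\<^sup>2 * g \<theta>"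
      "\<And>\<theta>. 0 \<le> \<theta> \<Longrightarrow> \<theta> \<le> pi \<Longrightarrow> 0 \<le> v \<theta>"
  shows "(\<integral>\<^sup>+\<omega>. ennreal ((cmod (sph_harm l m \<omega>))\<^sup>2 * g (fst \<omega>)) \<partial>sphere_measure)
     = ennreal (2 * pi * amp_const l (nat \<bar>m\<bar>) * integral {0..pi} v)"
proof -
  let ?c = "amp_const l (nat \<bar>m\<bar>)"
  have "(\<integral>\<^sup>+\<omega>. ennreal ((cmod (sph_harm l m \<omega>))\<^sup>2 * g (fst \<omega>)) \<partial>sphere_measure)
    = (\<integral>\<^sup>+\<omega>. ennreal ((sph_amp l m (fst \<omega>))\<^sup>2 * g (fst \<omega>)) \<partial>sphere_measure)"
    by (simp add: cmod_sph_harm)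
  also have "\<dots> = ennreal (2 * pi) * (\<integral>\<^sup>+\<theta>. ennreal ((sph_amp l m \<theta>)\<^sup>2 * g \<theta>) * ennreal (sin \<theta>) * indicator {0..pi} \<theta> \<partial>lborel)"
    by (rule nn_integral_sphere_radial) measurable
  also have "(\<integral>\<^sup>+\<theta>. ennreal ((sph_amp l m \<theta>)\<^sup>2 * g \<theta>) * ennreal (sin \<theta>) * indicator {0..pi} \<theta> \<partial>lborel)
     = (\<integral>\<^sup>+\<theta>. ennreal (?c * v \<theta>) * indicator {0..pi} \<theta> \<partial>lborel)"
  proof (rule nn_integral_cong_AE)
    show "AE \<theta> in lborel. ennreal ((sph_amp l m \<theta>)\<^sup>2 * g \<theta>) * ennreal (sin \<theta>) * indicator {0..pi} \<theta> = ennreal (?c * v \<theta>) * indicator {0..pi} \<theta>"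
      using AE_lborel_singleton[of 0] AE_lborel_singleton[of pi]
    proof eventually_elim
      case (elim \<theta>)
      show ?case
      proof (cases "0 < \<theta> \<and> \<theta> < pi")
        case True
        then have "ennreal ((sph_amp l m \<theta>)\<^sup>2 * g \<theta>) * ennreal (sin \<theta>) = ennreal ((sph_amp l m \<theta>)\<^sup>2 * g \<theta> * sin \<theta>)"
          by (simp add: ennreal_mult'' sin_ge_zero)
        then show ?thesis using True by (simp add: sph_amp_square m v mult_ac)
      next
        case False
        then show ?thesis using elim by (auto simp: indicator_def)
      qed
    qed
  qed
  also have "\<dots> = ennreal (?c * integral {0..pi} v)"
    using v amp_const_pos[of l "nat \<bar>m\<bar>"]
    by (intro nn_integral_has_integral_lebesgue' has_integral_mult_right integrable_integral integrable_continuous_interval) auto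
  finally show ?thesis using amp_const_pos[of l "nat \<bar>m\<bar>"] v
    by (simp add: ennreal_mult' mult.assoc)
qed

lemma polar_legendre_normalized:
  assumes "n \<le> l"
  shows "2 * pi * amp_const l n * integral {0..pi} (\<lambda>\<theta>. sin \<theta> * (polar_legendre l n \<theta>)\<^sup>2) = 1"
proof -
  have I: "integral {0..pi} (\<lambda>\<theta>. sin \<theta> * (polar_legendre l n \<theta>)\<^sup>2) =
     fact (l + n) / fact (l - n) * (2 ^ (2 * l + 1) * (fact l)\<^sup>2 / (2 * real l + 1))"
    using has_integral_polar_legendre_square[OF assms] by (rule integral_unique)
  have l0: "2 * real l + 1 > 0" by simp
  have p: "(2::real) ^ (2 * l + 1) = 2 * (2 ^ l)\<^sup>2" by (simp flip: power_mult add: mult.commute)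
  show ?thesis unfolding I amp_const_def p using l0
    by (simp add: power_mult_distrib divide_simps)
qed

lemma nn_integral_sph_harm:
  assumes m: "\<bar>m\<bar> \<le> int l"
  shows "(\<integral>\<^sup>+\<omega>. ennreal ((cmod (sph_harm l m \<omega>))\<^sup>2) \<partial>sphere_measure) = 1"
proof -
  have "(\<integral>\<^sup>+\<omega>. ennreal ((cmod (sph_harm l m \<omega>))\<^sup>2 * (\<lambda>_. 1) (fst \<omega>)) \<partial>sphere_measure)
     = ennreal (2 * pi * amp_const l (nat \<bar>m\<bar>) * integral {0..pi} (\<lambda>\<theta>. sin \<theta> * (polar_legendre l (nat \<bar>m\<bar>) \<theta>)\<^sup>2))"
    by (rule nn_integral_sph_harm_weight[OF m]) (auto intro!: continuous_on_mult continuous_on_power continuous_on_sin continuous_on_id continuous_on_polar_legendre mult_nonneg_nonneg sin_ge_zero)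
  then show ?thesis using polar_legendre_normalized[of "nat \<bar>m\<bar>" l] m by simp
qed

text \<open>For a \<ge> 1 the weight is at least a^3 \<ge> a^2, and normalisation suffices. This
  alternative is what covers l = 0, where l(l+1) a^2 is 0.\<close>

lemma sph_harm_weight_scale:
  assumes m: "\<bar>m\<bar> \<le> int l" and a: "a > 0" and la: "real l * (real l + 1) * a\<^sup>2 \<ge> 2 \<or> a \<ge> 1"
  shows "(\<integral>\<^sup>+\<omega>. ennreal ((cmod (sph_harm l m \<omega>))\<^sup>2 / sqrt (a\<^sup>2 + (sin (fst \<omega>))\<^sup>2) ^ 3) \<partial>sphere_measure) \<le> ennreal (2 / a\<^sup>2)"
proof (cases "a \<ge> 1")
  case True
  have "(cmod (sph_harm l m \<omega>))\<^sup>2 / sqrt (a\<^sup>2 + (sin (fst \<omega>))\<^sup>2) ^ 3 \<le> 1 / a\<^sup>2 * (cmod (sph_harm l m \<omega>))\<^sup>2" for \<omega>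
  proof -
    have "a \<le> sqrt (a\<^sup>2 + (sin (fst \<omega>))\<^sup>2)" using a by (intro real_le_rsqrt) simp
    then have "a ^ 3 \<le> sqrt (a\<^sup>2 + (sin (fst \<omega>))\<^sup>2) ^ 3" using a by (intro power_mono) auto
    moreover have "a\<^sup>2 \<le> a ^ 3" using True by (intro power_increasing) auto
    ultimately have "a\<^sup>2 \<le> sqrt (a\<^sup>2 + (sin (fst \<omega>))\<^sup>2) ^ 3" by linarith
    then have "(cmod (sph_harm l m \<omega>))\<^sup>2 / sqrt (a\<^sup>2 + (sin (fst \<omega>))\<^sup>2) ^ 3 \<le> (cmod (sph_harm l m \<omega>))\<^sup>2 / a\<^sup>2"
      using a by (intro divide_left_mono) (auto intro!: mult_pos_pos intro: less_le_trans[of 0 "a\<^sup>2"])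
    then show ?thesis by simp
  qed
  then have "(\<integral>\<^sup>+\<omega>. ennreal ((cmod (sph_harm l m \<omega>))\<^sup>2 / sqrt (a\<^sup>2 + (sin (fst \<omega>))\<^sup>2) ^ 3) \<partial>sphere_measure)
    \<le> (\<integral>\<^sup>+\<omega>. ennreal (1 / a\<^sup>2) * ennreal ((cmod (sph_harm l m \<omega>))\<^sup>2) \<partial>sphere_measure)"
    by (intro nn_integral_mono) (metis (no_types, lifting) ennreal_leI ennreal_mult'' zero_le_power2)
  also have "\<dots> = ennreal (1 / a\<^sup>2)"
    by (subst nn_integral_cmult) (auto simp: nn_integral_sph_harm[OF m])
  also have "\<dots> \<le> ennreal (2 / a\<^sup>2)" by (intro ennreal_leI divide_right_mono) auto
  finally show ?thesis .
next
  case False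
  then have la': "real l * (real l + 1) * a\<^sup>2 \<ge> 2" using la by auto
  let ?n = "nat \<bar>m\<bar>"
  have p: "sqrt (a\<^sup>2 + (sin \<theta>)\<^sup>2) > 0" for \<theta> using a by (simp add: add_pos_nonneg)
  let ?v = "\<lambda>\<theta>. sin \<theta> * (polar_legendre l ?n \<theta>)\<^sup>2 / sqrt (a\<^sup>2 + (sin \<theta>)\<^sup>2) ^ 3"
  have c: "continuous_on {0..pi} ?v"
  proof (rule continuous_on_divide)
    show "continuous_on {0..pi} (\<lambda>\<theta>. sin \<theta> * (polar_legendre l ?n \<theta>)\<^sup>2)"
      by (intro continuous_on_mult continuous_on_power continuous_on_sin continuous_on_id continuous_on_polar_legendre)
    show "continuous_on {0..pi} (\<lambda>\<theta>. sqrt (a\<^sup>2 + (sin \<theta>)\<^sup>2) ^ 3)"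
      by (intro continuous_on_power continuous_on_real_sqrt continuous_on_add continuous_on_const continuous_on_sin continuous_on_id)
    show "\<forall>\<theta>\<in>{0..pi}. sqrt (a\<^sup>2 + (sin \<theta>)\<^sup>2) ^ 3 \<noteq> 0"
      using p by (metis less_irrefl power_not_zero)
  qed
  have "(\<integral>\<^sup>+\<omega>. ennreal ((cmod (sph_harm l m \<omega>))\<^sup>2 * (\<lambda>\<theta>. inverse (sqrt (a\<^sup>2 + (sin \<theta>)\<^sup>2) ^ 3)) (fst \<omega>)) \<partial>sphere_measure)
     = ennreal (2 * pi * amp_const l ?n * integral {0..pi} ?v)"
  proof (rule nn_integral_sph_harm_weight[OF m _ c])
    show "0 \<le> ?v \<theta>" if "0 \<le> \<theta>" "\<theta> \<le> pi" for \<theta>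
      using that p[of \<theta>] by (auto intro!: divide_nonneg_pos mult_nonneg_nonneg sin_ge_zero)
  qed (auto simp: divide_inverse)
  then have "(\<integral>\<^sup>+\<omega>. ennreal ((cmod (sph_harm l m \<omega>))\<^sup>2 / sqrt (a\<^sup>2 + (sin (fst \<omega>))\<^sup>2) ^ 3) \<partial>sphere_measure)
     = ennreal (2 * pi * amp_const l ?n * integral {0..pi} ?v)" by (simp only: divide_inverse)
  also have "\<dots> \<le> ennreal (2 * pi * amp_const l ?n * (2 / a\<^sup>2 * integral {0..pi} (\<lambda>\<theta>. sin \<theta> * (polar_legendre l ?n \<theta>)\<^sup>2)))"
    using amp_const_pos[of l ?n] by (intro ennreal_leI mult_left_mono polar_legendre_weighted_scale[OF a la']) auto
  also have "2 * pi * amp_const l ?n * (2 / a\<^sup>2 * integral {0..pi} (\<lambda>\<theta>. sin \<theta> * (polar_legendre l ?n \<theta>)\<^sup>2)) = 2 / a\<^sup>2"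
    using polar_legendre_normalized[of ?n l] m by (simp add: mult.assoc mult.left_commute)
  finally show ?thesis .
qed

text \<open>A nonzero order gives Y_l^m a factor sin \<theta>, just enough for |Y_l^m|^2 / sin^3 to
  be integrable at the poles.\<close>

lemma sph_harm_weight_singular:
  assumes m: "\<bar>m\<bar> \<le> int l" "m \<noteq> 0"
  shows "(\<integral>\<^sup>+\<omega>. ennreal ((cmod (sph_harm l m \<omega>))\<^sup>2 / sin (fst \<omega>) ^ 3) \<partial>sphere_measure) \<le> ennreal (4 / 3 * (real l * (real l + 1)))"
proof -
  let ?n = "nat \<bar>m\<bar>"
  let ?v = "\<lambda>\<theta>. (sin \<theta> ^ (?n - 1) * poly (rodrigues l (l + ?n)) (cos \<theta>))\<^sup>2"
  have n: "?n > 0" using m by simp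
  have "(\<integral>\<^sup>+\<omega>. ennreal ((cmod (sph_harm l m \<omega>))\<^sup>2 * (\<lambda>\<theta>. inverse (sin \<theta> ^ 3)) (fst \<omega>)) \<partial>sphere_measure)
     = ennreal (2 * pi * amp_const l ?n * integral {0..pi} ?v)"
  proof (rule nn_integral_sph_harm_weight[OF m(1)])
    show "continuous_on {0..pi} ?v" by (intro continuous_intros)
    fix \<theta> :: real assume "0 < \<theta>" "\<theta> < pi"
    then have "sin \<theta> > 0" by (rule sin_gt_zero)
    moreover obtain k where "?n = Suc k" using n gr0_implies_Suc by blast
    ultimately show "?v \<theta> = sin \<theta> * (polar_legendre l ?n \<theta>)\<^sup>2 * inverse (sin \<theta> ^ 3)"
      by (simp add: polar_legendre_def field_simps power2_eq_square power3_eq_cube)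
  qed auto
  then have "(\<integral>\<^sup>+\<omega>. ennreal ((cmod (sph_harm l m \<omega>))\<^sup>2 / sin (fst \<omega>) ^ 3) \<partial>sphere_measure)
     = ennreal (2 * pi * amp_const l ?n * integral {0..pi} ?v)" by (simp only: divide_inverse)
  also have "\<dots> \<le> ennreal (2 * pi * amp_const l ?n * (4 / 3 * (real l * (real l + 1)) * integral {0..pi} (\<lambda>\<theta>. sin \<theta> * (polar_legendre l ?n \<theta>)\<^sup>2)))"
    using amp_const_pos[of l ?n] by (intro ennreal_leI mult_left_mono polar_legendre_weighted_singular n) auto
  also have "2 * pi * amp_const l ?n * (4 / 3 * (real l * (real l + 1)) * integral {0..pi} (\<lambda>\<theta>. sin \<theta> * (polar_legendre l ?n \<theta>)\<^sup>2)) = 4 / 3 * (real l * (real l + 1))"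
  proof -
    have "2 * pi * amp_const l ?n * (X * integral {0..pi} (\<lambda>\<theta>. sin \<theta> * (polar_legendre l ?n \<theta>)\<^sup>2)) = X" for X
      using polar_legendre_normalized[of ?n l] m by (simp add: mult.assoc mult.left_commute)
    then show ?thesis .
  qed
  finally show ?thesis .
qed

lemma integrable_sph_harm:
  assumes m: "\<bar>m\<bar> \<le> int l"
  shows "integrable sphere_measure (\<lambda>\<omega>. (cmod (sph_harm l m \<omega>))\<^sup>2)"
    "(\<integral>\<omega>. (cmod (sph_harm l m \<omega>))\<^sup>2 \<partial>sphere_measure) = 1"
  using nn_integral_sph_harm[OF m] nn_integral_eq_integral[of sphere_measure "\<lambda>\<omega>. (cmod (sph_harm l m \<omega>))\<^sup>2"]
  by (auto intro!: integrableI_nonneg simp: integral_eq_nn_integral)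

text \<open>Different orders have different frequencies in \<phi>, so a weight in \<theta> alone
  cannot disturb their orthogonality.\<close>

lemma sph_harm_orthogonal_weight:
  assumes [measurable]: "g \<in> borel_measurable borel" and "i \<noteq> j"
  shows "(\<integral>\<omega>. (sph_harm l i \<omega> * complex_of_real (g (fst \<omega>))) * cnj (sph_harm l j \<omega> * complex_of_real (g (fst \<omega>))) \<partial>sphere_measure) = 0"
proof -
  have "(sph_harm l i \<omega> * complex_of_real (g (fst \<omega>))) * cnj (sph_harm l j \<omega> * complex_of_real (g (fst \<omega>)))
    = (\<lambda>\<theta>. complex_of_real (sph_amp l i \<theta> * sph_amp l j \<theta> * (g \<theta>)\<^sup>2)) (fst \<omega>) * exp (\<i> * of_int (i - j) * of_real (snd \<omega>))" for \<omega>
  proof -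
    have "exp (\<i> * of_int (i - j) * of_real (snd \<omega>)) = exp (\<i> * of_int i * of_real (snd \<omega>)) * cnj (exp (\<i> * of_int j * of_real (snd \<omega>)))"
      by (simp add: exp_cnj exp_add[symmetric] algebra_simps)
    then show ?thesis by (simp add: sph_harm_amp power2_eq_square mult_ac)
  qed
  moreover have "(\<integral>\<omega>. (\<lambda>\<theta>. complex_of_real (sph_amp l i \<theta> * sph_amp l j \<theta> * (g \<theta>)\<^sup>2)) (fst \<omega>) * exp (\<i> * of_int (i - j) * of_real (snd \<omega>)) \<partial>sphere_measure) = 0"
    by (rule integral_sphere_exp) (use assms in auto)
  ultimately show ?thesis by (simp only:)
qed

lemma normsq_proj_l:
  "normsq_S2 (proj_l l f) = ennreal (\<Sum>m\<in>{-int l..int l}. (cmod (inner_S2 f (sph_harm l m)))\<^sup>2)"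
proof -
  let ?I = "{-int l..int l}" and ?c = "\<lambda>m. inner_S2 f (sph_harm l m)"
  have fin: "finite ?I" by simp
  have hm: "sph_harm l m \<in> borel_measurable sphere_measure" if "m \<in> ?I" for m by measurable
  have hi: "integrable sphere_measure (\<lambda>\<omega>. (cmod (sph_harm l m \<omega>))\<^sup>2)" if "m \<in> ?I" for m
    using that by (intro integrable_sph_harm) auto
  have orth: "(\<integral>\<omega>. sph_harm l i \<omega> * cnj (sph_harm l j \<omega>) \<partial>sphere_measure) = 0" if "i \<noteq> j" for i j
    using sph_harm_orthogonal_weight[of "\<lambda>_. 1" i j l] that by simp
  note * = integral_orthogonal_sum[OF fin hm hi orth, where c = ?c]
  have "normsq_S2 (proj_l l f) = ennreal (\<integral>\<omega>. (cmod (\<Sum>m\<in>?I. ?c m * sph_harm l m \<omega>))\<^sup>2 \<partial>sphere_measure)"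
    unfolding normsq_S2_def proj_l_def by (rule nn_integral_eq_integral) (use * in auto)
  also have "\<dots> = ennreal (\<Sum>m\<in>?I. (cmod (?c m))\<^sup>2)"
    by (subst *(2)) (auto intro!: arg_cong[where f = ennreal] sum.cong simp: integrable_sph_harm)
  finally show ?thesis .
qed

text \<open>The coefficient of f at Y is that of f sqrt W at Y / sqrt W, and Bessel's inequality
  applies to the latter family. Positivity of W is asked only between the poles, which admits
  sin^3.\<close>

lemma coeff_weight_bound:
  assumes f [measurable]: "f \<in> borel_measurable sphere_measure"
    and W [measurable]: "W \<in> borel_measurable borel" and W0: "\<And>\<theta>. 0 < \<theta> \<Longrightarrow> \<theta> < pi \<Longrightarrow> W \<theta> > 0"
    and Q: "(\<integral>\<^sup>+\<omega>. ennreal ((cmod (f \<omega>))\<^sup>2 * W (fst \<omega>)) \<partial>sphere_measure) \<le> ennreal Q" "Q \<ge> 0"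
    and I: "finite I"
    and K: "\<And>m. m \<in> I \<Longrightarrow> (\<integral>\<^sup>+\<omega>. ennreal ((cmod (sph_harm l m \<omega>))\<^sup>2 / W (fst \<omega>)) \<partial>sphere_measure) \<le> ennreal K" "K > 0"
  shows "(\<Sum>m\<in>I. (cmod (inner_S2 f (sph_harm l m)))\<^sup>2) \<le> K * Q"
proof -
  define g where "g = (\<lambda>\<omega>. f \<omega> * complex_of_real (sqrt (W (fst \<omega>))))"
  define h where "h = (\<lambda>m \<omega>. sph_harm l m \<omega> * complex_of_real ((\<lambda>\<theta>. inverse (sqrt (W \<theta>))) (fst \<omega>)))"
  have gm [measurable]: "g \<in> borel_measurable sphere_measure" unfolding g_def by measurable
  have hm [measurable]: "h m \<in> borel_measurable sphere_measure" for m unfolding h_def by measurable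
  have ga: "AE \<omega> in sphere_measure. (cmod (g \<omega>))\<^sup>2 = (cmod (f \<omega>))\<^sup>2 * W (fst \<omega>)"
    using AE_sphere_interior by eventually_elim (auto simp: g_def norm_mult power_mult_distrib W0 less_imp_le)
  have ha: "AE \<omega> in sphere_measure. (cmod (h m \<omega>))\<^sup>2 = (cmod (sph_harm l m \<omega>))\<^sup>2 / W (fst \<omega>)" for m
    using AE_sphere_interior
    by eventually_elim (auto simp: h_def norm_mult norm_inverse power_mult_distrib W0 less_imp_le divide_inverse power_inverse)
  have gn: "(\<integral>\<^sup>+\<omega>. ennreal ((cmod (g \<omega>))\<^sup>2) \<partial>sphere_measure) \<le> ennreal Q"
    using Q(1) by (subst nn_integral_cong_AE[where v = "\<lambda>\<omega>. ennreal ((cmod (f \<omega>))\<^sup>2 * W (fst \<omega>))"]) (use ga in auto)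
  have hn: "(\<integral>\<^sup>+\<omega>. ennreal ((cmod (h m \<omega>))\<^sup>2) \<partial>sphere_measure) \<le> ennreal K" if "m \<in> I" for m
    using K(1)[OF that] by (subst nn_integral_cong_AE[where v = "\<lambda>\<omega>. ennreal ((cmod (sph_harm l m \<omega>))\<^sup>2 / W (fst \<omega>))"]) (use ha[of m] in auto)
  have gi: "integrable sphere_measure (\<lambda>\<omega>. (cmod (g \<omega>))\<^sup>2)"
    using gn by (intro integrableI_nonneg) (auto intro: le_less_trans)
  have hi: "integrable sphere_measure (\<lambda>\<omega>. (cmod (h m \<omega>))\<^sup>2)" if "m \<in> I" for m
    using hn[OF that] by (intro integrableI_nonneg) (auto intro: le_less_trans)
  have gQ: "(\<integral>\<omega>. (cmod (g \<omega>))\<^sup>2 \<partial>sphere_measure) \<le> Q"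
    using gn Q(2) nn_integral_eq_integral[OF gi] by simp
  have hK: "(\<integral>\<omega>. (cmod (h m \<omega>))\<^sup>2 \<partial>sphere_measure) \<le> K" if "m \<in> I" for m
    using hn[OF that] K(2) nn_integral_eq_integral[OF hi[OF that]] by simp
  have orth: "(\<integral>\<omega>. h i \<omega> * cnj (h j \<omega>) \<partial>sphere_measure) = 0" if "i \<noteq> j" for i j
    unfolding h_def by (rule sph_harm_orthogonal_weight) (use that in auto)
  have eq: "inner_S2 f (sph_harm l m) = (\<integral>\<omega>. g \<omega> * cnj (h m \<omega>) \<partial>sphere_measure)" for m
    unfolding inner_S2_def
  proof (rule integral_cong_AE)
    show "AE \<omega> in sphere_measure. f \<omega> * cnj (sph_harm l m \<omega>) = g \<omega> * cnj (h m \<omega>)"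
      using AE_sphere_interior
    proof eventually_elim
      case (elim \<omega>)
      have "complex_of_real (sqrt (W (fst \<omega>))) * complex_of_real (inverse (sqrt (W (fst \<omega>)))) = 1"
        using W0[of "fst \<omega>"] elim by (simp flip: of_real_mult)
      then show ?case by (simp add: g_def h_def del: of_real_inverse)
    qed
  qed measurable
  have "(\<Sum>m\<in>I. (cmod (inner_S2 f (sph_harm l m)))\<^sup>2) \<le> K * (\<integral>\<omega>. (cmod (g \<omega>))\<^sup>2 \<partial>sphere_measure)"
    unfolding eq by (rule bessel_inequality[OF I hm hi orth gm gi K(2) hK])
  also have "\<dots> \<le> K * Q" using gQ K(2) by simp
  finally show ?thesis .
qed

section \<open>The zonal coefficient\<close>

text \<open>Sonin's argument: by the Legendre equation the left side has derivative 2 x q'(x)^2,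
  where q = \<open>rodrigues l l\<close>, so its maximum is at x = 1 or x = -1, and the right side
  is its value at both.\<close>

lemma rodrigues_energy_le:
  assumes "-1 \<le> x" "x \<le> 1"
  shows "real l * (real l + 1) * (poly (rodrigues l l) x)\<^sup>2 + (1 - x\<^sup>2) * (poly (rodrigues l (Suc l)) x)\<^sup>2
    \<le> real l * (real l + 1) * (2 ^ l * fact l)\<^sup>2"
proof -
  define G where "G = (\<lambda>x. real l * (real l + 1) * (poly (rodrigues l l) x)\<^sup>2 + (1 - x\<^sup>2) * (poly (rodrigues l (Suc l)) x)\<^sup>2)"
  have D: "(G has_real_derivative 2 * x * (poly (rodrigues l (Suc l)) x)\<^sup>2) (at x)" for x
  proof -
    let ?q = "poly (rodrigues l l) x" and ?q1 = "poly (rodrigues l (Suc l)) x" and ?q2 = "poly (rodrigues l (Suc (Suc l))) x"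
    have "(G has_real_derivative (2 * (real l * (real l + 1)) * ?q * ?q1 - 2 * x * ?q1\<^sup>2 + 2 * ?q1 * ((1 - x\<^sup>2) * ?q2))) (at x)"
      unfolding G_def
      by (rule derivative_eq_intros poly_DERIV[THEN DERIV_cong] refl pderiv_rodrigues)+ (simp add: algebra_simps power2_eq_square)
    moreover have e: "(1 - x\<^sup>2) * ?q2 = 2 * x * ?q1 - real l * (real l + 1) * ?q"
      using rodrigues_ode[of x l l] by (simp add: algebra_simps)
    moreover have "2 * L * q * q1 - 2 * x * q1\<^sup>2 + 2 * q1 * (2 * x * q1 - L * q) = 2 * x * q1\<^sup>2" for L q q1 :: real
      by (simp add: algebra_simps power2_eq_square)
    ultimately show ?thesis by (simp only:)
  qed
  have "G x \<le> real l * (real l + 1) * (2 ^ l * fact l)\<^sup>2"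
  proof (cases "x \<ge> 0")
    case True
    have "G x \<le> G 1"
      by (rule DERIV_nonneg_imp_nondecreasing[OF assms(2)]) (use D True in \<open>force intro: exI\<close>)
    also have "G 1 = real l * (real l + 1) * (2 ^ l * fact l)\<^sup>2" by (simp add: G_def rodrigues_l_at_1)
    finally show ?thesis .
  next
    case False
    have "G x \<le> G (-1)"
    proof (rule DERIV_nonpos_imp_nonincreasing[OF assms(1)])
      fix z assume "-1 \<le> z" "z \<le> x"
      then have "2 * z * (poly (rodrigues l (Suc l)) z)\<^sup>2 \<le> 0" using False by (intro mult_nonpos_nonneg[where a = "2 * z"]) auto
      then show "\<exists>y. (G has_real_derivative y) (at z) \<and> y \<le> 0" using D by blast
    qed
    also have "G (-1) = real l * (real l + 1) * (2 ^ l * fact l)\<^sup>2"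
      by (simp add: G_def rodrigues_l_at_minus_1 power_mult_distrib flip: power_mult)
    finally show ?thesis .
  qed
  then show ?thesis by (simp add: G_def)
qed

text \<open>The energy bound gives |d/d\<theta> P_l(cos \<theta>)| \<le> sqrt (l(l+1)) \<le> l + 1,
  here scaled by 2^l l!; the mean value theorem does the rest.\<close>

lemma legendre_lipschitz:
  assumes "\<theta> \<ge> 0"
  shows "\<bar>poly (rodrigues l l) (cos \<theta>) - 2 ^ l * fact l\<bar> \<le> (real l + 1) * (2 ^ l * fact l) * \<theta>"
proof (cases "\<theta> = 0")
  case True
  then show ?thesis by (simp add: rodrigues_l_at_1)
next
  case False
  then have \<theta>: "0 < \<theta>" using assms by simp
  let ?f' = "\<lambda>\<theta>. - sin \<theta> * poly (rodrigues l (Suc l)) (cos \<theta>)"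
  have b: "\<bar>?f' z\<bar> \<le> (real l + 1) * (2 ^ l * fact l)" for z
  proof (rule power2_le_imp_le)
    have "(?f' z)\<^sup>2 \<le> real l * (real l + 1) * (poly (rodrigues l l) (cos z))\<^sup>2 + (?f' z)\<^sup>2" by simp
    also have "\<dots> \<le> real l * (real l + 1) * (2 ^ l * fact l)\<^sup>2"
      using rodrigues_energy_le[of "cos z" l] by (simp add: power_mult_distrib sin_squared_eq)
    also have "\<dots> \<le> (real l + 1) * (real l + 1) * (2 ^ l * fact l)\<^sup>2"
      by (intro mult_right_mono) auto
    finally show "\<bar>?f' z\<bar>\<^sup>2 \<le> ((real l + 1) * (2 ^ l * fact l))\<^sup>2" by (simp add: power2_eq_square mult_ac)
  qed simp
  obtain z where "poly (rodrigues l l) (cos \<theta>) - poly (rodrigues l l) (cos 0) = (\<theta> - 0) * ?f' z"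
    using MVT2[OF \<theta>, of "\<lambda>\<theta>. poly (rodrigues l l) (cos \<theta>)" ?f'] DERIV_rodrigues_cos[of l l] by auto
  then have "\<bar>poly (rodrigues l l) (cos \<theta>) - 2 ^ l * fact l\<bar> = \<theta> * \<bar>?f' z\<bar>"
    using \<theta> by (simp only: cos_zero rodrigues_l_at_1 abs_mult) simp
  also have "\<dots> \<le> \<theta> * ((real l + 1) * (2 ^ l * fact l))" using \<theta> b by (intro mult_left_mono) auto
  finally show ?thesis by (simp add: mult_ac)
qed

lemma sph_amp_0:
  assumes "0 < \<theta>" "\<theta> < pi"
  shows "sph_amp l 0 \<theta> = sqrt ((2 * real l + 1) / (4 * pi)) * (poly (rodrigues l l) (cos \<theta>) / (2 ^ l * fact l))"
proof -
  have "1 - (cos \<theta>)\<^sup>2 \<noteq> 0" using sin_gt_zero[OF assms] by (simp flip: sin_squared_eq)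
  then show ?thesis by (simp add: sph_amp_def assoc_legendre_def rodrigues_def)
qed

section \<open>Moving the dilation onto the zonal harmonic\<close>

lemma dilation_eq: "dilation a f \<omega> = complex_of_real (sqrt (kappa a (fst \<omega>))) * f (dil_map (1 / a) \<omega>)"
  by (simp add: dilation_def dil_map_def)

lemma dilation_measurable:
  assumes "a > 0" and [measurable]: "f \<in> borel_measurable sphere_measure"
  shows "dilation a f \<in> borel_measurable sphere_measure"
proof -
  have [measurable]: "dil_map (1 / a) \<in> measurable sphere_measure sphere_measure"
    using assms by (intro dil_map_measurable) simp
  show ?thesis unfolding dilation_eq[abs_def] by measurable
qed

lemma theta_dil_pos:
  assumes "b > 0" "0 < \<theta>" "\<theta> < pi"
  shows "0 < theta_dil b \<theta>" "theta_dil b \<theta> < pi"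
proof -
  have "tan (\<theta> / 2) > 0" using assms by (intro tan_gt_zero) auto
  then show "0 < theta_dil b \<theta>" using assms by (simp add: theta_dil_def)
  show "theta_dil b \<theta> < pi" using assms by (intro theta_dil_lt_pi) auto
qed

text \<open>Dilating by 1/a and then by a restores sin \<theta>, and each application of
  \<open>sin_theta_dil\<close> contributes one of the denominators.\<close>

lemma half_den_theta_dil:
  assumes a: "a > 0" and \<theta>: "0 < \<theta>" "\<theta> < pi"
  shows "half_den (a\<^sup>2) (theta_dil (1 / a) \<theta>) * half_den ((1 / a)\<^sup>2) \<theta> = 1"
proof -
  let ?t = "theta_dil (1 / a) \<theta>"
  have t: "0 < ?t" "?t < pi" using theta_dil_pos[of "1 / a" \<theta>] assms by auto
  have p: "half_den (a\<^sup>2) ?t > 0" "half_den ((1 / a)\<^sup>2) \<theta> > 0" using a by (auto intro!: half_den_pos)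
  have "sin \<theta> = sin (theta_dil a ?t)" using theta_dil_inverse[OF a] \<theta> by simp
  also have "\<dots> = a * sin ?t / half_den (a\<^sup>2) ?t" using t by (intro sin_theta_dil a) auto
  also have "sin ?t = (1 / a) * sin \<theta> / half_den ((1 / a)\<^sup>2) \<theta>" using \<theta> a by (intro sin_theta_dil) auto
  finally have "sin \<theta> = sin \<theta> / (half_den ((1 / a)\<^sup>2) \<theta> * half_den (a\<^sup>2) ?t)" using a by simp
  then show ?thesis using sin_gt_zero[OF \<theta>] p by (simp add: field_simps)
qed

text \<open>The source of the factor 1/(1 + cos \<theta>) in (A1), (A2) and (C): the derivative of
  the dilated angle, expressed through the cosines of both angles.\<close>

lemma half_den_cos_theta_dil:
  assumes a: "a > 0" and \<theta>: "0 < \<theta>" "\<theta> < pi"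
  shows "a / half_den (a\<^sup>2) \<theta> = a * (1 + cos (theta_dil a \<theta>)) / (1 + cos \<theta>)"
proof -
  have C: "cos (\<theta> / 2) > 0" using half_cos_pos[of \<theta>] \<theta> by simp
  let ?t = "tan (\<theta> / 2)"
  have "cos (theta_dil a \<theta>) = (1 - (a * ?t)\<^sup>2) / (1 + (a * ?t)\<^sup>2)"
    using trig_of_tan_half(1)[of "theta_dil a \<theta>"] theta_dil_pos[OF a \<theta>] tan_half_theta_dil[of a \<theta>] a \<theta> by simp
  moreover have p: "1 + (a * ?t)\<^sup>2 > 0" by (simp add: add_pos_nonneg)
  ultimately have 1: "1 + cos (theta_dil a \<theta>) = 2 / (1 + (a * ?t)\<^sup>2)" by (simp add: field_simps)
  have 2: "half_den (a\<^sup>2) \<theta> = (cos (\<theta> / 2))\<^sup>2 * (1 + (a * ?t)\<^sup>2)"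
    using C by (simp add: half_den_def tan_def field_simps)
  show ?thesis unfolding 1 2 half_angle(3)[of \<theta>] by simp
qed

text \<open>Both follow from arctan x \<le> x. In the first, t \<le> 1 + t^2 produces two summands
  that match (A1) and (A2).\<close>

lemma theta_dil_le:
  assumes a: "a > 0" and \<theta>: "0 < \<theta>" "\<theta> < pi"
  shows "theta_dil a \<theta> \<le> 2 * a * (1 + (tan (\<theta> / 2))\<^sup>2)" "sin (theta_dil a \<theta>) \<le> 2 * a * tan (\<theta> / 2)"
proof -
  let ?t = "tan (\<theta> / 2)"
  have t: "?t > 0" using \<theta> by (intro tan_gt_zero) auto
  have "theta_dil a \<theta> = 2 * arctan (a * ?t)" using \<theta> by (simp add: theta_dil_def)
  also have "\<dots> \<le> 2 * (a * ?t)" using arctan_le_self[of "a * ?t"] t a by simp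
  finally have 1: "theta_dil a \<theta> \<le> 2 * a * ?t" by simp
  have "2 * 1 * ?t \<le> 1\<^sup>2 + ?t\<^sup>2" by (rule sum_squares_bound)
  then have "?t \<le> 1 + ?t\<^sup>2" using t by simp
  then have "2 * a * ?t \<le> 2 * a * (1 + ?t\<^sup>2)" using a by simp
  with 1 show "theta_dil a \<theta> \<le> 2 * a * (1 + ?t\<^sup>2)" by simp
  show "sin (theta_dil a \<theta>) \<le> 2 * a * ?t"
    using 1 sin_x_le_x[of "theta_dil a \<theta>"] theta_dil_pos[OF a \<theta>] by simp
qed

lemma one_minus_cos_le: "\<theta> \<ge> 0 \<Longrightarrow> 1 - cos \<theta> \<le> \<theta>" for \<theta> :: real
proof -
  assume t: "\<theta> \<ge> 0"
  have "1 - cos \<theta> = 2 * (sin (\<theta> / 2))\<^sup>2" by (rule half_angle(4))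
  also have "\<dots> \<le> 2 * \<bar>sin (\<theta> / 2)\<bar>"
  proof -
    have "(sin (\<theta> / 2))\<^sup>2 = \<bar>sin (\<theta> / 2)\<bar> * \<bar>sin (\<theta> / 2)\<bar>" by (simp add: power2_eq_square)
    also have "\<dots> \<le> \<bar>sin (\<theta> / 2)\<bar> * 1" by (intro mult_left_mono) auto
    finally show ?thesis by simp
  qed
  also have "\<dots> \<le> \<theta>" using abs_sin_x_le_abs_x[of "\<theta> / 2"] t by simp
  finally show ?thesis .
qed

text \<open>Since (C) concerns f itself, the dilation is transferred to Y_l^0; the root of the
  Jacobian that survives is a (1 + cos \<theta>_a) / (1 + cos \<theta>).\<close>

lemma inner_dilation_zonal:
  assumes a: "a > 0" and f [measurable]: "f \<in> borel_measurable sphere_measure"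
  shows "inner_S2 (dilation a f) (sph_harm l 0) =
    (\<integral>\<omega>. f \<omega> / complex_of_real (1 + cos (fst \<omega>)) * complex_of_real (a * (1 + cos (theta_dil a (fst \<omega>))) * sph_amp l 0 (theta_dil a (fst \<omega>))) \<partial>sphere_measure)"
proof -
  note [measurable] = dilation_measurable[OF a f]
  have [measurable]: "dil_map (1 / a) \<in> measurable sphere_measure sphere_measure"
    using a by (intro dil_map_measurable) simp
  have [measurable]: "half_den b \<in> borel_measurable borel" for b unfolding half_den_def[abs_def] by measurable
  let ?F = "\<lambda>\<omega>. f \<omega> * complex_of_real (a / half_den (a\<^sup>2) (fst \<omega>) * sph_amp l 0 (theta_dil a (fst \<omega>)))"
  have Fm: "?F \<in> borel_measurable sphere_measure" by measurable
  have "inner_S2 (dilation a f) (sph_harm l 0) = (\<integral>\<omega>. complex_of_real (kappa a (fst \<omega>)) * ?F (dil_map (1 / a) \<omega>) \<partial>sphere_measure)"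
    unfolding inner_S2_def
  proof (rule integral_cong_AE)
    show "AE \<omega> in sphere_measure. dilation a f \<omega> * cnj (sph_harm l 0 \<omega>) = complex_of_real (kappa a (fst \<omega>)) * ?F (dil_map (1 / a) \<omega>)"
      using AE_sphere_interior
    proof eventually_elim
      case (elim \<omega>)
      let ?\<theta> = "fst \<omega>"
      have V: "half_den ((1 / a)\<^sup>2) ?\<theta> > 0" using a by (intro half_den_pos) auto
      have k: "kappa a ?\<theta> = ((1 / a) / half_den ((1 / a)\<^sup>2) ?\<theta>)\<^sup>2" by (rule kappa_half_den[OF a])
      have sk: "sqrt (kappa a ?\<theta>) = (1 / a) / half_den ((1 / a)\<^sup>2) ?\<theta>" unfolding k using V a by simp
      have "kappa a ?\<theta> * (a / half_den (a\<^sup>2) (theta_dil (1 / a) ?\<theta>)) = sqrt (kappa a ?\<theta>)"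
        using half_den_theta_dil[OF a, of ?\<theta>] elim V a unfolding sk unfolding k
        by (simp add: field_simps power2_eq_square)
      moreover have "theta_dil a (theta_dil (1 / a) ?\<theta>) = ?\<theta>" using elim a by (intro theta_dil_inverse) auto
      moreover have "complex_of_real (kappa a ?\<theta>) * (z * complex_of_real (a / half_den (a\<^sup>2) (theta_dil (1 / a) ?\<theta>) * y))
        = complex_of_real (kappa a ?\<theta> * (a / half_den (a\<^sup>2) (theta_dil (1 / a) ?\<theta>))) * z * complex_of_real y" for z y
        by simp
      ultimately show ?case
        by (simp only: dilation_eq sph_harm_amp dil_map_def fst_conv) simp
    qed
  qed measurable
  also have "\<dots> = (\<integral>\<omega>. ?F \<omega> \<partial>sphere_measure)" by (rule integral_dilation[OF a Fm])
  also have "\<dots> = (\<integral>\<omega>. f \<omega> / complex_of_real (1 + cos (fst \<omega>)) * complex_of_real (a * (1 + cos (theta_dil a (fst \<omega>))) * sph_amp l 0 (theta_dil a (fst \<omega>))) \<partial>sphere_measure)"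
  proof (rule integral_cong_AE)
    show "AE \<omega> in sphere_measure. ?F \<omega> = f \<omega> / complex_of_real (1 + cos (fst \<omega>)) * complex_of_real (a * (1 + cos (theta_dil a (fst \<omega>))) * sph_amp l 0 (theta_dil a (fst \<omega>)))"
      using AE_sphere_interior by eventually_elim (simp add: half_den_cos_theta_dil[OF a])
  qed measurable
  finally show ?thesis .
qed

text \<open>For small a the kernel \<open>p\<close> is close to the constant 2 a A, where A is the
  limit of Y_l^0 at the north pole. By (C) this constant may be subtracted, and the remainder is of
  order a^2.\<close>

lemma zonal_coeff_bound:
  assumes a: "a > 0" and f [measurable]: "f \<in> borel_measurable sphere_measure"
    and J: "integrable sphere_measure (\<lambda>\<omega>. cmod (f \<omega>) / (1 + cos (fst \<omega>)) * (1 + (tan (fst \<omega> / 2))\<^sup>2))"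
    and C: "(\<integral>\<omega>. f \<omega> / complex_of_real (1 + cos (fst \<omega>)) \<partial>sphere_measure) = 0"
  shows "cmod (inner_S2 (dilation a f) (sph_harm l 0)) \<le> sqrt ((2 * real l + 1) / (4 * pi)) * (6 * (real l + 1) * a\<^sup>2 *
     (\<integral>\<omega>. cmod (f \<omega>) / (1 + cos (fst \<omega>)) * (1 + (tan (fst \<omega> / 2))\<^sup>2) \<partial>sphere_measure))"
proof -
  define A where "A = sqrt ((2 * real l + 1) / (4 * pi))"
  define J where "J = (\<lambda>\<omega>. cmod (f \<omega>) / (1 + cos (fst \<omega>)) * (1 + (tan (fst \<omega> / 2))\<^sup>2))"
  define u where "u = (\<lambda>\<omega>. f \<omega> / complex_of_real (1 + cos (fst \<omega>)))"
  define p where "p = (\<lambda>\<omega>::real \<times> real. a * (1 + cos (theta_dil a (fst \<omega>))) * sph_amp l 0 (theta_dil a (fst \<omega>)))"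
  have um [measurable]: "u \<in> borel_measurable sphere_measure" unfolding u_def by measurable
  have pm [measurable]: "p \<in> borel_measurable sphere_measure" unfolding p_def by measurable
  have Ji: "integrable sphere_measure J" using J unfolding J_def .
  have A0: "A \<ge> 0" by (simp add: A_def)
  have bd: "AE \<omega> in sphere_measure. cmod (u \<omega>) \<le> J \<omega> \<and> cmod (u \<omega> * complex_of_real (p \<omega> - 2 * a * A)) \<le> A * (6 * (real l + 1) * a\<^sup>2) * J \<omega>"
    using AE_sphere_interior
  proof eventually_elim
    case (elim \<omega>)
    let ?\<theta> = "fst \<omega>" and ?t = "theta_dil a (fst \<omega>)" and ?T = "(tan (fst \<omega> / 2))\<^sup>2"
    let ?P = "poly (rodrigues l l) (cos ?t) / (2 ^ l * fact l)"
    have c: "1 + cos ?\<theta> > 0" using half_cos_pos[of ?\<theta>] elim unfolding half_angle(3) by simp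
    have cu: "cmod (u \<omega>) = cmod (f \<omega>) / (1 + cos ?\<theta>)" unfolding u_def norm_divide norm_of_real using c by simp
    have uJ: "cmod (u \<omega>) * (1 + ?T) = J \<omega>" by (simp add: cu J_def)
    have "cmod (u \<omega>) * 1 \<le> cmod (u \<omega>) * (1 + ?T)" by (intro mult_left_mono) auto
    then have 1: "cmod (u \<omega>) \<le> J \<omega>" using uJ by simp
    have t: "0 < ?t" "?t < pi" using theta_dil_pos[OF a] elim by auto
    have N: "(2::real) ^ l * fact l > 0" by simp
    have P: "\<bar>?P - 1\<bar> \<le> (real l + 1) * ?t"
    proof -
      have "?P - 1 = (poly (rodrigues l l) (cos ?t) - 2 ^ l * fact l) / (2 ^ l * fact l)" by (simp add: diff_divide_distrib)
      then have "\<bar>?P - 1\<bar> = \<bar>poly (rodrigues l l) (cos ?t) - 2 ^ l * fact l\<bar> / (2 ^ l * fact l)" by (simp add: abs_divide abs_mult)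
      also have "\<dots> \<le> (real l + 1) * (2 ^ l * fact l) * ?t / (2 ^ l * fact l)"
        using legendre_lipschitz[of ?t l] t N by (intro divide_right_mono) auto
      finally show ?thesis by simp
    qed
    have "\<bar>(1 + cos ?t) * ?P - 2\<bar> = \<bar>(1 + cos ?t) * (?P - 1) - (1 - cos ?t)\<bar>" by (simp add: algebra_simps)
    also have "\<dots> \<le> \<bar>(1 + cos ?t) * (?P - 1)\<bar> + \<bar>1 - cos ?t\<bar>" by (rule abs_triangle_ineq4)
    \<comment> \<open>The constant 6 of the result: 1 + cos \<le> 2 times the Lipschitz constant l +
      1, plus 1 from 1 - cos t \<le> t, is at most 3 (l + 1); \<open>theta_dil_le\<close> doubles
      it.\<close>
    also have "\<dots> \<le> 2 * ((real l + 1) * ?t) + ?t"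
    proof (rule add_mono)
      show "\<bar>(1 + cos ?t) * (?P - 1)\<bar> \<le> 2 * ((real l + 1) * ?t)"
      proof -
        have "\<bar>1 + cos ?t\<bar> \<le> 2" using cos_le_one[of ?t] cos_ge_minus_one[of ?t] by linarith
        then show ?thesis unfolding abs_mult using P by (intro mult_mono) auto
      qed
      show "\<bar>1 - cos ?t\<bar> \<le> ?t" using one_minus_cos_le[of ?t] t by simp
    qed
    also have "\<dots> \<le> 3 * (real l + 1) * ?t" using t by (simp add: algebra_simps)
    also have "\<dots> \<le> 3 * (real l + 1) * (2 * a * (1 + ?T))"
      using theta_dil_le(1)[OF a, of ?\<theta>] elim by (intro mult_left_mono) auto
    also have "\<dots> = 6 * (real l + 1) * a * (1 + ?T)" by (simp add: algebra_simps)
    finally have b: "\<bar>(1 + cos ?t) * ?P - 2\<bar> \<le> 6 * (real l + 1) * a * (1 + ?T)" .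
    have "p \<omega> - 2 * a * A = a * A * ((1 + cos ?t) * ?P - 2)"
      unfolding p_def sph_amp_0[OF t] A_def[symmetric] by (simp add: algebra_simps)
    then have "\<bar>p \<omega> - 2 * a * A\<bar> = a * A * \<bar>(1 + cos ?t) * ?P - 2\<bar>" using a A0 by (simp add: abs_mult)
    also have "\<dots> \<le> a * A * (6 * (real l + 1) * a * (1 + ?T))" using b a A0 by (intro mult_left_mono) auto
    finally have b2: "\<bar>p \<omega> - 2 * a * A\<bar> \<le> a * A * (6 * (real l + 1) * a * (1 + ?T))" .
    have "cmod (u \<omega> * complex_of_real (p \<omega> - 2 * a * A)) = cmod (u \<omega>) * \<bar>p \<omega> - 2 * a * A\<bar>" by (simp only: norm_mult norm_of_real)
    also have "\<dots> \<le> cmod (u \<omega>) * (a * A * (6 * (real l + 1) * a * (1 + ?T)))" using b2 by (intro mult_left_mono) auto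
    also have "\<dots> = A * (6 * (real l + 1) * a\<^sup>2) * (cmod (u \<omega>) * (1 + ?T))" by (simp add: power2_eq_square mult_ac)
    finally show ?case using 1 unfolding uJ by simp
  qed
  let ?K = "A * (6 * (real l + 1) * a\<^sup>2)"
  have bd1: "AE \<omega> in sphere_measure. cmod (u \<omega>) \<le> norm (J \<omega>)"
    using bd by eventually_elim auto
  have bd2: "AE \<omega> in sphere_measure. cmod (u \<omega> * complex_of_real (p \<omega> - 2 * a * A)) \<le> ?K * J \<omega>"
    using bd by eventually_elim blast
  have bd3: "AE \<omega> in sphere_measure. cmod (u \<omega> * complex_of_real (p \<omega> - 2 * a * A)) \<le> norm (?K * J \<omega>)"
    using bd2 by eventually_elim (metis abs_ge_self order_trans real_norm_def)
  have ui: "integrable sphere_measure u"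
    by (rule Bochner_Integration.integrable_bound[OF Ji um bd1])
  have upi: "integrable sphere_measure (\<lambda>\<omega>. u \<omega> * complex_of_real (p \<omega> - 2 * a * A))"
    by (rule Bochner_Integration.integrable_bound[OF integrable_mult_right[OF Ji, of ?K] _ bd3]) measurable
  have "inner_S2 (dilation a f) (sph_harm l 0) = (\<integral>\<omega>. u \<omega> * complex_of_real (p \<omega>) \<partial>sphere_measure)"
    unfolding inner_dilation_zonal[OF a f] u_def p_def ..
  also have "\<dots> = (\<integral>\<omega>. u \<omega> * complex_of_real (p \<omega> - 2 * a * A) + complex_of_real (2 * a * A) * u \<omega> \<partial>sphere_measure)"
    by (simp add: algebra_simps)
  also have "\<dots> = (\<integral>\<omega>. u \<omega> * complex_of_real (p \<omega> - 2 * a * A) \<partial>sphere_measure)"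
    using Bochner_Integration.integral_add[OF upi integrable_mult_right[OF ui, of "complex_of_real (2 * a * A)"]] C
    unfolding u_def[symmetric] by simp
  finally have "cmod (inner_S2 (dilation a f) (sph_harm l 0)) \<le> (\<integral>\<omega>. cmod (u \<omega> * complex_of_real (p \<omega> - 2 * a * A)) \<partial>sphere_measure)"
    by (simp only: integral_norm_bound)
  also have "\<dots> \<le> (\<integral>\<omega>. ?K * J \<omega> \<partial>sphere_measure)"
    by (rule integral_mono_AE[OF integrable_norm[OF upi] integrable_mult_right[OF Ji] bd2])
  also have "\<dots> = ?K * (\<integral>\<omega>. J \<omega> \<partial>sphere_measure)" by simp
  finally show ?thesis unfolding A_def J_def by (simp only: mult.assoc)
qed

section \<open>Boundedness\<close>

lemma nn_integral_sphere_1: "(\<integral>\<^sup>+\<omega>. 1 \<partial>sphere_measure) = ennreal (4 * pi)"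
proof -
  have "(\<integral>\<^sup>+\<omega>. (\<lambda>_. 1) (fst \<omega>) \<partial>sphere_measure) = ennreal (2 * pi) * (\<integral>\<^sup>+\<theta>. 1 * ennreal (sin \<theta>) * indicator {0..pi} \<theta> \<partial>lborel)"
    by (rule nn_integral_sphere_radial) auto
  also have "(\<integral>\<^sup>+\<theta>. 1 * ennreal (sin \<theta>) * indicator {0..pi} \<theta> \<partial>lborel) = ennreal 2"
    using nn_integral_has_integral_lebesgue'[of "{0..pi}" sin 2] has_integral_odd_sin_power[of 0]
    by (simp add: sin_ge_zero)
  also have "ennreal (2 * pi) * ennreal 2 = ennreal (4 * pi)" by (subst ennreal_mult'[symmetric]) auto
  finally show ?thesis by simp
qed

text \<open>After substitution the weight is taken at the dilated angle, where it is at most (2 a /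
  cos(\<theta>/2))^3. The blow-up of this bound at the south pole is absorbed by the decay of f
  expressed by \<open>bd\<close>.\<close>

lemma dilation_weight_bound:
  assumes a: "a > 0" and f [measurable]: "f \<in> borel_measurable sphere_measure" and K: "K \<ge> 0"
    and bd: "AE \<omega> in sphere_measure. cmod (f \<omega>) * (1 + (tan (fst \<omega> / 2))\<^sup>2) / (1 - cos (fst \<omega>)) \<le> K"
  shows "(\<integral>\<^sup>+\<omega>. ennreal ((cmod (dilation a f \<omega>))\<^sup>2 * sqrt (a\<^sup>2 + (sin (fst \<omega>))\<^sup>2) ^ 3) \<partial>sphere_measure)
    \<le> ennreal (128 * pi * K\<^sup>2 * a ^ 3)"
proof -
  define r where "r = (\<lambda>\<theta>. sqrt (a\<^sup>2 + (sin \<theta>)\<^sup>2) ^ 3)"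
  have r0: "r \<theta> \<ge> 0" for \<theta> by (simp add: r_def)
  have [measurable]: "r \<in> borel_measurable borel" unfolding r_def by measurable
  let ?F = "\<lambda>\<omega>. ennreal ((cmod (f \<omega>))\<^sup>2 * r (theta_dil a (fst \<omega>)))"
  have Fm: "?F \<in> borel_measurable sphere_measure" by measurable
  have "(\<integral>\<^sup>+\<omega>. ennreal ((cmod (dilation a f \<omega>))\<^sup>2 * r (fst \<omega>)) \<partial>sphere_measure)
    = (\<integral>\<^sup>+\<omega>. ennreal (kappa a (fst \<omega>)) * ?F (dil_map (1 / a) \<omega>) \<partial>sphere_measure)"
  proof (rule nn_integral_cong_AE)
    show "AE \<omega> in sphere_measure. ennreal ((cmod (dilation a f \<omega>))\<^sup>2 * r (fst \<omega>)) = ennreal (kappa a (fst \<omega>)) * ?F (dil_map (1 / a) \<omega>)"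
      using AE_sphere_interior
    proof eventually_elim
      case (elim \<omega>)
      have "theta_dil a (theta_dil (1 / a) (fst \<omega>)) = fst \<omega>" using elim a by (intro theta_dil_inverse) auto
      then show ?case
        by (simp add: dilation_eq dil_map_def norm_mult power_mult_distrib kappa_nonneg mult.assoc r0 ennreal_mult')
    qed
  qed
  also have "\<dots> = (\<integral>\<^sup>+\<omega>. ?F \<omega> \<partial>sphere_measure)" by (rule nn_integral_dilation[OF a Fm])
  also have "\<dots> \<le> (\<integral>\<^sup>+\<omega>. ennreal (32 * K\<^sup>2 * a ^ 3) * 1 \<partial>sphere_measure)"
  proof (rule nn_integral_mono_AE)
    show "AE \<omega> in sphere_measure. ?F \<omega> \<le> ennreal (32 * K\<^sup>2 * a ^ 3) * 1"
      using AE_sphere_interior bd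
    proof eventually_elim
      case (elim \<omega>)
      let ?\<theta> = "fst \<omega>"
      define S C where "S = sin (?\<theta> / 2)" "C = cos (?\<theta> / 2)"
      note d = this
      have C: "C > 0" using half_cos_pos[of ?\<theta>] elim by (simp add: d)
      have S: "S > 0" unfolding d by (intro sin_gt_zero) (use elim in auto)
      have C1: "C \<le> 1" and S1: "S \<le> 1" by (simp_all add: d)
      have sc: "S\<^sup>2 + C\<^sup>2 = 1" by (simp add: d)
      have t: "tan (?\<theta> / 2) = S / C" by (simp add: tan_def d)
      have t2: "1 + (tan (?\<theta> / 2))\<^sup>2 = 1 / C\<^sup>2" unfolding t using C sc by (simp add: field_simps)
      have "cmod (f \<omega>) * (1 / C\<^sup>2) / (2 * S\<^sup>2) \<le> K"
        using elim(2) unfolding t2 half_angle(4)[of ?\<theta>] d[symmetric] by simp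
      \<comment> \<open>In half angles (A3) becomes |f| \<le> 2 K S^2 C^2, which is (K/2) sin^2
        \<theta>.\<close>
      then have fb: "cmod (f \<omega>) \<le> 2 * K * (S\<^sup>2 * C\<^sup>2)" using S C by (simp add: field_simps)
      have "(cmod (f \<omega>))\<^sup>2 \<le> (2 * K * (S\<^sup>2 * C\<^sup>2))\<^sup>2" using fb by (intro power_mono) auto
      also have "\<dots> = 4 * K\<^sup>2 * (S ^ 4 * C ^ 4)" by (simp add: power_mult_distrib flip: power_mult)
      finally have f2: "(cmod (f \<omega>))\<^sup>2 \<le> 4 * K\<^sup>2 * (S ^ 4 * C ^ 4)" .
      have sl: "sin (theta_dil a ?\<theta>) \<le> 2 * a * (S / C)" using theta_dil_le(2)[OF a, of ?\<theta>] elim by (simp add: t)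
      have s0: "sin (theta_dil a ?\<theta>) \<ge> 0" using theta_dil_pos[OF a, of ?\<theta>] elim by (intro sin_ge_zero) auto
      have "sqrt (a\<^sup>2 + (sin (theta_dil a ?\<theta>))\<^sup>2) \<le> 2 * a / C"
      proof (rule real_le_lsqrt)
        have "(sin (theta_dil a ?\<theta>))\<^sup>2 \<le> (2 * a * (S / C))\<^sup>2" using sl s0 by (intro power_mono) auto
        moreover have "a\<^sup>2 * 1 \<le> 4 * a\<^sup>2 * 1" by simp
        moreover have "(2 * a * (S / C))\<^sup>2 + 4 * a\<^sup>2 * 1 = (2 * a / C)\<^sup>2"
        proof -
          have "(2 * a * (S / C))\<^sup>2 + 4 * a\<^sup>2 * 1 = 4 * a\<^sup>2 * (S\<^sup>2 + C\<^sup>2) / C\<^sup>2"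
            using C by (simp add: power_mult_distrib power_divide field_simps)
          then show ?thesis unfolding sc by (simp add: power_mult_distrib power_divide)
        qed
        ultimately show "a\<^sup>2 + (sin (theta_dil a ?\<theta>))\<^sup>2 \<le> (2 * a / C)\<^sup>2" by linarith
      qed (use a C in auto)
      then have "r (theta_dil a ?\<theta>) \<le> (2 * a / C) ^ 3" unfolding r_def by (intro power_mono) auto
      \<comment> \<open>The decay C^4 beats the growth C^(-3). The constants are 4 * 2^3 = 32, and
        the area 4 pi of the sphere raises this to 128 pi.\<close>
      then have "(cmod (f \<omega>))\<^sup>2 * r (theta_dil a ?\<theta>) \<le> 4 * K\<^sup>2 * (S ^ 4 * C ^ 4) * (2 * a / C) ^ 3"
        using f2 r0 C S by (intro mult_mono) auto
      also have "\<dots> = 32 * K\<^sup>2 * a ^ 3 * (S ^ 4 * C)" using C by (simp add: power_divide power_mult_distrib power4_eq_xxxx power3_eq_cube)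
      also have "\<dots> \<le> 32 * K\<^sup>2 * a ^ 3 * 1"
      proof (rule mult_left_mono)
        have "S ^ 4 \<le> 1" using S S1 by (intro power_le_one) auto
        then show "S ^ 4 * C \<le> 1" using C C1 S by (intro mult_le_one) auto
      qed (use a in auto)
      finally show ?case by (simp add: ennreal_leI)
    qed
  qed
  also have "\<dots> = ennreal (32 * K\<^sup>2 * a ^ 3) * ennreal (4 * pi)"
    by (subst nn_integral_cmult) (simp_all add: nn_integral_sphere_1 del: nn_integral_const)
  also have "\<dots> = ennreal (128 * pi * K\<^sup>2 * a ^ 3)"
    by (subst ennreal_mult''[symmetric]) (auto simp: mult_ac)
  finally show ?thesis unfolding r_def .
qed

text \<open>The threshold gives (l+1)^2 a^2 \<ge> 4, hence l(l+1) a^2 \<ge> 2 for l \<ge> 1 because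
  l + 1 \<le> 2 l; for l = 0 it gives a \<ge> 2, the other alternative of
  \<open>sph_harm_weight_scale\<close>. The two weighted bounds multiply to a^(-2) a^3 = a.\<close>

lemma proj_dilation_large_scale:
  assumes a: "a \<ge> 2 / (real l + 1)" and f: "f \<in> borel_measurable sphere_measure" and K: "K \<ge> 0"
    and bd: "AE \<omega> in sphere_measure. cmod (f \<omega>) * (1 + (tan (fst \<omega> / 2))\<^sup>2) / (1 - cos (fst \<omega>)) \<le> K"
  shows "(\<Sum>m\<in>{-int l..int l}. (cmod (inner_S2 (dilation a f) (sph_harm l m)))\<^sup>2) \<le> 2 * (128 * pi * K\<^sup>2) * a"
proof -
  have a0: "a > 0" using a less_le_trans[of 0 "2 / (real l + 1)" a] by simp
  have al: "a * (real l + 1) \<ge> 2" using a by (simp add: divide_le_eq)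
  have la: "real l * (real l + 1) * a\<^sup>2 \<ge> 2 \<or> a \<ge> 1"
  proof (cases "l = 0")
    case True
    then show ?thesis using al by simp
  next
    case False
    then have l1: "real l \<ge> 1" by simp
    have "2 * 2 \<le> (a * (real l + 1)) * (a * (real l + 1))" using al by (intro mult_mono) auto
    also have "\<dots> = (real l + 1) * ((real l + 1) * a\<^sup>2)" by (simp add: power2_eq_square mult_ac)
    also have "\<dots> \<le> (2 * real l) * ((real l + 1) * a\<^sup>2)" using l1 by (intro mult_right_mono) auto
    finally show ?thesis by simp
  qed
  have p: "sqrt (a\<^sup>2 + (sin \<theta>)\<^sup>2) > 0" for \<theta> using a0 by (simp add: add_pos_nonneg)
  have "(\<Sum>m\<in>{-int l..int l}. (cmod (inner_S2 (dilation a f) (sph_harm l m)))\<^sup>2) \<le> (2 / a\<^sup>2) * (128 * pi * K\<^sup>2 * a ^ 3)"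
  proof (rule coeff_weight_bound[where W = "\<lambda>\<theta>. sqrt (a\<^sup>2 + (sin \<theta>)\<^sup>2) ^ 3"])
    show "(\<integral>\<^sup>+\<omega>. ennreal ((cmod (sph_harm l m \<omega>))\<^sup>2 / sqrt (a\<^sup>2 + (sin (fst \<omega>))\<^sup>2) ^ 3) \<partial>sphere_measure) \<le> ennreal (2 / a\<^sup>2)"
      if "m \<in> {-int l..int l}" for m using that by (intro sph_harm_weight_scale a0 la) auto
    show "0 < sqrt (a\<^sup>2 + (sin \<theta>)\<^sup>2) ^ 3" for \<theta> using p by (rule zero_less_power)
    show "dilation a f \<in> borel_measurable sphere_measure" by (rule dilation_measurable[OF a0 f])
    show "(\<integral>\<^sup>+\<omega>. ennreal ((cmod (dilation a f \<omega>))\<^sup>2 * sqrt (a\<^sup>2 + (sin (fst \<omega>))\<^sup>2) ^ 3) \<partial>sphere_measure) \<le> ennreal (128 * pi * K\<^sup>2 * a ^ 3)"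
      by (rule dilation_weight_bound[OF a0 f K bd])
  qed (use a0 in auto)
  also have "\<dots> = 2 * (128 * pi * K\<^sup>2) * a" using a0 by (simp add: power2_eq_square power3_eq_cube)
  finally show ?thesis .
qed

text \<open>Order 0 is estimated by the cancellation, the others by the weight sin^3. As sin \<le>
  sqrt (a^2 + sin^2), the bound of \<open>dilation_weight_bound\<close> also serves for
  sin^3.\<close>

lemma proj_dilation_small_scale:
  assumes a: "a > 0" and f [measurable]: "f \<in> borel_measurable sphere_measure" and K: "K \<ge> 0"
    and bd: "AE \<omega> in sphere_measure. cmod (f \<omega>) * (1 + (tan (fst \<omega> / 2))\<^sup>2) / (1 - cos (fst \<omega>)) \<le> K"
    and Ji: "integrable sphere_measure (\<lambda>\<omega>. cmod (f \<omega>) / (1 + cos (fst \<omega>)) * (1 + (tan (fst \<omega> / 2))\<^sup>2))"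
    and J: "J = (\<integral>\<omega>. cmod (f \<omega>) / (1 + cos (fst \<omega>)) * (1 + (tan (fst \<omega> / 2))\<^sup>2) \<partial>sphere_measure)"
    and C: "(\<integral>\<omega>. f \<omega> / complex_of_real (1 + cos (fst \<omega>)) \<partial>sphere_measure) = 0"
  shows "(\<Sum>m\<in>{-int l..int l}. (cmod (inner_S2 (dilation a f) (sph_harm l m)))\<^sup>2)
    \<le> 9 * (2 * real l + 1) * (real l + 1)\<^sup>2 * J\<^sup>2 * a ^ 4 + 4 / 3 * (real l + 1)\<^sup>2 * (128 * pi * K\<^sup>2) * a ^ 3"
proof -
  let ?c = "\<lambda>m. (cmod (inner_S2 (dilation a f) (sph_harm l m)))\<^sup>2"
  have "(\<Sum>m\<in>{-int l..int l}. ?c m) = ?c 0 + (\<Sum>m\<in>{-int l..int l} - {0}. ?c m)"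
    by (rule sum.remove) auto
  also have "\<dots> \<le> 9 * (2 * real l + 1) * (real l + 1)\<^sup>2 * J\<^sup>2 * a ^ 4 + (4 / 3 * (real l + 1)\<^sup>2) * (128 * pi * K\<^sup>2 * a ^ 3)"
  proof (rule add_mono)
    have "?c 0 \<le> (sqrt ((2 * real l + 1) / (4 * pi)) * (6 * (real l + 1) * a\<^sup>2 * J))\<^sup>2"
      unfolding J by (intro power_mono zonal_coeff_bound a f Ji C) auto
    also have "\<dots> = (2 * real l + 1) / (4 * pi) * (36 * (real l + 1)\<^sup>2 * J\<^sup>2 * a ^ 4)"
    proof -
      have "(sqrt ((2 * real l + 1) / (4 * pi)))\<^sup>2 = (2 * real l + 1) / (4 * pi)" by simp
      then show ?thesis by (simp only: power_mult_distrib) (simp flip: power_mult)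
    qed
    also have "\<dots> \<le> (2 * real l + 1) / 4 * (36 * (real l + 1)\<^sup>2 * J\<^sup>2 * a ^ 4)"
      using pi_gt3 by (intro mult_right_mono divide_left_mono) auto
    also have "\<dots> = 9 * (2 * real l + 1) * (real l + 1)\<^sup>2 * J\<^sup>2 * a ^ 4"
      by (simp add: algebra_simps)
    finally show "?c 0 \<le> 9 * (2 * real l + 1) * (real l + 1)\<^sup>2 * J\<^sup>2 * a ^ 4" .
    show "(\<Sum>m\<in>{-int l..int l} - {0}. ?c m) \<le> (4 / 3 * (real l + 1)\<^sup>2) * (128 * pi * K\<^sup>2 * a ^ 3)"
    proof (rule coeff_weight_bound[where W = "\<lambda>\<theta>. sin \<theta> ^ 3"])
      show "(\<integral>\<^sup>+\<omega>. ennreal ((cmod (sph_harm l m \<omega>))\<^sup>2 / sin (fst \<omega>) ^ 3) \<partial>sphere_measure) \<le> ennreal (4 / 3 * (real l + 1)\<^sup>2)"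
        if "m \<in> {-int l..int l} - {0}" for m
      proof -
        have "(\<integral>\<^sup>+\<omega>. ennreal ((cmod (sph_harm l m \<omega>))\<^sup>2 / sin (fst \<omega>) ^ 3) \<partial>sphere_measure) \<le> ennreal (4 / 3 * (real l * (real l + 1)))"
          using that by (intro sph_harm_weight_singular) auto
        also have "\<dots> \<le> ennreal (4 / 3 * (real l + 1)\<^sup>2)"
          by (intro ennreal_leI) (simp add: power2_eq_square)
        finally show ?thesis .
      qed
      have "(\<integral>\<^sup>+\<omega>. ennreal ((cmod (dilation a f \<omega>))\<^sup>2 * sin (fst \<omega>) ^ 3) \<partial>sphere_measure)
        \<le> (\<integral>\<^sup>+\<omega>. ennreal ((cmod (dilation a f \<omega>))\<^sup>2 * sqrt (a\<^sup>2 + (sin (fst \<omega>))\<^sup>2) ^ 3) \<partial>sphere_measure)"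
      proof (rule nn_integral_mono_AE)
        show "AE \<omega> in sphere_measure. ennreal ((cmod (dilation a f \<omega>))\<^sup>2 * sin (fst \<omega>) ^ 3) \<le> ennreal ((cmod (dilation a f \<omega>))\<^sup>2 * sqrt (a\<^sup>2 + (sin (fst \<omega>))\<^sup>2) ^ 3)"
          using AE_sphere_interior
        proof eventually_elim
          case (elim \<omega>)
          then have "sin (fst \<omega>) > 0" by (intro sin_gt_zero) auto
          moreover have "sin (fst \<omega>) \<le> sqrt (a\<^sup>2 + (sin (fst \<omega>))\<^sup>2)" by (rule real_le_rsqrt) simp
          ultimately show ?case by (intro ennreal_leI mult_left_mono power_mono) auto
        qed
      qed
      also have "\<dots> \<le> ennreal (128 * pi * K\<^sup>2 * a ^ 3)" by (rule dilation_weight_bound[OF a f K bd])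
      finally show "(\<integral>\<^sup>+\<omega>. ennreal ((cmod (dilation a f \<omega>))\<^sup>2 * sin (fst \<omega>) ^ 3) \<partial>sphere_measure) \<le> ennreal (128 * pi * K\<^sup>2 * a ^ 3)" .
      show "dilation a f \<in> borel_measurable sphere_measure" by (rule dilation_measurable[OF a f])
      show "0 < sin \<theta> ^ 3" if "0 < \<theta>" "\<theta> < pi" for \<theta> using sin_gt_zero[OF that] by simp
      show "4 / 3 * (real l + 1)\<^sup>2 > 0" by (intro mult_pos_pos zero_less_power) auto
    qed (use a in auto)
  qed
  finally show ?thesis by (simp add: mult_ac)
qed

lemma nn_integral_inverse_square:
  assumes "t > 0"
  shows "(\<integral>\<^sup>+a. ennreal (1 / a\<^sup>2) * indicator {t..} a \<partial>lborel) = ennreal (1 / t)"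
proof -
  have "(\<integral>\<^sup>+a. ennreal (1 / a\<^sup>2) * indicator {t..} a \<partial>lborel) = ennreal (0 - - (1 / t))"
  proof (rule nn_integral_FTC_atLeast)
    show "((\<lambda>x. - (1 / x)) has_real_derivative 1 / x\<^sup>2) (at x)" if "t \<le> x" for x :: real
      using that assms by (auto intro!: derivative_eq_intros simp: power2_eq_square)
    have "((\<lambda>x::real. - (1 / x)) \<longlongrightarrow> - 0) at_top"
      by (intro tendsto_minus tendsto_divide_0[OF tendsto_const] filterlim_at_top_imp_at_infinity filterlim_ident)
    then show "((\<lambda>x::real. - (1 / x)) \<longlongrightarrow> 0) at_top" by simp
  qed auto
  then show ?thesis by simp
qed

theorem mainTheorem7:
  fixes \<eta> :: "real \<times> real \<Rightarrow> complex"
  assumes L2: "\<eta> \<in> L2_sphere"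
    and A1: "(\<integral>\<^sup>+\<omega>. ennreal (cmod (\<eta> \<omega>) / (1 + cos (fst \<omega>))) \<partial>sphere_measure) < \<infinity>"
    and A2: "(\<integral>\<^sup>+\<omega>. ennreal (cmod (\<eta> \<omega>) * (tan (fst \<omega> / 2))\<^sup>2 / (1 + cos (fst \<omega>)))
               \<partial>sphere_measure) < \<infinity>"
    and A3: "esssup sphere_measure
               (\<lambda>\<omega>. ereal (cmod (\<eta> \<omega>) * (1 + (tan (fst \<omega> / 2))\<^sup>2) / (1 - cos (fst \<omega>)))) < \<infinity>"
    and C: "(\<integral>\<omega>. \<eta> \<omega> / complex_of_real (1 + cos (fst \<omega>)) \<partial>sphere_measure) = 0"
  shows "\<exists>B::real. \<forall>l. G_coeff \<eta> l \<le> ennreal B"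
proof -
  have m [measurable]: "\<eta> \<in> borel_measurable sphere_measure" using L2 by (simp add: L2_sphere_def)
  have [measurable]: "(\<lambda>\<omega>. tan (fst \<omega> / 2)) \<in> borel_measurable sphere_measure"
    unfolding tan_def by measurable
  obtain K where K: "K \<ge> 0" "AE \<omega> in sphere_measure. cmod (\<eta> \<omega>) * (1 + (tan (fst \<omega> / 2))\<^sup>2) / (1 - cos (fst \<omega>)) \<le> K"
  proof -
    let ?g = "\<lambda>\<omega>. cmod (\<eta> \<omega>) * (1 + (tan (fst \<omega> / 2))\<^sup>2) / (1 - cos (fst \<omega>))"
    obtain k where k: "esssup sphere_measure (\<lambda>\<omega>. ereal (?g \<omega>)) \<le> ereal k"
      using A3 by (cases "esssup sphere_measure (\<lambda>\<omega>. ereal (?g \<omega>))") auto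
    have "AE \<omega> in sphere_measure. ?g \<omega> \<le> max k 0"
      using esssup_AE[of "\<lambda>\<omega>. ereal (?g \<omega>)" sphere_measure]
    proof eventually_elim
      case (elim \<omega>)
      then have "ereal (?g \<omega>) \<le> ereal k" using k by (rule order_trans)
      then show ?case by simp
    qed
    then show ?thesis by (intro that[of "max k 0"]) auto
  qed
  \<comment> \<open>The sum of the integrands of (A1) and (A2), which is the majorant that
    \<open>zonal_coeff_bound\<close> needs.\<close>
  let ?j = "\<lambda>\<omega>. cmod (\<eta> \<omega>) / (1 + cos (fst \<omega>)) * (1 + (tan (fst \<omega> / 2))\<^sup>2)"
  have c0: "1 + cos (fst \<omega>) \<ge> 0" for \<omega> :: "real \<times> real"
    using cos_ge_minus_one[of "fst \<omega>"] by linarith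
  then have j0: "?j \<omega> \<ge> 0" for \<omega> by (intro mult_nonneg_nonneg divide_nonneg_nonneg) auto
  have Ji: "integrable sphere_measure ?j"
  proof (rule integrableI_nonneg)
    have "(\<integral>\<^sup>+\<omega>. ennreal (?j \<omega>) \<partial>sphere_measure) = (\<integral>\<^sup>+\<omega>. ennreal (cmod (\<eta> \<omega>) / (1 + cos (fst \<omega>)))
       + ennreal (cmod (\<eta> \<omega>) * (tan (fst \<omega> / 2))\<^sup>2 / (1 + cos (fst \<omega>))) \<partial>sphere_measure)"
    proof (rule nn_integral_cong)
      fix \<omega> :: "real \<times> real"
      show "ennreal (?j \<omega>) = ennreal (cmod (\<eta> \<omega>) / (1 + cos (fst \<omega>)))
       + ennreal (cmod (\<eta> \<omega>) * (tan (fst \<omega> / 2))\<^sup>2 / (1 + cos (fst \<omega>)))"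
        using c0 by (subst ennreal_plus[symmetric]) (auto simp: algebra_simps add_divide_distrib)
    qed
    also have "\<dots> < \<infinity>" using A1 A2 by (subst nn_integral_add) auto
    finally show "(\<integral>\<^sup>+\<omega>. ennreal (?j \<omega>) \<partial>sphere_measure) < \<infinity>" .
  qed (use j0 in auto)
  define J where "J = (\<integral>\<omega>. ?j \<omega> \<partial>sphere_measure)"
  define Q where "Q = 128 * pi * K\<^sup>2"
  have Q0: "Q \<ge> 0" by (simp add: Q_def)
  have "G_coeff \<eta> l \<le> ennreal (36 * J\<^sup>2 + 8 / 3 * Q + Q)" for l
  proof -
    define t where "t = 2 / (real l + 1)"
    have t0: "t > 0" by (simp add: t_def)
    \<comment> \<open>A bound for the integrand below t: a (l+1) \<le> 2 turns the a^4 term into 9 *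
      2 = 18, and (l+1)^2 is enlarged to (2l+1)(l+1) to give both terms a common factor.\<close>
    define D where "D = (2 * real l + 1) * (real l + 1) * (18 * J\<^sup>2 + 4 / 3 * Q)"
    have D0: "D \<ge> 0" using Q0 by (simp add: D_def)
    let ?S = "\<lambda>a. \<Sum>m\<in>{-int l..int l}. (cmod (inner_S2 (dilation a \<eta>) (sph_harm l m)))\<^sup>2"
    have pt: "normsq_S2 (proj_l l (dilation a \<eta>)) * ennreal (1 / a ^ 3) * indicator {0<..} a
       \<le> ennreal D * indicator {0..t} a + ennreal (2 * Q) * (ennreal (1 / a\<^sup>2) * indicator {t..} a)" for a
    proof (cases "a > 0")
      case True
      have n: "normsq_S2 (proj_l l (dilation a \<eta>)) * ennreal (1 / a ^ 3) = ennreal (?S a / a ^ 3)"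
        unfolding normsq_proj_l using True by (subst ennreal_mult'[symmetric]) (auto intro: sum_nonneg)
      show ?thesis
      proof (cases "a \<ge> t")
        case t: True
        have "?S a \<le> 2 * Q * a" unfolding Q_def by (rule proj_dilation_large_scale[OF t[unfolded t_def] m K])
        then have "?S a / a ^ 3 \<le> 2 * Q * a / a ^ 3" using True by (intro divide_right_mono) auto
        also have "\<dots> = 2 * Q * (1 / a\<^sup>2)" using True by (simp add: power2_eq_square power3_eq_cube)
        finally have "ennreal (?S a / a ^ 3) \<le> ennreal (2 * Q) * ennreal (1 / a\<^sup>2)"
          using Q0 by (subst ennreal_mult'[symmetric]) (auto intro: ennreal_leI)
        then show ?thesis unfolding n using True t by (simp add: add_increasing)
      next
        case t: False
        have "?S a \<le> 9 * (2 * real l + 1) * (real l + 1)\<^sup>2 * J\<^sup>2 * a ^ 4 + 4 / 3 * (real l + 1)\<^sup>2 * Q * a ^ 3"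
          unfolding Q_def by (rule proj_dilation_small_scale[OF True m K Ji J_def C])
        then have "?S a / a ^ 3 \<le> (9 * (2 * real l + 1) * (real l + 1)\<^sup>2 * J\<^sup>2 * a ^ 4 + 4 / 3 * (real l + 1)\<^sup>2 * Q * a ^ 3) / a ^ 3"
          using True by (intro divide_right_mono) auto
        also have "\<dots> = 9 * (2 * real l + 1) * (real l + 1) * J\<^sup>2 * (a * (real l + 1)) + 4 / 3 * Q * ((real l + 1) * (real l + 1))"
          using True by (simp add: field_simps power2_eq_square eval_nat_numeral)
        also have "\<dots> \<le> 9 * (2 * real l + 1) * (real l + 1) * J\<^sup>2 * 2 + 4 / 3 * Q * ((2 * real l + 1) * (real l + 1))"
        proof (intro add_mono mult_left_mono mult_right_mono)
          show "a * (real l + 1) \<le> 2" using t by (simp add: t_def field_simps)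
        qed (use Q0 in auto)
        also have "\<dots> = D" by (simp add: D_def algebra_simps)
        finally have "ennreal (?S a / a ^ 3) \<le> ennreal D" by (rule ennreal_leI)
        then show ?thesis unfolding n using True t by simp
      qed
    qed auto
    have "(\<integral>\<^sup>+a\<in>{0<..}. normsq_S2 (proj_l l (dilation a \<eta>)) * ennreal (1 / a ^ 3) \<partial>lborel)
      \<le> (\<integral>\<^sup>+a. ennreal D * indicator {0..t} a + ennreal (2 * Q) * (ennreal (1 / a\<^sup>2) * indicator {t..} a) \<partial>lborel)"
      by (intro nn_integral_mono pt)
    also have "\<dots> = ennreal D * ennreal t + ennreal (2 * Q) * ennreal (1 / t)"
      using t0 by (subst nn_integral_add) (auto simp: nn_integral_cmult nn_integral_inverse_square)
    also have "\<dots> = ennreal (D * t + 2 * Q * (1 / t))"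
    proof -
      have "ennreal D * ennreal t = ennreal (D * t)" using D0 by (simp add: ennreal_mult')
      moreover have "ennreal (2 * Q) * ennreal (1 / t) = ennreal (2 * Q * (1 / t))"
        using Q0 by (intro ennreal_mult'[symmetric]) simp
      moreover have "D * t \<ge> 0" "2 * Q * (1 / t) \<ge> 0" using D0 Q0 t0 by auto
      ultimately show ?thesis by (simp only: ennreal_plus)
    qed
    finally have "G_coeff \<eta> l \<le> ennreal (1 / (2 * real l + 1)) * ennreal (D * t + 2 * Q * (1 / t))"
      unfolding G_coeff_def by (intro mult_left_mono) auto
    also have "\<dots> = ennreal (1 / (2 * real l + 1) * (D * t + 2 * Q * (1 / t)))"
      by (rule ennreal_mult'[symmetric]) simp
    \<comment> \<open>The choice of t balances both ranges: D t is a constant times 2l+1, and 2 Q /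
      t = Q (l+1). After division by 2l+1 only the quotient (l+1)/(2l+1) \<le> 1 still depends on
      l.\<close>
    also have "1 / (2 * real l + 1) * (D * t + 2 * Q * (1 / t)) = 2 * (18 * J\<^sup>2 + 4 / 3 * Q) + Q * ((real l + 1) / (2 * real l + 1))"
    proof -
      have "D * t = (2 * real l + 1) * (2 * (18 * J\<^sup>2 + 4 / 3 * Q))" by (simp add: D_def t_def)
      moreover have "2 * Q * (1 / t) = Q * (real l + 1)" by (simp add: t_def)
      ultimately show ?thesis by (simp add: distrib_left add_divide_distrib)
    qed
    also have "\<dots> \<le> 36 * J\<^sup>2 + 8 / 3 * Q + Q"
      using mult_left_mono[of "(real l + 1) / (2 * real l + 1)" 1 Q] Q0 by (simp add: divide_le_eq)
    finally show ?thesis by (simp add: ennreal_leI)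
  qed
  then show ?thesis by blast
qed

end
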